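(* Fix a positive integer $n$. Let $m$ be a positive integer, $k\in\{0,1,\dotsc,n-1\}$ and let $\lambda$ be a partition of $n$. Let $\mu$ be a partition of $mn$ with exactly $l(\mu)=n-k$ parts, and set $\hat{\mu}:=\mu-(1^{n-k})$, a partition of $(m-1)n+k$. Then \[ a^\mu_{\lambda',(m)} = \sum_{i=0}^k (-1)^{k+i} \sum_{\substack{\alpha\vdash k+(m-1)i\\ \beta\vdash i}} a^{\alpha/(k-i)}_{\beta',(m)}\cdot a^{\hat{\mu}/\alpha}_{\lambda/\beta,(m-1)}. \]
   Context: For a partition $\lambda$: $l(\lambda)$ is the number of (nonzero) parts, $\lambda'$ is the conjugate partition, $\lambda\vdash n$ means $\lambda$ is a partition of $n$; the only partition of $0$ is $\emptyset$. $(r)$ denotes the one-part partition, with $(0)=\emptyset$. $\mu-(1^{n-k})$ is obtained from $\mu$ by subtracting $1$ from each of its $n-k$ parts (i.e. removing the first column) and discarding zeros. Plethysm coefficients: for partitions $\lambda,\mu,\nu$, $a^\mu_{\lambda,\nu}:=\langle s_\lambda\circ s_\nu, s_\mu\rangle$ is the multiplicity of the Schur function $s_\mu$ in the plethysm $s_\lambda\circ s_\nu$; it is $0$ if $|\mu|\ne|\lambda|\cdot|\nu|$. In particular, $a^\zeta_{\eta,\emptyset}=1$ if $\zeta=\emptyset$ and $\eta=(n)$ for some $n\ge 0$, and $a^\zeta_{\eta,\emptyset}=0$ otherwise; also $a^{\emptyset}_{\emptyset,\nu}=1$. Skew plethysm coefficients: for partitions $\alpha,\beta,\gamma,\delta,\nu$,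 \[ a^{\alpha/\beta}_{\gamma/\delta,\nu}:=\sum_{\eta\vdash|\gamma|-|\delta|,\ \zeta\vdash|\alpha|-|\beta|} c^\gamma_{\eta,\delta}\cdot c^\alpha_{\zeta,\beta}\cdot a^\zeta_{\eta,\nu}, \] where $c^{\cdot}_{\cdot,\cdot}$ are Littlewood--Richardson coefficients. In particular this is $0$ if $\beta\not\subseteq\alpha$ or $\delta\not\subseteq\gamma$. A non-skew shape $\gamma$ is identified with $\gamma/\emptyset$. *)

theory Defs
  imports Complex_Main "HOL-Library.FuncSet" "HOL-Library.Poly_Mapping"
begin

section \<open>Formal power series in the variables \<open>x\<^sub>0, x\<^sub>1, x\<^sub>2, \<dots>\<close>\<close>

text \<open>
  A monomial is a finitely supported exponent vector \<open>nat \<Rightarrow>\<^sub>0 nat\<close>. Symmetric functions are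
  series in infinitely many variables, so a series is an arbitrary function on monomials.
\<close>

typedef 'a mps = "UNIV :: ((nat \<Rightarrow>\<^sub>0 nat) \<Rightarrow> 'a) set"
  morphisms mps_coeff Abs_mps ..

lemma mps_eqI: "(\<And>\<theta>. mps_coeff f \<theta> = mps_coeff g \<theta>) \<Longrightarrow> f = g"
  by (metis ext mps_coeff_inject)

lemma mps_coeff_Abs [simp]: "mps_coeff (Abs_mps f) = f"
  by (simp add: Abs_mps_inverse)

definition mono_splits :: "(nat \<Rightarrow>\<^sub>0 nat) \<Rightarrow> ((nat \<Rightarrow>\<^sub>0 nat) \<times> (nat \<Rightarrow>\<^sub>0 nat)) set" where
  "mono_splits \<theta> = {(a, b). a + b = \<theta>}"

lemma finite_mono_splits [simp]: "finite (mono_splits \<theta>)"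
proof -
  let ?keys = "Poly_Mapping.keys \<theta>"
  let ?B = "{..Max (insert 0 (Poly_Mapping.lookup \<theta> ` ?keys))}"
  let ?S = "{f. \<forall>x. (x \<in> ?keys \<longrightarrow> f x \<in> ?B) \<and> (x \<notin> ?keys \<longrightarrow> f x = 0)}"
  let ?A = "{a. Poly_Mapping.lookup a \<in> ?S}"
  have "finite ?S" by (rule finite_set_of_finite_funs) simp_all
  then have "finite (Poly_Mapping.lookup -` ?S)"
    by (rule finite_vimageI) (auto simp: inj_on_def lookup_inject)
  then have fin: "finite ?A" by (simp add: vimage_def)
  have mem: "a \<in> ?A" if "a + b = \<theta>" for a b
  proof -
    have le: "Poly_Mapping.lookup a x \<le> Poly_Mapping.lookup \<theta> x" for x
      using that by (auto simp: lookup_add)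
    have "Poly_Mapping.lookup a x \<in> ?B" if "x \<in> ?keys" for x
      unfolding atMost_iff by (rule order_trans[OF le]) (use that in \<open>auto intro!: Max_ge\<close>)
    moreover have "Poly_Mapping.lookup a x = 0" if "x \<notin> ?keys" for x
      using le[of x] that by (simp add: in_keys_iff)
    ultimately show ?thesis by auto
  qed
  have "mono_splits \<theta> \<subseteq> ?A \<times> ?A"
  proof
    fix p assume "p \<in> mono_splits \<theta>"
    then have "fst p + snd p = \<theta>" "snd p + fst p = \<theta>"
      by (auto simp: mono_splits_def add.commute)
    then show "p \<in> ?A \<times> ?A" unfolding mem_Times_iff by (intro conjI) (erule mem)+
  qed
  then show ?thesis by (rule finite_subset) (rule finite_cartesian_product[OF fin fin])
qed

instantiation mps :: (comm_ring_1) comm_ring_1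
begin

definition "0 = Abs_mps (\<lambda>_. 0)"
definition "1 = Abs_mps (\<lambda>\<theta>. if \<theta> = 0 then 1 else 0)"
definition "f + g = Abs_mps (\<lambda>\<theta>. mps_coeff f \<theta> + mps_coeff g \<theta>)"
definition "f - g = Abs_mps (\<lambda>\<theta>. mps_coeff f \<theta> - mps_coeff g \<theta>)"
definition "- f = Abs_mps (\<lambda>\<theta>. - mps_coeff f \<theta>)"
definition "f * g = Abs_mps (\<lambda>\<theta>. \<Sum>(a, b)\<in>mono_splits \<theta>. mps_coeff f a * mps_coeff g b)"

instance
proof
  fix f g h :: "'a mps"
  show "f * g * h = f * (g * h)"
  proof (rule mps_eqI)
    fix \<theta>
    have "mps_coeff (f * g * h) \<theta> =
        (\<Sum>p\<in>mono_splits \<theta>. \<Sum>q\<in>mono_splits (fst p).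
          mps_coeff f (fst q) * mps_coeff g (snd q) * mps_coeff h (snd p))"
      by (simp add: times_mps_def case_prod_unfold sum_distrib_right)
    also have "\<dots> = (\<Sum>(p, q)\<in>(SIGMA p:mono_splits \<theta>. mono_splits (fst p)).
          mps_coeff f (fst q) * mps_coeff g (snd q) * mps_coeff h (snd p))"
      by (subst sum.Sigma) auto
    also have "\<dots> = (\<Sum>(p, q)\<in>(SIGMA p:mono_splits \<theta>. mono_splits (snd p)).
          mps_coeff f (fst p) * (mps_coeff g (fst q) * mps_coeff h (snd q)))"
      by (rule sum.reindex_bij_witness[where
            i = "\<lambda>(p, q). ((fst p + fst q, snd q), (fst p, fst q))" and
            j = "\<lambda>(p, q). ((fst q, snd q + snd p), (snd q, snd p))"])
        (auto simp: mono_splits_def add.assoc mult.assoc)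
    also have "\<dots> = (\<Sum>p\<in>mono_splits \<theta>. \<Sum>q\<in>mono_splits (snd p).
          mps_coeff f (fst p) * (mps_coeff g (fst q) * mps_coeff h (snd q)))"
      by (subst sum.Sigma) auto
    also have "\<dots> = mps_coeff (f * (g * h)) \<theta>"
      by (simp add: times_mps_def case_prod_unfold sum_distrib_left)
    finally show "mps_coeff (f * g * h) \<theta> = mps_coeff (f * (g * h)) \<theta>" .
  qed
  show "f * g = g * f"
  proof (rule mps_eqI)
    fix \<theta>
    show "mps_coeff (f * g) \<theta> = mps_coeff (g * f) \<theta>"
      unfolding times_mps_def mps_coeff_Abs
      by (rule sum.reindex_bij_witness[where i = prod.swap and j = prod.swap])
        (auto simp: mono_splits_def add.commute mult.commute)
  qed
  show "1 * f = f"
  proof (rule mps_eqI)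
    fix \<theta>
    have "mps_coeff (1 * f) \<theta> =
        (\<Sum>p\<in>mono_splits \<theta>. if p = (0, \<theta>) then mps_coeff f \<theta> else 0)"
      unfolding times_mps_def one_mps_def mps_coeff_Abs
      by (rule sum.cong) (auto simp: mono_splits_def split: if_splits)
    also have "\<dots> = mps_coeff f \<theta>"
      by (subst sum.delta) (simp_all, simp add: mono_splits_def)
    finally show "mps_coeff (1 * f) \<theta> = mps_coeff f \<theta>" .
  qed
  show "(f + g) * h = f * h + g * h"
    by (rule mps_eqI)
      (simp add: times_mps_def plus_mps_def case_prod_unfold distrib_right sum.distrib)
  show "(0::'a mps) \<noteq> 1"
  proof
    assume "(0::'a mps) = 1"
    then have "mps_coeff (0::'a mps) 0 = mps_coeff 1 0" by (rule arg_cong)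
    then show False by (simp add: zero_mps_def one_mps_def)
  qed
qed (auto intro!: mps_eqI simp: zero_mps_def plus_mps_def minus_mps_def uminus_mps_def)

end

definition mps_scale :: "'a \<Rightarrow> 'a mps \<Rightarrow> 'a::comm_ring_1 mps" where
  "mps_scale c f = Abs_mps (\<lambda>\<theta>. c * mps_coeff f \<theta>)"

global_interpretation mps: vector_space "mps_scale :: 'a::field \<Rightarrow> 'a mps \<Rightarrow> 'a mps"
  by unfold_locales
    (auto intro!: mps_eqI simp: mps_scale_def plus_mps_def distrib_left distrib_right)


section \<open>Partitions\<close>

definition is_partition :: "nat list \<Rightarrow> bool" where
  "is_partition lam \<longleftrightarrow> sorted_wrt (\<ge>) lam \<and> 0 \<notin> set lam"

definition partitions_of :: "nat \<Rightarrow> nat list set" where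
  "partitions_of n = {lam. is_partition lam \<and> sum_list lam = n}"

lemma finite_partitions_of [simp]: "finite (partitions_of n)"
proof (rule finite_subset)
  have "length xs \<le> sum_list xs" if "0 \<notin> set xs" for xs :: "nat list"
    using that by (induction xs) (auto simp: Suc_le_eq add_mono)
  then show "partitions_of n \<subseteq> {xs. set xs \<subseteq> {..n} \<and> length xs \<le> n}"
    by (auto simp: partitions_of_def is_partition_def member_le_sum_list)
  show "finite {xs. set xs \<subseteq> {..n} \<and> length xs \<le> n}"
    by (rule finite_lists_length_le) simp
qed

definition conjugate :: "nat list \<Rightarrow> nat list" where
  "conjugate lam =
    (case lam of [] \<Rightarrow> [] | p # _ \<Rightarrow> map (\<lambda>j. length (filter (\<lambda>q. j < q) lam)) [0..<p])"

definition one_row :: "nat \<Rightarrow> nat list" where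
  "one_row r = (if r = 0 then [] else [r])"

definition remove_first_column :: "nat list \<Rightarrow> nat list" where
  "remove_first_column \<mu> = filter (\<lambda>p. p \<noteq> 0) (map (\<lambda>p. p - 1) \<mu>)"


section \<open>Schur functions\<close>

definition cells :: "nat list \<Rightarrow> (nat \<times> nat) set" where
  "cells lam = {(i, j). i < length lam \<and> j < lam ! i}"

text \<open>Entries are variable indices and hence start at 0.\<close>

definition semistandard_tableaux :: "nat list \<Rightarrow> (nat \<times> nat \<Rightarrow> nat) set" where
  "semistandard_tableaux lam = {T \<in> extensional (cells lam).
     (\<forall>i j. (i, j) \<in> cells lam \<and> (i, Suc j) \<in> cells lam \<longrightarrow> T (i, j) \<le> T (i, Suc j)) \<and>
     (\<forall>i j. (i, j) \<in> cells lam \<and> (Suc i, j) \<in> cells lam \<longrightarrow> T (i, j) < T (Suc i, j))}"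

definition has_content :: "nat list \<Rightarrow> (nat \<times> nat \<Rightarrow> nat) \<Rightarrow> (nat \<Rightarrow>\<^sub>0 nat) \<Rightarrow> bool" where
  "has_content lam T \<theta> \<longleftrightarrow> (\<forall>v. card {c \<in> cells lam. T c = v} = Poly_Mapping.lookup \<theta> v)"

definition schur :: "nat list \<Rightarrow> rat mps" where
  "schur lam = Abs_mps (\<lambda>\<theta>. of_nat (card {T \<in> semistandard_tableaux lam. has_content lam T \<theta>}))"

text \<open>
  The Schur functions of all partitions are a basis of the rational symmetric functions
  (of bounded degree). \<open>schur_coeff f \<mu>\<close> is the multiplicity of \<open>s\<^sub>\<mu>\<close> in \<open>f\<close>, and the Hall inner
  product is the one making this basis orthonormal.
\<close>

definition schur_coeff :: "rat mps \<Rightarrow> nat list \<Rightarrow> rat" where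
  "schur_coeff f \<mu> = mps.representation (schur ` Collect is_partition) f (schur \<mu>)"

definition hall_inner :: "rat mps \<Rightarrow> rat mps \<Rightarrow> rat" where
  "hall_inner f g =
    (\<Sum>\<mu> | is_partition \<mu> \<and> schur_coeff f \<mu> \<noteq> 0. schur_coeff f \<mu> * schur_coeff g \<mu>)"


section \<open>Plethysm\<close>

text \<open>\<open>adams k g\<close> is \<open>g(x\<^sub>0\<^sup>k, x\<^sub>1\<^sup>k, \<dots>)\<close>; for \<open>k > 0\<close> the sum has at most one term.\<close>

definition adams :: "nat \<Rightarrow> rat mps \<Rightarrow> rat mps" where
  "adams k g = Abs_mps (\<lambda>\<theta>. \<Sum>\<eta> | Poly_Mapping.map ((*) k) \<eta> = \<theta>. mps_coeff g \<eta>)"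

definition power_sum :: "nat \<Rightarrow> rat mps" where
  "power_sum k = Abs_mps (\<lambda>\<theta>. if \<exists>i. \<theta> = Poly_Mapping.single i k then 1 else 0)"

definition power_sum_prod :: "nat list \<Rightarrow> rat mps" where
  "power_sum_prod \<rho> = prod_list (map power_sum \<rho>)"

definition power_sum_coeff :: "rat mps \<Rightarrow> nat list \<Rightarrow> rat" where
  "power_sum_coeff f \<rho> =
    mps.representation (power_sum_prod ` Collect is_partition) f (power_sum_prod \<rho>)"

text \<open>
  The products \<open>p\<^sub>\<rho>\<close> are a basis of the rational symmetric functions, and \<open>f \<mapsto> f \<circ> g\<close> is the
  algebra homomorphism with \<open>p\<^sub>k \<circ> g = g(x\<^sub>0\<^sup>k, x\<^sub>1\<^sup>k, \<dots>)\<close>.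
\<close>

definition plethysm :: "rat mps \<Rightarrow> rat mps \<Rightarrow> rat mps" where
  "plethysm f g = (\<Sum>\<rho> | is_partition \<rho> \<and> power_sum_coeff f \<rho> \<noteq> 0.
     mps_scale (power_sum_coeff f \<rho>) (prod_list (map (\<lambda>k. adams k g) \<rho>)))"

definition plethysm_coeff :: "nat list \<Rightarrow> nat list \<Rightarrow> nat list \<Rightarrow> rat" where
  "plethysm_coeff \<mu> lam \<nu> = hall_inner (plethysm (schur lam) (schur \<nu>)) (schur \<mu>)"

definition lr_coeff :: "nat list \<Rightarrow> nat list \<Rightarrow> nat list \<Rightarrow> rat" where
  "lr_coeff lam \<mu> \<nu> = hall_inner (schur \<mu> * schur \<nu>) (schur lam)"

text \<open>
  \<open>skew_plethysm_coeff \<alpha> \<beta> \<gamma> \<delta> \<nu>\<close> is \<open>a\<close> with upper index \<open>\<alpha>/\<beta>\<close> and lower indices \<open>\<gamma>/\<delta>, \<nu>\<close>.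
  The size conditions are written additively, so that they are unsatisfiable
  when \<open>|\<delta>| > |\<gamma>|\<close> or \<open>|\<beta>| > |\<alpha>|\<close>.
\<close>

definition skew_plethysm_coeff ::
    "nat list \<Rightarrow> nat list \<Rightarrow> nat list \<Rightarrow> nat list \<Rightarrow> nat list \<Rightarrow> rat" where
  "skew_plethysm_coeff \<alpha> \<beta> \<gamma> \<delta> \<nu> =
    (\<Sum>\<eta> | is_partition \<eta> \<and> sum_list \<eta> + sum_list \<delta> = sum_list \<gamma>.
     \<Sum>\<zeta> | is_partition \<zeta> \<and> sum_list \<zeta> + sum_list \<beta> = sum_list \<alpha>.
       lr_coeff \<gamma> \<eta> \<delta> * lr_coeff \<alpha> \<zeta> \<beta> * plethysm_coeff \<zeta> \<eta> \<nu>)"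

end

theory Submission
  imports Defs "HOL-Computational_Algebra.Formal_Power_Series"
begin

text \<open>
  Write \<open>\<nu>\<close> for \<open>\<mu>\<close> without its first column, \<open>r\<close> for the number of parts of \<open>\<mu>\<close>, and
  \<open>f\<^sup>\<bottom>\<close> for the adjoint of multiplication by \<open>f\<close>. Adding a column of length \<open>r\<close> is a Bernstein
  operator, \<open>s\<^sub>\<mu> = \<Sum>\<^sub>i (-1)\<^sup>i e\<^sub>r\<^sub>+\<^sub>i h\<^sub>i\<^sup>\<bottom> s\<^sub>\<nu>\<close>, so the coefficient of \<open>s\<^sub>\<mu>\<close> in
  \<open>F = s\<^sub>\<lambda>\<^sub>' \<circ> h\<^sub>m\<close> is the sum of the coefficients of \<open>s\<^sub>\<nu>\<close> in
  \<open>(-1)\<^sup>i h\<^sub>i \<cdot> e\<^sub>r\<^sub>+\<^sub>i\<^sup>\<bottom> F\<close>. The total operator \<open>\<Sum>\<^sub>j e\<^sub>j\<^sup>\<bottom>\<close> is a ring homomorphism which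
  maps \<open>p\<^sub>k \<circ> h\<^sub>m\<close> to \<open>p\<^sub>k \<circ> h\<^sub>m + (-1)\<^sup>k\<^sup>-\<^sup>1 p\<^sub>k \<circ> h\<^sub>m\<^sub>-\<^sub>1\<close>. Together with the coproduct of
  \<open>s\<^sub>\<lambda>\<^sub>'\<close> and the conjugation involution this gives
  \<open>e\<^sub>j\<^sup>\<bottom> F = \<Sum>\<^sub>\<beta> (s\<^sub>\<beta>\<^sub>' \<circ> h\<^sub>m) (s\<^sub>\<lambda>\<^sub>/\<^sub>\<beta> \<circ> h\<^sub>m\<^sub>-\<^sub>1)\<close> with \<open>|\<beta>| = n - j\<close>.
\<close>

section \<open>Partitions and strips\<close>

text \<open>The skewing operators are understood on Schur functions, plethysm on power sums, and the
  proof has to link the two bases. The link is the family \<open>h r\<close>: a linear map given on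
  Schur functions is a ring homomorphism once it is compatible with multiplication by each
  \<open>h r\<close>, which the Pieri rule makes a statement about strips; Newton's identities then
  give its values on power sums. One bijection, \<open>card_strip_exchange\<close>, carries both the
  Pieri rule for \<open>h r\<close> and the multiplicativity of \<open>skew_h\<close>, and the
  latter yields the coproduct. The sign of the summand \<open>p_k \<circ> h_(m-1)\<close> is the one
  with which \<open>omega\<close> acts on \<open>p_k\<close>. Absorbing it conjugates the second
  factor of the coproduct; hence \<lambda>' stands on the left of the theorem and \<lambda>/\<beta>
  on the right. Degrees fix the constants. With j = r + i and r = n - k, the Bernstein index i
  satisfies |\<beta>| = k - i, so only |\<beta>| up to k occurs. Renaming |\<beta>| to i leaves
  \<open>h_(k-i)\<close> with sign (-1)^(k-i), and \<alpha> indexes the Schur expansion of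
  \<open>h_(k-i)\<close> times \<open>s_\<beta>' \<circ> h_m\<close>, of degree k - i + m i = k + (m
  - 1) i.\<close>

definition part :: "nat list \<Rightarrow> nat \<Rightarrow> nat" where
  "part lam i = (if i < length lam then lam ! i else 0)"

text \<open>Inverse to \<open>part\<close>, whose padding by zeros makes strip conditions meaningful
  at every index. Bijections on partitions are built below as functions of the row index and turned
  into lists by this map.\<close>

definition of_parts :: "(nat \<Rightarrow> nat) \<Rightarrow> nat list" where
  "of_parts f = map f [0..<(LEAST N. f N = 0)]"

lemma part_Nil [simp]: "part [] i = 0"
  by (simp add: part_def)

lemma part_Cons_0 [simp]: "part (a # lam) 0 = a"
  by (simp add: part_def)

lemma part_Cons_Suc [simp]: "part (a # lam) (Suc i) = part lam i"
  by (simp add: part_def)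

lemma part_beyond: "length lam \<le> i \<Longrightarrow> part lam i = 0"
  by (simp add: part_def)

lemma is_partition_Nil [simp]: "is_partition []"
  by (simp add: is_partition_def)

lemma part_antimono:
  assumes "is_partition lam" "i \<le> j"
  shows "part lam j \<le> part lam i"
  using assms by (auto simp: part_def is_partition_def sorted_wrt_iff_nth_less le_less)

lemma part_pos_iff: "is_partition lam \<Longrightarrow> 0 < part lam i \<longleftrightarrow> i < length lam"
  by (auto simp: part_def is_partition_def) (metis gr0I nth_mem)

lemma partition_eqI:
  assumes "is_partition lam" "is_partition mu" "\<And>i. part lam i = part mu i"
  shows "lam = mu"
proof -
  have "i < length lam \<longleftrightarrow> i < length mu" for i
    using part_pos_iff[OF assms(1)] part_pos_iff[OF assms(2)] assms(3) by metis
  then have len: "length lam = length mu"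
    by (metis linorder_neqE_nat less_irrefl)
  show ?thesis
  proof (rule nth_equalityI[OF len])
    fix i assume "i < length lam"
    then show "lam ! i = mu ! i" using assms(3)[of i] len by (simp add: part_def)
  qed
qed

lemma
  assumes anti: "\<And>i j. i \<le> j \<Longrightarrow> f j \<le> f i" and zero: "f N = (0::nat)"
  shows is_partition_of_parts: "is_partition (of_parts f)"
    and part_of_parts: "part (of_parts f) = f"
    and length_of_parts_le: "length (of_parts f) \<le> N"
proof -
  define L where "L = (LEAST N. f N = 0)"
  have L0: "f L = 0" unfolding L_def by (rule LeastI[of "\<lambda>N. f N = 0", OF zero])
  have pos: "0 < f i" if "i < L" for i
    using not_less_Least[of i "\<lambda>N. f N = 0"] that by (simp add: L_def)
  have beyond: "f i = 0" if "L \<le> i" for i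
    using anti[OF that] L0 by simp
  show "is_partition (of_parts f)"
    unfolding is_partition_def of_parts_def L_def[symmetric]
    using anti by (auto simp: sorted_wrt_iff_nth_less dest!: pos)
  show "part (of_parts f) = f"
    using beyond by (auto simp: part_def of_parts_def L_def[symmetric] not_less fun_eq_iff)
  show "length (of_parts f) \<le> N"
    unfolding of_parts_def by (simp add: Least_le zero)
qed

lemma of_parts_part:
  assumes "is_partition lam"
  shows "of_parts (part lam) = lam"
proof (rule partition_eqI)
  note a = part_antimono[OF assms] part_beyond[OF order.refl]
  show "is_partition (of_parts (part lam))"
    by (rule is_partition_of_parts[of "part lam", OF a])
  show "part (of_parts (part lam)) i = part lam i" for i
    by (simp add: part_of_parts[of "part lam", OF a])
qed (rule assms)

lemma sum_part:
  assumes "length lam \<le> N"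
  shows "(\<Sum>i<N. part lam i) = sum_list lam"
proof -
  have "(\<Sum>i<N. part lam i) = (\<Sum>i<length lam. part lam i)"
    using assms by (intro sum.mono_neutral_right) (auto simp: part_def)
  also have "\<dots> = (\<Sum>i<length lam. lam ! i)"
    by (simp add: part_def)
  also have "\<dots> = sum_list lam"
    by (simp add: sum_list_sum_nth atLeast0LessThan)
  finally show ?thesis .
qed

lemma sum_list_mono_part:
  assumes "\<And>i. part mu i \<le> part lam i"
  shows "sum_list mu \<le> sum_list lam"
proof -
  define N where "N = max (length mu) (length lam)"
  have "(\<Sum>i<N. part mu i) \<le> (\<Sum>i<N. part lam i)"
    by (intro sum_mono assms)
  then show ?thesis by (simp add: sum_part N_def)
qed

lemma cells_eq_part: "cells lam = {(i, j). j < part lam i}"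
  by (auto simp: cells_def part_def split: if_splits)

lemma cells_eq_Sigma: "cells lam = (SIGMA i:{..<length lam}. {..<part lam i})"
  by (auto simp: cells_def part_def split: if_splits)

lemma finite_cells [simp]: "finite (cells lam)"
  by (simp add: cells_eq_Sigma)

lemma card_cells: "card (cells lam) = sum_list lam"
  by (simp add: cells_eq_Sigma sum_part)

lemma is_partition_one_row [simp]: "is_partition (one_row r)"
  by (simp add: one_row_def is_partition_def)

lemma sum_list_one_row [simp]: "sum_list (one_row r) = r"
  by (simp add: one_row_def)

lemma part_one_row: "part (one_row r) i = (if i = 0 then r else 0)"
  by (simp add: one_row_def part_def)

definition one_column :: "nat \<Rightarrow> nat list" where
  "one_column r = replicate r 1"

lemma is_partition_one_column [simp]: "is_partition (one_column r)"
  by (induction r) (auto simp: is_partition_def one_column_def)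

lemma sum_list_one_column [simp]: "sum_list (one_column r) = r"
  by (simp add: one_column_def sum_list_replicate)

lemma part_one_column: "part (one_column r) i = (if i < r then 1 else 0)"
  by (simp add: one_column_def part_def)

lemma sum_list_zero_partition: "is_partition lam \<Longrightarrow> sum_list lam = 0 \<longleftrightarrow> lam = []"
  by (cases lam) (auto simp: is_partition_def)

section \<open>Conjugate partitions and removal of the first column\<close>

lemma less_length_filter_iff:
  assumes "sorted_wrt (\<ge>) lam"
  shows "i < length (filter (\<lambda>q. j < q) lam) \<longleftrightarrow> j < part lam i"
  using assms
proof (induction lam arbitrary: i)
  case (Cons a lam)
  show ?case
  proof (cases "j < a")
    case True
    then show ?thesis using Cons by (cases i) auto
  next
    case False
    then have "\<forall>q\<in>set lam. \<not> j < q" using Cons.prems by auto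
    then have "filter (\<lambda>q. j < q) lam = []" by (simp add: filter_empty_conv)
    moreover have "part lam i' \<le> a" for i'
      using Cons.prems by (auto simp: part_def)
    ultimately show ?thesis using False by (cases i) (auto simp: not_less intro: order_trans)
  qed
qed simp

text \<open>In a decreasing list the entries above a bound form an initial segment, so counting them
  locates its end. The symmetric form, reflection of cells, is what later arguments about
  conjugation use.\<close>

lemma part_conjugate:
  assumes "is_partition lam"
  shows "i < part (conjugate lam) j \<longleftrightarrow> j < part lam i"
proof -
  have sw: "sorted_wrt (\<ge>) lam" using assms by (simp add: is_partition_def)
  have "part (conjugate lam) j = length (filter (\<lambda>q. j < q) lam)"
  proof (cases lam)
    case (Cons p xs)
    have "length (filter (\<lambda>q. j < q) lam) = 0" if "p \<le> j"
      using sw that unfolding Cons by (auto simp: filter_empty_conv)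
    then show ?thesis by (auto simp: part_def conjugate_def Cons)
  qed (simp add: conjugate_def)
  then show ?thesis using less_length_filter_iff[OF sw] by simp
qed

lemma is_partition_conjugate [simp]:
  assumes "is_partition lam"
  shows "is_partition (conjugate lam)"
proof -
  define f where "f = part (conjugate lam)"
  have anti: "f j \<le> f i" if "i \<le> j" for i j
  proof (rule ccontr)
    assume "\<not> f j \<le> f i"
    then have "j < part lam (f i)"
      using part_conjugate[OF assms, of "f i" j] by (simp add: f_def)
    then have "f i < part (conjugate lam) i"
      using part_conjugate[OF assms, of "f i" i] that by simp
    then show False by (simp add: f_def)
  qed
  have pos: "0 < conjugate lam ! i" if "i < length (conjugate lam)" for i
  proof (cases lam)
    case (Cons p xs)
    then have "i < part lam 0" using that by (simp add: conjugate_def)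
    then show ?thesis using part_conjugate[OF assms, of 0 i] that by (simp add: part_def)
  qed (use that in \<open>simp add: conjugate_def\<close>)
  show ?thesis
    unfolding is_partition_def sorted_wrt_iff_nth_less
  proof (intro conjI allI impI)
    fix i j assume "i < j" "j < length (conjugate lam)"
    then show "conjugate lam ! j \<le> conjugate lam ! i"
      using anti[of i j] by (simp add: f_def part_def)
  next
    show "0 \<notin> set (conjugate lam)"
      using pos by (metis in_set_conv_nth less_irrefl)
  qed
qed

lemma conjugate_conjugate [simp]:
  assumes "is_partition lam"
  shows "conjugate (conjugate lam) = lam"
proof (rule partition_eqI)
  fix i
  have "j < part (conjugate (conjugate lam)) i \<longleftrightarrow> j < part lam i" for j
    using assms by (simp add: part_conjugate)
  then show "part (conjugate (conjugate lam)) i = part lam i"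
    by (metis linorder_neqE_nat less_irrefl)
qed (use assms in auto)

lemma sum_list_conjugate [simp]:
  assumes "is_partition lam"
  shows "sum_list (conjugate lam) = sum_list lam"
proof -
  have "bij_betw prod.swap (cells lam) (cells (conjugate lam))"
    by (rule bij_betw_byWitness[where f' = prod.swap])
      (auto simp: cells_eq_part part_conjugate[OF assms])
  then show ?thesis by (metis bij_betw_same_card card_cells)
qed

text \<open>The zeros dropped by the filter stand at the end of the decreasing list, so no row
  changes its index.\<close>

lemma partition_remove_first_column:
  assumes "is_partition mu"
  shows "is_partition (remove_first_column mu)"
    and "part (remove_first_column mu) i = part mu i - 1"
proof -
  have "sorted_wrt (\<ge>) (map (\<lambda>p. p - 1) mu)"
    using assms by (auto simp: is_partition_def sorted_wrt_iff_nth_less intro: diff_le_mono)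
  then show "is_partition (remove_first_column mu)"
    by (auto simp: is_partition_def remove_first_column_def intro: sorted_wrt_filter)
  show "part (remove_first_column mu) i = part mu i - 1"
    using assms
  proof (induction mu arbitrary: i)
    case Nil
    then show ?case by (simp add: remove_first_column_def)
  next
    case (Cons a mu)
    show ?case
    proof (cases "a - 1 = 0")
      case True
      have "part (a # mu) i \<le> part (a # mu) 0"
        by (rule part_antimono[OF Cons.prems]) simp
      moreover have "\<forall>q \<in> set (a # mu). q - 1 = 0"
        using Cons.prems True by (auto simp: is_partition_def)
      then have "remove_first_column (a # mu) = []"
        unfolding remove_first_column_def by (simp add: filter_empty_conv)
      ultimately show ?thesis using True by simp
    next
      case False
      then show ?thesis
        using Cons by (cases i) (auto simp: remove_first_column_def is_partition_def)
    qed
  qed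
qed

lemma length_remove_first_column_le: "length (remove_first_column mu) \<le> length mu"
  unfolding remove_first_column_def by (metis length_filter_le length_map)

lemma sum_list_remove_first_column:
  assumes "is_partition mu"
  shows "sum_list (remove_first_column mu) + length mu = sum_list mu"
proof -
  have "(\<Sum>i<length mu. part (remove_first_column mu) i) + length mu
      = (\<Sum>i<length mu. part (remove_first_column mu) i + 1)"
    by (simp only: sum.distrib sum_constant card_lessThan of_nat_id mult_1_right)
  also have "\<dots> = (\<Sum>i<length mu. part mu i)"
    using part_pos_iff[OF assms]
    by (intro sum.cong) (auto simp: partition_remove_first_column[OF assms])
  finally show ?thesis
    by (simp add: sum_part length_remove_first_column_le)
qed

section \<open>Horizontal and vertical strips\<close>

definition hstrip :: "nat list \<Rightarrow> nat list \<Rightarrow> bool" where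
  "hstrip lam mu \<longleftrightarrow> (\<forall>i. part mu i \<le> part lam i \<and> part lam (Suc i) \<le> part mu i)"

text \<open>The skew diagram has at most one cell in each row. For \<open>hstrip\<close>, where the
  rows interlace, it has at most one cell in each column.\<close>

definition vstrip :: "nat list \<Rightarrow> nat list \<Rightarrow> bool" where
  "vstrip lam mu \<longleftrightarrow> (\<forall>i. part mu i \<le> part lam i \<and> part lam i \<le> Suc (part mu i))"

abbreviation hstrips_over :: "nat list \<Rightarrow> nat \<Rightarrow> nat list set" where
  "hstrips_over lam n \<equiv> {tau. is_partition tau \<and> hstrip tau lam \<and> sum_list tau = n}"

abbreviation vstrips_over :: "nat list \<Rightarrow> nat \<Rightarrow> nat list set" where
  "vstrips_over lam n \<equiv> {tau. is_partition tau \<and> vstrip tau lam \<and> sum_list tau = n}"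

abbreviation hstrips_under :: "nat list \<Rightarrow> nat list set" where
  "hstrips_under lam \<equiv> {mu. is_partition mu \<and> hstrip lam mu}"

abbreviation vstrips_under :: "nat list \<Rightarrow> nat list set" where
  "vstrips_under lam \<equiv> {mu. is_partition mu \<and> vstrip lam mu}"

lemma vstrip_conjugate:
  assumes "is_partition lam" "is_partition mu"
  shows "vstrip (conjugate lam) (conjugate mu) \<longleftrightarrow> hstrip lam mu"
proof -
  note c = part_conjugate[OF assms(1)] part_conjugate[OF assms(2)]
  \<comment> \<open>Inequalities between parts are rewritten as implications between memberships of
    cells, the form in which \<open>part_conjugate\<close> applies.\<close>
  have le: "a \<le> b \<longleftrightarrow> (\<forall>j. j < a \<longrightarrow> j < b)" for a b :: nat
    by (meson not_le_imp_less order_less_le_trans less_irrefl)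
  have le_Suc: "a \<le> Suc b \<longleftrightarrow> (\<forall>j. Suc j < a \<longrightarrow> j < b)" for a b
    using le[of "a - 1" b] by (cases a) auto
  have "(\<forall>i. part (conjugate mu) i \<le> part (conjugate lam) i) \<longleftrightarrow> (\<forall>i. part mu i \<le> part lam i)"
    unfolding le c by blast
  moreover have "(\<forall>i. part (conjugate lam) i \<le> Suc (part (conjugate mu) i)) \<longleftrightarrow>
      (\<forall>i. part lam (Suc i) \<le> part mu i)"
    unfolding le_Suc unfolding le c by blast
  ultimately show ?thesis by (simp add: vstrip_def hstrip_def all_conj_distrib)
qed

lemma hstrip_size: "hstrip lam mu \<Longrightarrow> sum_list mu \<le> sum_list lam"
  unfolding hstrip_def by (auto intro: sum_list_mono_part)

lemma vstrip_size: "vstrip lam mu \<Longrightarrow> sum_list mu \<le> sum_list lam"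
  unfolding vstrip_def by (auto intro: sum_list_mono_part)

lemma finite_partitions_bounded: "finite {lam. is_partition lam \<and> sum_list lam \<le> n}"
proof -
  have "{lam. is_partition lam \<and> sum_list lam \<le> n} = (\<Union>k\<le>n. partitions_of k)"
    by (auto simp: partitions_of_def)
  then show ?thesis by simp
qed

lemma finite_sub_strips [simp]:
  "finite (hstrips_under lam)"
  "finite (vstrips_under lam)"
  by (rule finite_subset[OF _ finite_partitions_bounded[of "sum_list lam"]],
      use hstrip_size vstrip_size in blast)+

section \<open>Tableaux and the Pieri rule\<close>

abbreviation (input) lookup :: "(nat \<Rightarrow>\<^sub>0 nat) \<Rightarrow> nat \<Rightarrow> nat" where
  "lookup \<equiv> Poly_Mapping.lookup"

abbreviation (input) single :: "nat \<Rightarrow> nat \<Rightarrow> (nat \<Rightarrow>\<^sub>0 nat)" where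
  "single \<equiv> Poly_Mapping.single"

abbreviation (input) keys :: "(nat \<Rightarrow>\<^sub>0 nat) \<Rightarrow> nat set" where
  "keys \<equiv> Poly_Mapping.keys"

text \<open>
  Row \<open>i + 1\<close> of \<open>rho\<close> and row \<open>i\<close> of \<open>tau\<close> range over the same interval
  \<open>[max nu\<^sub>i\<^sub>+\<^sub>1 sig\<^sub>i\<^sub>+\<^sub>1, min nu\<^sub>i sig\<^sub>i]\<close>. Reflecting these intervals
  gives the bijection; the first row of \<open>rho\<close> is then determined by the size.
\<close>

lemma card_strip_exchange:
  assumes nu: "is_partition nu" and sig: "is_partition sig"
  shows "card {rho. is_partition rho \<and> hstrip rho nu \<and> hstrip rho sig
            \<and> sum_list rho = sum_list nu + s}
       = card {tau. is_partition tau \<and> hstrip nu tau \<and> hstrip sig tau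
            \<and> sum_list sig \<le> sum_list tau + s}"
    (is "card ?A = card ?B")
proof -
  define N where "N = max (length nu) (length sig)"
  define hi where "hi i = max (part nu i) (part sig i)" for i
  define lo where "lo i = min (part nu i) (part sig i)" for i
  \<comment> \<open>\<open>hi (Suc i)\<close> and \<open>lo i\<close> are the ends of the common
    interval, so \<open>c i - x\<close> is the reflection of \<open>x\<close> in it.\<close>
  define c where "c i = hi (Suc i) + lo i" for i
  define f where "f rho = of_parts (\<lambda>i. c i - part rho (Suc i))" for rho
  \<comment> \<open>The first row of \<open>rho\<close> lies in no such interval. It is what the
    prescribed size leaves after the reflected rows of \<open>tau\<close>, which become the later
    rows of \<open>rho\<close>.\<close>
  define r where "r tau = sum_list nu + s - (\<Sum>i<N. c i - part tau i)" for tau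
  define gf where "gf tau i = (case i of 0 \<Rightarrow> r tau | Suc j \<Rightarrow> c j - part tau j)" for tau i
  define g where "g tau = of_parts (gf tau)" for tau
  have lohi: "lo i \<le> hi i" for i by (simp add: lo_def hi_def)
  have zero: "lo i = 0" "hi i = 0" "part nu i = 0" "part sig i = 0" if "N \<le> i" for i
    using that by (auto simp: lo_def hi_def N_def part_beyond)
  \<comment> \<open>The shift of the index loses only \<open>hi 0\<close>, and a maximum plus the
    matching minimum is the sum of both parts.\<close>
  have "(\<Sum>i<N. hi (Suc i)) + hi 0 = (\<Sum>i<Suc N. hi i)"
    by (subst sum.lessThan_Suc_shift) simp
  also have "\<dots> = (\<Sum>i<N. hi i)" by (simp add: zero)
  finally have "(\<Sum>i<N. c i) + hi 0 = (\<Sum>i<N. hi i + lo i)"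
    by (simp add: c_def sum.distrib)
  also have "\<dots> = (\<Sum>i<N. part nu i + part sig i)"
    by (rule sum.cong) (auto simp: hi_def lo_def)
  finally have csum: "(\<Sum>i<N. c i) + hi 0 = sum_list nu + sum_list sig"
    by (simp add: sum.distrib sum_part N_def)
  have A: "f rho \<in> ?B \<and> g (f rho) = rho" if "rho \<in> ?A" for rho
  proof -
    have P: "is_partition rho" and size: "sum_list rho = sum_list nu + s" using that by auto
    have strips: "part nu i \<le> part rho i" "part sig i \<le> part rho i"
      "part rho (Suc i) \<le> part nu i" "part rho (Suc i) \<le> part sig i" for i
      using that unfolding hstrip_def by blast+
    have range: "hi (Suc i) \<le> part rho (Suc i)" "part rho (Suc i) \<le> lo i" for i
      using strips[of i] strips[of "Suc i"] by (simp_all add: hi_def lo_def)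
    have "part nu 0 \<le> part rho 0" "part sig 0 \<le> part rho 0"
      by (rule strips)+
    then have first: "hi 0 \<le> part rho 0" by (simp add: hi_def)
    have "part rho (Suc N) \<le> lo N" by (rule range)
    then have "part rho (Suc N) = 0" by (simp add: zero)
    then have len: "length rho \<le> Suc N" using part_pos_iff[OF P, of "Suc N"] by simp
    have anti: "c j - part rho (Suc j) \<le> c i - part rho (Suc i)" if "i \<le> j" for i j
    proof (cases "i = j")
      case False
      then have "Suc i \<le> j" using that by simp
      then have "lo j \<le> hi (Suc i)"
        unfolding lo_def hi_def using part_antimono[OF nu, of "Suc i" j] by linarith
      then show ?thesis using range[of i] range[of j] unfolding c_def by linarith
    qed simp
    have z: "c N - part rho (Suc N) = 0" by (simp add: c_def zero)
    note Pf = is_partition_of_parts[of "\<lambda>i. c i - part rho (Suc i)", OF anti z]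
    note pf = part_of_parts[of "\<lambda>i. c i - part rho (Suc i)", OF anti z]
    note lf = length_of_parts_le[of "\<lambda>i. c i - part rho (Suc i)", OF anti z]
    have part_f: "part (f rho) i = c i - part rho (Suc i)" for i
      by (simp add: f_def pf)
    have inv: "c i - part (f rho) i = part rho (Suc i)" for i
      using range[of i] by (simp add: part_f c_def)
    have "(\<Sum>i<N. part rho (Suc i)) + part rho 0 = sum_list nu + s"
      using sum_part[OF len] size by (subst (asm) sum.lessThan_Suc_shift) simp
    then have r: "r (f rho) = part rho 0" by (simp add: r_def inv)
    have "sum_list (f rho) + (\<Sum>i<N. part rho (Suc i)) = (\<Sum>i<N. part (f rho) i + part rho (Suc i))"
      using sum_part[OF lf] by (simp add: sum.distrib f_def)
    also have "\<dots> = (\<Sum>i<N. c i)"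
      using range by (intro sum.cong) (auto simp: part_f c_def trans_le_add2)
    finally have "sum_list (f rho) + (\<Sum>i<N. part rho (Suc i)) = (\<Sum>i<N. c i)" .
    moreover have "(\<Sum>i<N. part rho (Suc i)) + part rho 0 = sum_list nu + s"
      using sum_part[OF len] size by (subst (asm) sum.lessThan_Suc_shift) simp
    \<comment> \<open>Given the size of \<open>rho\<close>, this is equivalent to
      \<open>hi 0 \<le> part rho 0\<close>, the strip condition on the one row outside the
      intervals.\<close>
    ultimately have "sum_list sig \<le> sum_list (f rho) + s"
      using csum first by linarith
    moreover have "hstrip nu (f rho)" "hstrip sig (f rho)"
      unfolding hstrip_def part_f
    proof (safe)
      fix i
      show "c i - part rho (Suc i) \<le> part nu i" "part nu (Suc i) \<le> c i - part rho (Suc i)"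
        "c i - part rho (Suc i) \<le> part sig i" "part sig (Suc i) \<le> c i - part rho (Suc i)"
        using range[of i] unfolding c_def hi_def lo_def by linarith+
    qed
    moreover have "g (f rho) = rho"
    proof -
      have "gf (f rho) = part rho"
        by (auto simp: fun_eq_iff gf_def r inv split: nat.split)
      then show ?thesis by (simp add: g_def of_parts_part[OF P])
    qed
    ultimately show ?thesis using Pf by (simp add: f_def)
  qed
  have B: "g tau \<in> ?A \<and> f (g tau) = tau" if "tau \<in> ?B" for tau
  proof -
    have P: "is_partition tau" and size: "sum_list sig \<le> sum_list tau + s" using that by auto
    have strips: "part nu (Suc i) \<le> part tau i" "part sig (Suc i) \<le> part tau i"
      "part tau i \<le> part nu i" "part tau i \<le> part sig i" for i
      using that unfolding hstrip_def by blast+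
    have range: "hi (Suc i) \<le> part tau i" "part tau i \<le> lo i" for i
      using strips[of i] by (simp_all add: hi_def lo_def)
    have "part tau N = 0" using range(2)[of N] by (simp add: zero)
    then have len: "length tau \<le> N" using part_pos_iff[OF P, of N] by simp
    have "sum_list tau + (\<Sum>i<N. c i - part tau i) = (\<Sum>i<N. part tau i + (c i - part tau i))"
      using sum_part[OF len] by (simp add: sum.distrib)
    also have "\<dots> = (\<Sum>i<N. c i)"
      using range by (intro sum.cong) (auto simp: c_def trans_le_add2)
    finally have eq: "sum_list tau + (\<Sum>i<N. c i - part tau i) = (\<Sum>i<N. c i)" .
    have r: "r tau + (\<Sum>i<N. c i - part tau i) = sum_list nu + s" "hi 0 \<le> r tau"
      using eq csum size unfolding r_def by linarith+
    have step: "gf tau (Suc i) \<le> gf tau i" for i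
    proof (cases i)
      case 0
      then show ?thesis using range[of 0] r(2) lohi[of 0] by (simp add: gf_def c_def)
    next
      case (Suc j)
      then show ?thesis
        using range[of j] range[of "Suc j"] lohi[of "Suc j"] by (simp add: gf_def c_def)
    qed
    have anti: "gf tau j \<le> gf tau i" if "i \<le> j" for i j
      using that by (rule lift_Suc_antimono_le[of "gf tau", OF step])
    have z: "gf tau (Suc N) = 0" by (simp add: gf_def c_def zero)
    note Pg = is_partition_of_parts[of "gf tau", OF anti z]
    note pg = part_of_parts[of "gf tau", OF anti z]
    note lg = length_of_parts_le[of "gf tau", OF anti z]
    have "sum_list (g tau) = (\<Sum>i<Suc N. gf tau i)"
      using sum_part[OF lg] by (simp add: g_def pg)
    also have "\<dots> = sum_list nu + s"
      by (subst sum.lessThan_Suc_shift) (use r(1) in \<open>simp add: gf_def\<close>)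
    finally have "sum_list (g tau) = sum_list nu + s" .
    moreover have "part nu i \<le> gf tau i \<and> part sig i \<le> gf tau i" for i
    proof (cases i)
      case 0
      then show ?thesis using r(2) by (simp add: gf_def hi_def)
    next
      case (Suc j)
      have "gf tau i = c j - part tau j" by (simp add: gf_def Suc)
      then show ?thesis
        using range[of j] unfolding Suc c_def hi_def lo_def by linarith
    qed
    moreover have "gf tau (Suc i) \<le> part nu i \<and> gf tau (Suc i) \<le> part sig i" for i
    proof -
      have "gf tau (Suc i) = c i - part tau i" by (simp add: gf_def)
      then show ?thesis using range[of i] unfolding c_def hi_def lo_def by linarith
    qed
    ultimately have "g tau \<in> ?A"
      using Pg by (simp add: g_def pg hstrip_def)
    moreover have "f (g tau) = tau"
    proof -
      have "c i - part (g tau) (Suc i) = part tau i" for i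
        using range[of i] by (simp add: g_def pg gf_def c_def)
      then show ?thesis by (simp add: f_def of_parts_part[OF P])
    qed
    ultimately show ?thesis by blast
  qed
  have "bij_betw f ?A ?B"
  proof (rule bij_betw_byWitness[where f' = g])
    show "\<forall>rho\<in>?A. g (f rho) = rho" using A by meson
    show "\<forall>tau\<in>?B. f (g tau) = tau" using B by meson
    show "f ` ?A \<subseteq> ?B" using A by (meson image_subsetI)
    show "g ` ?B \<subseteq> ?A" using B by (meson image_subsetI)
  qed
  then show ?thesis by (rule bij_betw_same_card)
qed

section \<open>Kostka numbers and the branching rule\<close>

definition kostka :: "nat list \<Rightarrow> (nat \<Rightarrow>\<^sub>0 nat) \<Rightarrow> nat" where
  "kostka lam \<theta> = card {T \<in> semistandard_tableaux lam. has_content lam T \<theta>}"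

lemma mps_coeff_schur: "mps_coeff (schur lam) \<theta> = of_nat (kostka lam \<theta>)"
  by (simp add: schur_def kostka_def)

lemma content_entry:
  assumes "has_content lam T \<theta>" "c \<in> cells lam"
  shows "0 < lookup \<theta> (T c)"
proof -
  have "c \<in> {c' \<in> cells lam. T c' = T c}" using assms(2) by simp
  then have "{c' \<in> cells lam. T c' = T c} \<noteq> {}" by blast
  then have "0 < card {c' \<in> cells lam. T c' = T c}" by (simp add: card_gt_0_iff)
  then show ?thesis using assms(1) by (simp add: has_content_def)
qed

lemma finite_tableaux_content [simp]:
  "finite {T \<in> semistandard_tableaux lam. has_content lam T \<theta>}"
proof (rule finite_subset)
  show "{T \<in> semistandard_tableaux lam. has_content lam T \<theta>}
      \<subseteq> PiE (cells lam) (\<lambda>_. keys \<theta>)"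
  proof
    fix T assume "T \<in> {T \<in> semistandard_tableaux lam. has_content lam T \<theta>}"
    then have "T \<in> extensional (cells lam)" "has_content lam T \<theta>"
      by (simp_all add: semistandard_tableaux_def)
    then show "T \<in> PiE (cells lam) (\<lambda>_. keys \<theta>)"
      using content_entry[of lam T \<theta>] by (simp add: PiE_iff in_keys_iff del: split_paired_All)
  qed
qed (auto intro: finite_PiE)

lemma downward_closed_eq_lessThan:
  fixes D :: "nat set"
  assumes "finite D" "\<And>i j. j \<in> D \<Longrightarrow> i \<le> j \<Longrightarrow> i \<in> D"
  shows "D = {..<card D}"
proof -
  obtain m where "m \<notin> D" using assms(1) by (metis UNIV_eq_I infinite_UNIV_nat)
  define k where "k = (LEAST m. m \<notin> D)"
  have "k \<notin> D" unfolding k_def by (rule LeastI[of "\<lambda>m. m \<notin> D", OF \<open>m \<notin> D\<close>])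
  moreover have "i \<in> D" if "i < k" for i using not_less_Least that unfolding k_def by blast
  ultimately have "D = {..<k}" using assms(2) by (metis lessThan_iff not_less set_eqI)
  then show ?thesis by (metis card_lessThan)
qed

definition subshape :: "nat list \<Rightarrow> nat \<Rightarrow> (nat \<times> nat \<Rightarrow> nat) \<Rightarrow> nat list" where
  "subshape lam n T = of_parts (\<lambda>i. card {j. (i, j) \<in> cells lam \<and> T (i, j) < n})"

text \<open>Rows increase weakly, so the entries below \<open>n\<close> fill an initial segment of
  each row; columns increase, so these segments do not grow downwards.\<close>

lemma
  assumes lam: "is_partition lam" and T: "T \<in> semistandard_tableaux lam"
  shows is_partition_subshape: "is_partition (subshape lam n T)"
    and cells_subshape: "cells (subshape lam n T) = {c \<in> cells lam. T c < n}"
proof -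
  define D where "D i = {j. (i, j) \<in> cells lam \<and> T (i, j) < n}" for i
  have fin: "finite (D i)" for i
    by (rule finite_subset[of _ "{..<part lam i}"]) (auto simp: D_def cells_eq_part)
  have down: "i' \<in> D i" if "j \<in> D i" "i' \<le> j" for i i' j
    using that(2,1)
  proof (induction rule: inc_induct)
    case (step k)
    then have "(i, Suc k) \<in> cells lam" "T (i, Suc k) < n" by (auto simp: D_def)
    moreover from this have "(i, k) \<in> cells lam" by (simp add: cells_eq_part)
    ultimately show ?case
      using T unfolding D_def semistandard_tableaux_def by fastforce
  qed
  have D: "D i = {..<card (D i)}" for i
    by (rule downward_closed_eq_lessThan[OF fin down])
  have col: "D (Suc i) \<subseteq> D i" for i
  proof
    fix j assume "j \<in> D (Suc i)"
    then have "(Suc i, j) \<in> cells lam" "T (Suc i, j) < n" by (auto simp: D_def)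
    moreover from this have "(i, j) \<in> cells lam"
      using part_antimono[OF lam, of i "Suc i"] by (simp add: cells_eq_part)
    ultimately show "j \<in> D i"
      using T unfolding D_def semistandard_tableaux_def by fastforce
  qed
  have anti: "card (D j) \<le> card (D i)" if "i \<le> j" for i j
    using that
    by (rule lift_Suc_antimono_le[of "\<lambda>i. card (D i)", rotated]) (rule card_mono[OF fin col])
  have z: "card (D (length lam)) = 0" by (simp add: D_def cells_eq_part part_beyond)
  note P = is_partition_of_parts[of "\<lambda>i. card (D i)", OF anti z]
    part_of_parts[of "\<lambda>i. card (D i)", OF anti z]
  show "is_partition (subshape lam n T)" using P(1) by (simp add: subshape_def D_def)
  have "(i, j) \<in> cells (subshape lam n T) \<longleftrightarrow> j \<in> D i" for i j
    using P(2) D[of i] by (auto simp: cells_eq_part subshape_def D_def)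
  then show "cells (subshape lam n T) = {c \<in> cells lam. T c < n}"
    by (auto simp: D_def)
qed

lemma cells_inject:
  assumes "is_partition lam" "is_partition mu" "cells lam = cells mu"
  shows "lam = mu"
proof (rule partition_eqI[OF assms(1,2)])
  fix i
  have "j < part lam i \<longleftrightarrow> j < part mu i" for j
    using assms(3) by (auto simp: cells_eq_part set_eq_iff)
  then show "part lam i = part mu i" by (metis linorder_neqE_nat less_irrefl)
qed

text \<open>The entry \<open>n\<close> is the largest possible one. Strict columns allow it at most
  once per column, so its cells form a horizontal strip of size \<open>r\<close>; conversely every
  such strip can be filled with \<open>n\<close>.\<close>

lemma kostka_branch:
  assumes lam: "is_partition lam" and \<theta>: "\<And>v. n \<le> v \<Longrightarrow> lookup \<theta> v = 0"
  shows "kostka lam (\<theta> + single n r) =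
    (\<Sum>mu | is_partition mu \<and> hstrip lam mu \<and> sum_list lam = sum_list mu + r. kostka mu \<theta>)"
proof -
  define X where "X mu \<eta> = {T \<in> semistandard_tableaux mu. has_content mu T \<eta>}" for mu \<eta>
  define M where "M = {mu. is_partition mu \<and> hstrip lam mu \<and> sum_list lam = sum_list mu + r}"
  define F where "F = (\<lambda>(mu, T). \<lambda>c\<in>cells lam. if c \<in> cells mu then T c else (n::nat))"
  define G where "G T = (subshape lam n T, restrict T (cells (subshape lam n T)))" for T :: "nat \<times> nat \<Rightarrow> nat"
  have F: "F (mu, T) \<in> X lam (\<theta> + single n r) \<and> G (F (mu, T)) = (mu, T)"
    if mu: "mu \<in> M" and T: "T \<in> X mu \<theta>" for mu T
  proof -
    have Pmu: "is_partition mu" and hs: "hstrip lam mu"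
      and size: "sum_list lam = sum_list mu + r" using mu by (auto simp: M_def)
    have sub: "cells mu \<subseteq> cells lam"
      using hs by (fastforce simp: cells_eq_part hstrip_def intro: less_le_trans)
    have ent: "T c < n" if "c \<in> cells mu" for c
      using content_entry[of mu T \<theta> c] T that \<theta>[of "T c"] by (force simp: X_def)
    have rows: "F (mu, T) (i, j) \<le> F (mu, T) (i, Suc j)"
      if "(i, j) \<in> cells lam" "(i, Suc j) \<in> cells lam" for i j
    proof (cases "(i, Suc j) \<in> cells mu")
      case True
      then have "(i, j) \<in> cells mu" by (simp add: cells_eq_part)
      then show ?thesis using True T that by (auto simp: F_def X_def semistandard_tableaux_def)
    next
      case False
      then show ?thesis using that ent[of "(i, j)"] by (auto simp: F_def)
    qed
    have cols: "F (mu, T) (i, j) < F (mu, T) (Suc i, j)"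
      if "(i, j) \<in> cells lam" "(Suc i, j) \<in> cells lam" for i j
    proof -
      \<comment> \<open>A cell of \<open>lam\<close> with another cell of \<open>lam\<close> below
        it lies in \<open>mu\<close> by interlacing, so its entry is below \<open>n\<close>.\<close>
      have in_mu: "(i, j) \<in> cells mu"
        using that(2) hs by (auto simp: cells_eq_part hstrip_def intro: less_le_trans)
      show ?thesis
      proof (cases "(Suc i, j) \<in> cells mu")
        case True
        then show ?thesis using in_mu T that by (auto simp: F_def X_def semistandard_tableaux_def)
      next
        case False
        then show ?thesis using that ent[OF in_mu] in_mu by (auto simp: F_def)
      qed
    qed
    have lt: "{c \<in> cells lam. F (mu, T) c < n} = cells mu"
      using sub ent by (auto simp: F_def)
    have cont: "card {c \<in> cells lam. F (mu, T) c = v} = lookup (\<theta> + single n r) v" for v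
    proof (cases "v = n")
      case True
      have "{c \<in> cells lam. F (mu, T) c = v} = cells lam - cells mu"
        using True ent by (auto simp: F_def)
      then have "card {c \<in> cells lam. F (mu, T) c = v} = r"
        using size sub by (simp add: card_Diff_subset card_cells)
      then show ?thesis using True \<theta>[of n] by (simp add: lookup_add)
    next
      case False
      then have "{c \<in> cells lam. F (mu, T) c = v} = {c \<in> cells mu. T c = v}"
        using sub by (auto simp: F_def split: if_splits)
      then show ?thesis using False T by (simp add: lookup_add lookup_single X_def has_content_def)
    qed
    have FX: "F (mu, T) \<in> semistandard_tableaux lam"
      unfolding semistandard_tableaux_def using rows cols by (auto simp: F_def)
    have sh: "subshape lam n (F (mu, T)) = mu"
      using cells_subshape[OF lam FX] lt
      by (intro cells_inject is_partition_subshape[OF lam FX] Pmu) simp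
    have "restrict (F (mu, T)) (cells mu) = T"
      using sub T by (auto simp: fun_eq_iff F_def restrict_def X_def semistandard_tableaux_def extensional_def)
    then show ?thesis
      using FX cont sh by (auto simp: X_def has_content_def G_def)
  qed
  have G: "G T \<in> (SIGMA mu:M. X mu \<theta>) \<and> F (G T) = T"
    if T: "T \<in> X lam (\<theta> + single n r)" for T
  proof -
    define mu where "mu = subshape lam n T"
    have TS: "T \<in> semistandard_tableaux lam" and TC: "has_content lam T (\<theta> + single n r)"
      using T by (auto simp: X_def)
    have Pmu: "is_partition mu" and cmu: "cells mu = {c \<in> cells lam. T c < n}"
      using is_partition_subshape[OF lam TS] cells_subshape[OF lam TS] by (auto simp: mu_def)
    have ent: "T c \<le> n" if "c \<in> cells lam" for c
      using content_entry[OF TC that] \<theta>[of "T c"] by (fastforce simp: lookup_add lookup_single when_def split: if_splits)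
    have "part mu i \<le> part lam i \<and> part lam (Suc i) \<le> part mu i" for i
    proof (intro conjI)
      show "part mu i \<le> part lam i"
      proof (rule ccontr)
        assume "\<not> ?thesis"
        then have "(i, part lam i) \<in> cells mu" by (simp add: cells_eq_part)
        then have "(i, part lam i) \<in> cells lam" using cmu by blast
        then show False by (simp add: cells_eq_part)
      qed
      show "part lam (Suc i) \<le> part mu i"
      proof (rule ccontr)
        assume "\<not> ?thesis"
        then have j: "(Suc i, part mu i) \<in> cells lam" by (simp add: cells_eq_part)
        then have i: "(i, part mu i) \<in> cells lam"
          using part_antimono[OF lam, of i "Suc i"] by (simp add: cells_eq_part)
        then have "T (i, part mu i) < T (Suc i, part mu i)"
          using j TS by (auto simp: semistandard_tableaux_def)
        then have "T (i, part mu i) < n" using ent[OF j] by simp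
        then have "(i, part mu i) \<in> cells mu" using i cmu by simp
        then show False by (simp add: cells_eq_part)
      qed
    qed
    then have hs: "hstrip lam mu" by (simp add: hstrip_def)
    have "cells lam = cells mu \<union> {c \<in> cells lam. T c = n}"
      using cmu ent by (auto simp: le_less)
    moreover have "cells mu \<inter> {c \<in> cells lam. T c = n} = {}"
      using cmu by auto
    moreover have "finite {c \<in> cells lam. T c = n}" by simp
    ultimately have "card (cells lam) = card (cells mu) + card {c \<in> cells lam. T c = n}"
      using card_Un_disjoint[of "cells mu" "{c \<in> cells lam. T c = n}"] by simp
    then have size: "sum_list lam = sum_list mu + r"
      using TC \<theta>[of n] by (simp add: has_content_def card_cells lookup_add)
    have "has_content mu (restrict T (cells mu)) \<theta>"
      unfolding has_content_def
    proof
      fix v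
      have eq: "{c \<in> cells mu. restrict T (cells mu) c = v} = (if v < n then {c \<in> cells lam. T c = v} else {})"
        using cmu by auto
      then show "card {c \<in> cells mu. restrict T (cells mu) c = v} = lookup \<theta> v"
        using TC \<theta>[of v] by (auto simp: has_content_def lookup_add lookup_single not_less)
    qed
    moreover have "restrict T (cells mu) \<in> semistandard_tableaux mu"
      using TS cmu unfolding semistandard_tableaux_def by auto
    moreover have "F (mu, restrict T (cells mu)) = T"
    proof
      fix c
      show "F (mu, restrict T (cells mu)) c = T c"
      proof (cases "c \<in> cells lam")
        case True
        then show ?thesis using cmu ent[OF True] by (auto simp: F_def not_less)
      next
        case False
        then show ?thesis
          using TS extensional_arb[of T "cells lam" c] by (simp add: F_def semistandard_tableaux_def)
      qed
    qed
    ultimately show ?thesis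
      using Pmu hs size by (simp add: G_def M_def X_def flip: mu_def)
  qed
  have "bij_betw F (SIGMA mu:M. X mu \<theta>) (X lam (\<theta> + single n r))"
  proof (rule bij_betw_byWitness[where f' = G])
    show "\<forall>p\<in>SIGMA mu:M. X mu \<theta>. G (F p) = p"
      "F ` (SIGMA mu:M. X mu \<theta>) \<subseteq> X lam (\<theta> + single n r)"
      using F by (auto simp del: split_paired_All)
    show "\<forall>T\<in>X lam (\<theta> + single n r). F (G T) = T"
      "G ` X lam (\<theta> + single n r) \<subseteq> (SIGMA mu:M. X mu \<theta>)"
      using G by (meson, meson image_subsetI)
  qed
  then have "card (X lam (\<theta> + single n r)) = card (SIGMA mu:M. X mu \<theta>)"
    by (metis bij_betw_same_card)
  also have "\<dots> = (\<Sum>mu\<in>M. card (X mu \<theta>))"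
  proof (rule card_SigmaI)
    show "finite M" by (rule finite_subset[OF _ finite_sub_strips(1)[of lam]]) (auto simp: M_def)
  qed (simp add: X_def)
  finally show ?thesis by (simp add: kostka_def X_def M_def)
qed

text \<open>The variables enter in increasing order, as the branching rule demands. The exponent
  \<open>r = 0\<close> is allowed, so variables that do not occur are passed over.\<close>

lemma monomial_induct [case_names zero add]:
  assumes zero: "P (0 :: nat \<Rightarrow>\<^sub>0 nat)"
    and add: "\<And>n r \<theta>. (\<And>v. n \<le> v \<Longrightarrow> lookup \<theta> v = 0) \<Longrightarrow> P \<theta> \<Longrightarrow> P (\<theta> + single n r)"
  shows "P \<theta>"
proof -
  have "P \<theta>" if "\<And>v. n \<le> v \<Longrightarrow> lookup \<theta> v = 0" for n \<theta>
    using that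
  proof (induction n arbitrary: \<theta>)
    case 0
    then have "\<theta> = 0" by (intro poly_mapping_eqI) simp
    then show ?case using zero by simp
  next
    case (Suc n)
    define \<theta>' where "\<theta>' = Poly_Mapping.update n 0 \<theta>"
    have l: "lookup \<theta>' v = (if v = n then 0 else lookup \<theta> v)" for v
      by (simp add: \<theta>'_def lookup_update)
    have "\<theta> = \<theta>' + single n (lookup \<theta> n)"
      by (rule poly_mapping_eqI) (auto simp: lookup_add l lookup_single when_def)
    moreover have z: "lookup \<theta>' v = 0" if "n \<le> v" for v
      using Suc.prems[of v] that by (auto simp: l)
    ultimately show ?case using add[OF z Suc.IH[OF z]] by metis
  qed
  moreover obtain n where "\<forall>v\<in>keys \<theta>. v < n"
    using finite_keys[of \<theta>] unfolding finite_nat_set_iff_bounded by blast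
  ultimately show ?thesis by (metis in_keys_iff not_le)
qed

section \<open>Degrees of monomials and the Pieri rule for complete functions\<close>

definition mono_degree :: "(nat \<Rightarrow>\<^sub>0 nat) \<Rightarrow> nat" where
  "mono_degree \<theta> = (\<Sum>v\<in>keys \<theta>. lookup \<theta> v)"

lemma mono_degree_eq:
  assumes "finite A" "keys \<theta> \<subseteq> A"
  shows "mono_degree \<theta> = (\<Sum>v\<in>A. lookup \<theta> v)"
  unfolding mono_degree_def
  by (rule sum.mono_neutral_left) (use assms in \<open>auto simp: in_keys_iff\<close>)

lemma mono_degree_zero [simp]: "mono_degree 0 = 0"
  by (simp add: mono_degree_def)

lemma mono_degree_add: "mono_degree (a + b) = mono_degree a + mono_degree b"
  using mono_degree_eq[of "keys a \<union> keys b"] keys_add[of a b]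
  by (simp add: lookup_add sum.distrib)

lemma mono_degree_single [simp]: "mono_degree (single n r) = r"
  using mono_degree_eq[of "{n}" "single n r"] by simp

lemma mono_degree_eq_0_iff: "mono_degree \<theta> = 0 \<longleftrightarrow> \<theta> = 0"
  by (auto simp: mono_degree_def in_keys_iff intro!: poly_mapping_eqI)

lemma kostka_zero:
  assumes "is_partition lam" "lam \<noteq> []"
  shows "kostka lam 0 = 0"
proof -
  have "(0, 0) \<in> cells lam"
    using part_pos_iff[OF assms(1), of 0] assms(2) by (simp add: cells_eq_part)
  then have "{T \<in> semistandard_tableaux lam. has_content lam T 0} = {}"
    using content_entry[of lam _ 0 "(0, 0)"] by auto
  then show ?thesis by (simp add: kostka_def)
qed

lemma kostka_Nil: "kostka [] \<theta> = (if \<theta> = 0 then 1 else 0)"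
proof -
  have c: "cells [] = {}" by (simp add: cells_def)
  have "{T \<in> semistandard_tableaux []. has_content [] T \<theta>} = (if \<theta> = 0 then {\<lambda>_. undefined} else {})"
    by (auto simp: semistandard_tableaux_def has_content_def c poly_mapping_eq_iff fun_eq_iff)
  then show ?thesis by (simp add: kostka_def)
qed

lemma kostka_degree:
  assumes "kostka lam \<theta> \<noteq> 0"
  shows "mono_degree \<theta> = sum_list lam"
proof -
  obtain T where T: "has_content lam T \<theta>"
    using assms by (auto simp: kostka_def card_eq_0_iff)
  have "sum_list lam = (\<Sum>c\<in>cells lam. 1)" by (simp add: card_cells)
  also have "\<dots> = (\<Sum>v\<in>T ` cells lam. \<Sum>c | c \<in> cells lam \<and> T c = v. 1)"
    by (rule sum.group[symmetric]) auto
  also have "\<dots> = (\<Sum>v\<in>T ` cells lam. lookup \<theta> v)"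
    using T by (simp add: has_content_def)
  also have "\<dots> = mono_degree \<theta>"
  proof (rule mono_degree_eq[symmetric])
    show "keys \<theta> \<subseteq> T ` cells lam"
    proof
      fix v assume "v \<in> keys \<theta>"
      then have "card {c \<in> cells lam. T c = v} \<noteq> 0"
        using T by (simp add: has_content_def in_keys_iff)
      then show "v \<in> T ` cells lam" by (auto simp: card_eq_0_iff)
    qed
  qed simp
  finally show ?thesis by simp
qed

lemma hstrip_one_row:
  assumes "is_partition mu"
  shows "hstrip (one_row s) mu \<longleftrightarrow> (\<exists>t\<le>s. mu = one_row t)"
proof
  assume h: "hstrip (one_row s) mu"
  then have "mu = one_row (part mu 0)"
  proof (intro partition_eqI assms)
    fix i
    have "part mu i \<le> part (one_row s) i" using h by (simp add: hstrip_def)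
    then show "part mu i = part (one_row (part mu 0)) i" by (auto simp: part_one_row)
  qed simp
  moreover have "part mu 0 \<le> s" using h unfolding hstrip_def by (metis part_one_row)
  ultimately show "\<exists>t\<le>s. mu = one_row t" by blast
qed (auto simp: hstrip_def part_one_row)

text \<open>A row can lose the cells of its last entry in just one way, so every monomial of degree
  \<open>s\<close> has coefficient 1 in \<open>h s\<close>.\<close>

lemma kostka_one_row: "kostka (one_row s) \<theta> = (if mono_degree \<theta> = s then 1 else 0)"
proof (induction \<theta> arbitrary: s rule: monomial_induct)
  case zero
  show ?case
    using kostka_zero[of "one_row s"] by (auto simp: one_row_def kostka_Nil is_partition_def)
next
  case (add n r \<theta>)
  have "{mu. is_partition mu \<and> hstrip (one_row s) mu \<and> s = sum_list mu + r} =
      (if r \<le> s then {one_row (s - r)} else {})"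
    by (auto simp: hstrip_one_row intro!: exI[of _ "s - r"])
  then show ?case
    using add.IH
    by (simp add: kostka_branch[OF is_partition_one_row add.hyps] mono_degree_add) auto
qed

lemma finite_super_strips [simp]:
  "finite (hstrips_over lam n)"
  "finite (vstrips_over lam n)"
  by (rule finite_subset[OF _ finite_partitions_of[of n]]; auto simp: partitions_of_def)+

lemma finite_partitions_pred [simp]: "finite {tau. is_partition tau \<and> sum_list tau + i = n}"
  by (rule finite_subset[OF _ finite_partitions_bounded[of n]]) auto

text \<open>A splitting of the larger monomial is a splitting of \<open>\<theta>\<close> together
  with the share \<open>i\<close> of the last variable that goes to the first factor.\<close>

lemma sum_mono_splits_add_single:
  assumes \<theta>: "\<And>v. n \<le> v \<Longrightarrow> lookup \<theta> v = 0"
  shows "(\<Sum>(a, b)\<in>mono_splits (\<theta> + single n r). F a b) =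
    (\<Sum>i\<le>r. \<Sum>(a, b)\<in>mono_splits \<theta>. F (a + single n i) (b + single n (r - i)))"
proof -
  let ?s = "single n" and ?l = "\<lambda>a. lookup a n"
  let ?u = "Poly_Mapping.update n 0"
  have lu: "lookup (?u a) v = (if v = n then 0 else lookup a v)"
    for a :: "nat \<Rightarrow>\<^sub>0 nat" and v by (simp add: lookup_update)
  have lk: "lookup a v + lookup b v = lookup \<eta> v"
    if "a + b = \<eta>" for a b \<eta> :: "nat \<Rightarrow>\<^sub>0 nat" and v
    using that by (auto simp: lookup_add)
  have "(\<Sum>i\<le>r. \<Sum>(a, b)\<in>mono_splits \<theta>. F (a + ?s i) (b + ?s (r - i))) =
      (\<Sum>(i, a, b)\<in>(SIGMA i:{..r}. mono_splits \<theta>). F (a + ?s i) (b + ?s (r - i)))"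
    by (subst sum.Sigma) (auto simp: case_prod_unfold)
  also have "\<dots> = (\<Sum>(a, b)\<in>mono_splits (\<theta> + ?s r). F a b)"
  proof (rule sum.reindex_bij_witness[where
        i = "\<lambda>(a, b). (?l a, ?u a, ?u b)" and j = "\<lambda>(i, a, b). (a + ?s i, b + ?s (r - i))"])
    fix p assume "p \<in> (SIGMA i:{..r}. mono_splits \<theta>)"
    then obtain i a b where p: "p = (i, a, b)" "i \<le> r" "a + b = \<theta>"
      by (auto simp: mono_splits_def)
    have "?l a = 0" "?l b = 0" using lk[OF p(3), of n] \<theta>[of n] by auto
    then have "?u (a + ?s i) = a" "?u (b + ?s (r - i)) = b" "?l (a + ?s i) = i"
      by (auto intro!: poly_mapping_eqI simp: lu lookup_add lookup_single when_def)
    then show "(\<lambda>(a, b). (?l a, ?u a, ?u b)) ((\<lambda>(i, a, b). (a + ?s i, b + ?s (r - i))) p) = p"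
      by (simp add: p)
    have "a + ?s i + (b + ?s (r - i)) = \<theta> + ?s (i + (r - i))"
      by (simp add: p(3)[symmetric] single_add algebra_simps)
    then show "(\<lambda>(i, a, b). (a + ?s i, b + ?s (r - i))) p \<in> mono_splits (\<theta> + ?s r)"
      using p by (simp add: mono_splits_def)
    show "(case case p of (i, a, b) \<Rightarrow> (a + ?s i, b + ?s (r - i)) of (a, b) \<Rightarrow> F a b) =
        (case p of (i, a, b) \<Rightarrow> F (a + ?s i) (b + ?s (r - i)))"
      by (simp add: p)
  next
    fix p assume "p \<in> mono_splits (\<theta> + ?s r)"
    then obtain a b where p: "p = (a, b)" "a + b = \<theta> + ?s r" by (auto simp: mono_splits_def)
    have ab: "lookup a v + lookup b v = lookup \<theta> v + (if v = n then r else 0)" for v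
      using lk[OF p(2), of v] by (auto simp: lookup_add lookup_single when_def)
    have l: "?l a + ?l b = r" using ab[of n] \<theta>[of n] by simp
    then have rb: "r - ?l a = ?l b" by simp
    have "?u a + ?s (?l a) = a" "?u b + ?s (r - ?l a) = b"
      unfolding rb by (auto intro!: poly_mapping_eqI simp: lu lookup_add lookup_single when_def)
    then show "(\<lambda>(i, a, b). (a + ?s i, b + ?s (r - i))) ((\<lambda>(a, b). (?l a, ?u a, ?u b)) p) = p"
      by (simp add: p)
    have "?u a + ?u b = \<theta>"
      using ab \<theta>[of n] by (auto intro!: poly_mapping_eqI simp: lu lookup_add split: if_splits)
    then show "(\<lambda>(a, b). (?l a, ?u a, ?u b)) p \<in> (SIGMA i:{..r}. mono_splits \<theta>)"
      using l by (auto simp: p mono_splits_def)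
  qed
  finally show ?thesis by simp
qed

text \<open>For \<open>i = 0\<close> this is the Pieri rule read off at \<open>\<theta>\<close>. The
  offset \<open>i\<close> carries the induction: it records the degree that the variables already
  split off have contributed to the first factor.\<close>

lemma pieri_coefficients:
  assumes "is_partition lam"
  shows "(\<Sum>(a, b)\<in>mono_splits \<theta>. if mono_degree a + i = s then kostka lam b else 0) =
    (\<Sum>tau | is_partition tau \<and> hstrip tau lam \<and> sum_list tau + i = sum_list lam + s.
      kostka tau \<theta>)"
  using assms
proof (induction \<theta> arbitrary: i s lam rule: monomial_induct)
  case zero
  have m: "mono_splits 0 = {(0, 0)}"
  proof -
    have *: "a = 0 \<and> b = 0" if "a + b = 0" for a b :: "nat \<Rightarrow>\<^sub>0 nat"
    proof -
      have "mono_degree a + mono_degree b = 0" unfolding mono_degree_add[symmetric] that by simp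
      then show ?thesis by (simp add: mono_degree_eq_0_iff)
    qed
    show ?thesis unfolding mono_splits_def by (auto dest: *)
  qed
  let ?A = "{tau. is_partition tau \<and> hstrip tau lam \<and> sum_list tau + i = sum_list lam + s}"
  have fin: "finite ?A" by (rule finite_subset[OF _ finite_partitions_pred[of i "sum_list lam + s"]]) auto
  have "(\<Sum>tau\<in>?A. kostka tau 0) = (\<Sum>tau\<in>?A. if tau = [] then 1 else 0)"
    using kostka_zero by (intro sum.cong) (auto simp: kostka_Nil)
  also have "\<dots> = (if [] \<in> ?A then 1 else 0)"
    using fin by simp
  also have "[] \<in> ?A \<longleftrightarrow> lam = [] \<and> i = s"
  proof -
    have "lam = []" if "hstrip [] lam"
      using that zero by (intro partition_eqI) (auto simp: hstrip_def)
    then show ?thesis by (auto simp: hstrip_def)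
  qed
  also have "(if lam = [] \<and> i = s then 1 else 0) = (if i = s then kostka lam 0 else 0)"
    using kostka_zero[OF zero] by (auto simp: kostka_Nil)
  finally show ?case by (simp add: m)
next
  case (add n r \<theta>)
  define L where "L = hstrips_under lam"
  define U where "U = {tau. is_partition tau \<and> sum_list tau + (i + r) = sum_list lam + s}"
  define G where "G mu = (\<Sum>tau | tau \<in> U \<and> hstrip tau mu. kostka tau \<theta>)" for mu
  define R where "R = {rho. is_partition rho \<and> hstrip rho lam \<and> sum_list rho + i = sum_list lam + s}"
  have fin: "finite L" "finite U" by (simp_all add: L_def U_def)
  have finR: "finite R"
    by (rule finite_subset[OF _ finite_partitions_pred[of i "sum_list lam + s"]]) (auto simp: R_def)
  have "(\<Sum>(a, b)\<in>mono_splits (\<theta> + single n r). if mono_degree a + i = s then kostka lam b else 0)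
     = (\<Sum>j\<le>r. \<Sum>(a, b)\<in>mono_splits \<theta>. if mono_degree a + (i + j) = s
         then kostka lam (b + single n (r - j)) else 0)"
    by (subst sum_mono_splits_add_single[OF add.hyps]) (simp_all add: mono_degree_add ac_simps)
  also have "\<dots> = (\<Sum>j\<le>r. \<Sum>(a, b)\<in>mono_splits \<theta>.
      \<Sum>mu | mu \<in> L \<and> sum_list lam + j = sum_list mu + r. if mono_degree a + (i + j) = s then kostka mu b else 0)"
  proof (intro sum.cong refl)
    fix j p assume j: "j \<in> {..r}" and "p \<in> mono_splits \<theta>"
    then obtain a b where p: "p = (a, b)" and ab: "(a, b) \<in> mono_splits \<theta>"
      by (cases p) auto
    have b: "lookup b v = 0" if "n \<le> v" for v
      using add.hyps[OF that] ab by (auto simp: mono_splits_def lookup_add)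
    have eq: "{mu. is_partition mu \<and> hstrip lam mu \<and> sum_list lam = sum_list mu + (r - j)} =
        {mu. mu \<in> L \<and> sum_list lam + j = sum_list mu + r}"
      using j by (auto simp: L_def)
    show "(case p of (a, b) \<Rightarrow> if mono_degree a + (i + j) = s
          then kostka lam (b + single n (r - j)) else 0) =
      (case p of (a, b) \<Rightarrow> \<Sum>mu | mu \<in> L \<and> sum_list lam + j = sum_list mu + r.
          if mono_degree a + (i + j) = s then kostka mu b else 0)"
      using kostka_branch[OF add.prems b, of n "r - j"] eq by (simp add: p)
  qed
  also have "\<dots> = (\<Sum>j\<le>r. \<Sum>mu | mu \<in> L \<and> sum_list lam + j = sum_list mu + r.
      \<Sum>(a, b)\<in>mono_splits \<theta>. if mono_degree a + (i + j) = s then kostka mu b else 0)"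
    by (subst sum.swap) (simp add: case_prod_unfold)
  also have "\<dots> = (\<Sum>j\<le>r. \<Sum>mu | mu \<in> L \<and> sum_list lam + j = sum_list mu + r.
      G mu)"
  proof (intro sum.cong refl)
    fix j mu assume "mu \<in> {mu. mu \<in> L \<and> sum_list lam + j = sum_list mu + r}"
    then have mu: "is_partition mu" and sz: "sum_list lam + j = sum_list mu + r" by (auto simp: L_def)
    have eq: "{tau. is_partition tau \<and> hstrip tau mu \<and> sum_list tau + (i + j) = sum_list mu + s} =
        {tau. tau \<in> U \<and> hstrip tau mu}"
      using sz by (auto simp: U_def)
    show "(\<Sum>(a, b)\<in>mono_splits \<theta>. if mono_degree a + (i + j) = s then kostka mu b else 0) =
        G mu"
      using add.IH[OF mu, of "i + j" s] eq by (simp add: G_def)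
  qed
  also have "\<dots> = (\<Sum>mu\<in>L. \<Sum>j | j \<in> {..r} \<and> sum_list lam + j = sum_list mu + r.
      G mu)"
    by (rule sum.swap_restrict) (use fin in auto)
  also have "\<dots> = (\<Sum>mu\<in>L. if sum_list lam \<le> sum_list mu + r
      then G mu else 0)"
  proof (intro sum.cong refl)
    fix mu assume "mu \<in> L"
    then have "sum_list mu \<le> sum_list lam" using hstrip_size by (auto simp: L_def)
    then have "{j. j \<in> {..r} \<and> sum_list lam + j = sum_list mu + r} =
        (if sum_list lam \<le> sum_list mu + r then {sum_list mu + r - sum_list lam} else {})"
      by auto
    then show "(\<Sum>j | j \<in> {..r} \<and> sum_list lam + j = sum_list mu + r.
        G mu) =
      (if sum_list lam \<le> sum_list mu + r
        then G mu else 0)"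
      by simp
  qed
  also have "\<dots> = (\<Sum>mu | mu \<in> L \<and> sum_list lam \<le> sum_list mu + r.
      G mu)"
    by (rule sum.inter_filter[OF fin(1), symmetric])
  also have "\<dots> = (\<Sum>tau\<in>U. \<Sum>mu | mu \<in> {mu. mu \<in> L \<and> sum_list lam \<le> sum_list mu + r} \<and> hstrip tau mu.
      kostka tau \<theta>)"
    unfolding G_def by (rule sum.swap_restrict) (use fin in auto)
  \<comment> \<open>The strip exchange trades the common lower neighbours \<open>mu\<close> of
    \<open>lam\<close> and \<open>tau\<close> for common upper neighbours \<open>rho\<close>.
    Branching \<open>rho\<close> then restores the last variable.\<close>
  also have "\<dots> = (\<Sum>tau\<in>U. \<Sum>rho | rho \<in> R \<and> hstrip rho tau. kostka tau \<theta>)"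
  proof (rule sum.cong[OF refl])
    fix tau assume tau: "tau \<in> U"
    then have Ptau: "is_partition tau" and sz: "sum_list tau + (i + r) = sum_list lam + s"
      by (auto simp: U_def)
    have "card {mu. mu \<in> {mu. mu \<in> L \<and> sum_list lam \<le> sum_list mu + r} \<and> hstrip tau mu} =
      card {mu. is_partition mu \<and> hstrip tau mu \<and> hstrip lam mu \<and> sum_list lam \<le> sum_list mu + r}"
      by (rule arg_cong[of _ _ card]) (auto simp: L_def)
    also have "\<dots> = card {rho. is_partition rho \<and> hstrip rho tau \<and> hstrip rho lam
        \<and> sum_list rho = sum_list tau + r}"
      by (rule card_strip_exchange[OF Ptau add.prems, symmetric])
    also have "\<dots> = card {rho. rho \<in> R \<and> hstrip rho tau}"
      using sz by (intro arg_cong[of _ _ card]) (auto simp: R_def)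
    finally show "(\<Sum>mu | mu \<in> {mu. mu \<in> L \<and> sum_list lam \<le> sum_list mu + r} \<and> hstrip tau mu. kostka tau \<theta>) =
        (\<Sum>rho | rho \<in> R \<and> hstrip rho tau. kostka tau \<theta>)"
      by simp
  qed
  also have "\<dots> = (\<Sum>rho\<in>R. \<Sum>tau | tau \<in> U \<and> hstrip rho tau. kostka tau \<theta>)"
    by (rule sum.swap_restrict[OF finR fin(2), symmetric])
  also have "\<dots> = (\<Sum>rho\<in>R. kostka rho (\<theta> + single n r))"
  proof (rule sum.cong[OF refl])
    fix rho assume rho: "rho \<in> R"
    then have "{mu. is_partition mu \<and> hstrip rho mu \<and> sum_list rho = sum_list mu + r} =
        {tau. tau \<in> U \<and> hstrip rho tau}"
      by (auto simp: R_def U_def)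
    then show "(\<Sum>tau | tau \<in> U \<and> hstrip rho tau. kostka tau \<theta>) =
        kostka rho (\<theta> + single n r)"
      using kostka_branch[OF _ add.hyps, of rho n r] rho by (simp add: R_def)
  qed
  finally show ?case by (simp add: R_def)
qed

abbreviation h :: "nat \<Rightarrow> rat mps" where "h r \<equiv> schur (one_row r)"

abbreviation e :: "nat \<Rightarrow> rat mps" where "e r \<equiv> schur (one_column r)"

lemma mps_coeff_simps [simp]:
  "mps_coeff 0 \<theta> = 0"
  "mps_coeff 1 \<theta> = (if \<theta> = 0 then 1 else 0)"
  "mps_coeff (f + g) \<theta> = mps_coeff f \<theta> + mps_coeff g \<theta>"
  "mps_coeff (f - g) \<theta> = mps_coeff f \<theta> - mps_coeff g \<theta>"
  "mps_coeff (- f) \<theta> = - mps_coeff f \<theta>"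
  "mps_coeff (mps_scale c f) \<theta> = c * mps_coeff f \<theta>"
  by (simp_all add: zero_mps_def one_mps_def plus_mps_def minus_mps_def uminus_mps_def mps_scale_def)

lemma mps_coeff_mult:
  "mps_coeff (f * g) \<theta> = (\<Sum>(a, b)\<in>mono_splits \<theta>. mps_coeff f a * mps_coeff g b)"
  by (simp add: times_mps_def)

lemma mps_coeff_sum [simp]: "mps_coeff (\<Sum>x\<in>A. f x) \<theta> = (\<Sum>x\<in>A. mps_coeff (f x) \<theta>)"
  by (induction A rule: infinite_finite_induct) auto

lemma schur_Nil [simp]: "schur [] = 1"
  by (rule mps_eqI) (simp add: mps_coeff_schur kostka_Nil)

lemma h_0 [simp]: "h 0 = 1"
  by (simp add: one_row_def)

lemma e_0 [simp]: "e 0 = 1"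
  by (simp add: one_column_def)

lemma pieri_h:
  assumes "is_partition lam"
  shows "h s * schur lam =
    (\<Sum>tau\<in>hstrips_over lam (sum_list lam + s). schur tau)"
proof (rule mps_eqI)
  fix \<theta>
  have "mps_coeff (h s * schur lam) \<theta> =
      of_nat (\<Sum>(a, b)\<in>mono_splits \<theta>. if mono_degree a + 0 = s then kostka lam b else 0)"
    by (auto simp: mps_coeff_mult mps_coeff_schur kostka_one_row case_prod_unfold intro!: sum.cong)
  then show "mps_coeff (h s * schur lam) \<theta> = mps_coeff (\<Sum>tau | is_partition tau \<and>
      hstrip tau lam \<and> sum_list tau = sum_list lam + s. schur tau) \<theta>"
    unfolding pieri_coefficients[OF assms] by (simp add: mps_coeff_schur)
qed

section \<open>Sign-reversing involutions\<close>

lemma sum_sign_reversing: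
  fixes f :: "'a \<Rightarrow> rat"
  assumes "\<And>x. x \<in> A \<Longrightarrow> g x \<in> A" "\<And>x. x \<in> A \<Longrightarrow> g (g x) = x" "\<And>x. x \<in> A \<Longrightarrow> f (g x) = - f x"
  shows "sum f A = 0"
proof -
  have "sum f A = (\<Sum>x\<in>A. f (g x))"
    by (rule sum.reindex_bij_witness[where i = g and j = g]) (use assms in auto)
  also have "\<dots> = - sum f A"
    using assms(3) by (simp add: sum_negf)
  finally show ?thesis by simp
qed

text \<open>Row \<open>i0\<close> can be switched between its two admissible values, which changes the sign.\<close>

lemma sum_box_eq_0:
  assumes box: "\<And>i. b (Suc i) \<le> a i" and i0: "b i0 = Suc (a i0)"
  shows "(\<Sum>tau | is_partition tau \<and> (\<forall>i. a i \<le> part tau i \<and> part tau i \<le> b i). (- 1) ^ sum_list tau) = (0 :: rat)"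
    (is "sum _ ?A = 0")
proof -
  define t where "t tau = (part tau)(i0 := a i0 + b i0 - part tau i0)" for tau
  define g where "g tau = of_parts (t tau)" for tau
  have g: "is_partition (g tau)" "part (g tau) = t tau" "g tau \<in> ?A"
    "(- 1 :: rat) ^ sum_list (g tau) = - ((- 1) ^ sum_list tau)" if tau: "tau \<in> ?A" for tau
  proof -
    have P: "is_partition tau" and ab: "a i \<le> part tau i" "part tau i \<le> b i" for i using tau by auto
    have t: "a i \<le> t tau i" "t tau i \<le> b i" for i
      using ab[of i] by (auto simp: t_def)
    \<comment> \<open>The rows vary independently inside the box, because the lower end of each row
      is at least the upper end of the next.\<close>
    have anti: "t tau j \<le> t tau i" if "i \<le> j" for i j
    proof (rule lift_Suc_antimono_le[of "t tau", OF _ that])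
      show "t tau (Suc n) \<le> t tau n" for n
        using t(2)[of "Suc n"] box[of n] t(1)[of n] by linarith
    qed
    define N where "N = Suc (max (length tau) i0)"
    have z: "t tau N = 0" by (simp add: t_def N_def part_beyond)
    note G = is_partition_of_parts[of "t tau", OF anti z] part_of_parts[of "t tau", OF anti z]
      length_of_parts_le[of "t tau", OF anti z]
    show 1: "is_partition (g tau)" "part (g tau) = t tau" using G by (simp_all add: g_def)
    then show "g tau \<in> ?A" using t by simp
    have "sum_list (g tau) = (\<Sum>i<N. t tau i)" using sum_part[OF G(3)] G(2) by (simp add: g_def)
    also have "\<dots> = t tau i0 + (\<Sum>i\<in>{..<N} - {i0}. part tau i)"
      by (subst sum.remove[of _ i0]) (auto simp: N_def t_def intro!: sum.cong)
    finally have "sum_list (g tau) = t tau i0 + (\<Sum>i\<in>{..<N} - {i0}. part tau i)" .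
    moreover have "sum_list tau = (\<Sum>i<N. part tau i)"
      by (rule sum_part[symmetric]) (simp add: N_def)
    then have "sum_list tau = part tau i0 + (\<Sum>i\<in>{..<N} - {i0}. part tau i)"
      by (subst (asm) sum.remove[of _ i0]) (auto simp: N_def)
    moreover have "t tau i0 + part tau i0 = Suc (2 * a i0)"
      using ab[of i0] i0 by (simp add: t_def)
    ultimately have "sum_list (g tau) + sum_list tau = Suc (2 * (a i0 + (\<Sum>i\<in>{..<N} - {i0}. part tau i)))"
      by simp
    then have "odd (sum_list (g tau) + sum_list tau)" by simp
    then show "(- 1 :: rat) ^ sum_list (g tau) = - ((- 1) ^ sum_list tau)"
      by (cases "even (sum_list tau)") auto
  qed
  have "g (g tau) = tau" if tau: "tau \<in> ?A" for tau
  proof (rule partition_eqI)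
    fix i
    have "a i0 \<le> part tau i0" "part tau i0 \<le> b i0" using tau by auto
    then show "part (g (g tau)) i = part tau i"
      using g(2)[OF g(3)[OF tau]] by (simp add: t_def g(2)[OF tau])
  qed (use g tau in auto)
  then show ?thesis using g by (intro sum_sign_reversing[where g = g]) auto
qed

text \<open>The combinatorial core of the alternating relation between \<open>e\<close> and
  \<open>h\<close>. The candidates for \<open>tau\<close>, if any, fill a box. If \<open>nu\<close>
  and \<open>sig\<close> differ, the first row where they do has two admissible values and
  everything cancels; if they agree, \<open>tau\<close> is forced.\<close>

lemma sum_vertical_horizontal:
  assumes nu: "is_partition nu" and sig: "is_partition sig"
  shows "(\<Sum>tau | is_partition tau \<and> vstrip nu tau \<and> hstrip tau sig. (- 1) ^ sum_list tau) =
    (if nu = sig then (- 1) ^ sum_list sig else (0 :: rat))" (is "sum _ ?X = _")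
proof (cases "nu = sig")
  case True
  have "?X = {sig}"
  proof -
    have "tau = sig" if "tau \<in> ?X" for tau
      using that True by (intro partition_eqI sig) (auto simp: vstrip_def hstrip_def intro: antisym)
    moreover have "sig \<in> ?X"
      using True sig part_antimono[OF sig] by (auto simp: vstrip_def hstrip_def)
    ultimately show ?thesis by blast
  qed
  then show ?thesis using True by simp
next
  case False
  show ?thesis
  proof (cases "?X = {}")
    case X: False
    then obtain tau where "tau \<in> ?X" by blast
    then have "part sig i \<le> part tau i" "part tau i \<le> part nu i" for i
      by (auto simp: vstrip_def hstrip_def)
    then have sn: "part sig i \<le> part nu i" for i using order_trans by blast
    have "\<exists>i. part nu i \<noteq> part sig i" using False partition_eqI[OF nu sig] by blast
    define i0 where "i0 = (LEAST i. part nu i \<noteq> part sig i)"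
    have i0: "part nu i0 \<noteq> part sig i0"
      unfolding i0_def using \<open>\<exists>i. part nu i \<noteq> part sig i\<close> by (rule LeastI_ex)
    have below: "part nu i = part sig i" if "i < i0" for i
      using not_less_Least that unfolding i0_def by blast
    define a where "a i = max (part nu i - 1) (part sig i)" for i
    define b where "b i = (case i of 0 \<Rightarrow> part nu 0 | Suc j \<Rightarrow> min (part nu i) (part sig j))" for i
    have "?X = {tau. is_partition tau \<and> (\<forall>i. a i \<le> part tau i \<and> part tau i \<le> b i)}"
    proof (rule Collect_cong, rule conj_cong[OF refl])
      fix tau
      show "vstrip nu tau \<and> hstrip tau sig \<longleftrightarrow> (\<forall>i. a i \<le> part tau i \<and> part tau i \<le> b i)"
      proof (safe)
        fix i assume *: "vstrip nu tau" "hstrip tau sig"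
        then have "part tau i \<le> part nu i" "part nu i \<le> Suc (part tau i)" "part sig i \<le> part tau i"
          by (simp_all add: vstrip_def hstrip_def)
        then show "a i \<le> part tau i" by (simp add: a_def)
        show "part tau i \<le> b i"
          using * by (cases i) (simp_all add: b_def vstrip_def hstrip_def)
      next
        assume *: "\<forall>i. a i \<le> part tau i \<and> part tau i \<le> b i"
        have "part tau i \<le> part nu i" for i using *[rule_format, of i] by (cases i) (simp_all add: b_def)
        moreover have "part nu i \<le> Suc (part tau i)" "part sig i \<le> part tau i" for i
          using *[rule_format, of i] unfolding a_def by linarith+
        moreover have "part tau (Suc i) \<le> part sig i" for i
          using *[rule_format, of "Suc i"] by (simp add: b_def)
        ultimately show "vstrip nu tau" "hstrip tau sig"
          by (simp_all add: vstrip_def hstrip_def)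
      qed
    qed
    moreover have "b (Suc i) \<le> a i" for i by (simp add: a_def b_def)
    moreover have "b i0 = Suc (a i0)"
    proof -
      have lt: "part sig i0 < part nu i0" using i0 sn[of i0] by simp
      then have "a i0 = part nu i0 - 1" by (simp add: a_def)
      moreover have "b i0 = part nu i0"
      proof (cases i0)
        \<comment> \<open>In the row above, \<open>nu\<close> and \<open>sig\<close> agree, so the
          bound \<open>part sig j\<close> does not cut below \<open>part nu i0\<close>.\<close>
        case (Suc j)
        then show ?thesis using below[of j] part_antimono[OF nu, of j i0] by (simp add: b_def)
      qed (simp add: b_def)
      ultimately show ?thesis using lt by simp
    qed
    ultimately show ?thesis using sum_box_eq_0[of b a i0] False by simp
  next
    case True
    then show ?thesis using False by (simp only: sum.empty if_False)
  qed
qed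

text \<open>The combinatorial core of the Bernstein operator. Candidates again fill a box, which has
  a row with two admissible values unless each row of \<open>sig\<close> equals
  \<open>part nu (Suc i)\<close> or \<open>Suc (part nu i)\<close>. Among such \<open>sig\<close>
  the size singles out \<open>mu\<close>.\<close>

lemma sum_vertical_horizontal_column:
  assumes mu: "is_partition mu" and sig: "is_partition sig" and size: "sum_list sig = sum_list mu"
  defines "nu \<equiv> remove_first_column mu"
  shows "(\<Sum>rho | is_partition rho \<and> vstrip sig rho \<and> hstrip nu rho. (- 1) ^ sum_list rho) =
    (if sig = mu then (- 1) ^ sum_list nu else (0 :: rat))" (is "sum _ ?X = _")
proof -
  have Pnu: "is_partition nu" and pnu: "part nu i = part mu i - 1" for i
    using partition_remove_first_column[OF mu] by (auto simp: nu_def)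
  define r where "r = length mu"
  have mu_eq: "part mu i = (if i < r then Suc (part nu i) else 0)" for i
    using part_pos_iff[OF mu, of i] by (auto simp: pnu r_def part_beyond)
  have nu_zero: "part nu i = 0" if "r \<le> i" for i using that by (simp add: pnu part_beyond r_def)
  show ?thesis
  proof (cases "sig = mu")
    case True
    have "?X = {nu}"
    proof -
      have "rho = nu" if "rho \<in> ?X" for rho
      proof (rule partition_eqI)
        fix i
        have 1: "part rho i \<le> part nu i" "part mu i \<le> Suc (part rho i)"
          using that True by (auto simp: vstrip_def hstrip_def)
        show "part rho i = part nu i"
          using 1 nu_zero[of i] by (cases "i < r") (simp_all add: mu_eq)
      qed (use that Pnu in auto)
      moreover have "nu \<in> ?X"
        using True Pnu part_antimono[OF Pnu] nu_zero
        by (auto simp: vstrip_def hstrip_def mu_eq)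
      ultimately show ?thesis by blast
    qed
    then show ?thesis using True by simp
  next
    case False
    show ?thesis
    proof (cases "?X = {}")
      case X: False
      then obtain rho where "rho \<in> ?X" by blast
      then have rho: "part rho i \<le> part sig i" "part sig i \<le> Suc (part rho i)"
        "part nu (Suc i) \<le> part rho i" "part rho i \<le> part nu i" for i
        by (auto simp: vstrip_def hstrip_def)
      define a where "a i = max (part sig i - 1) (part nu (Suc i))" for i
      define b where "b i = min (part sig i) (part nu i)" for i
      have "\<exists>i0. part nu (Suc i0) < part sig i0 \<and> part sig i0 \<le> part nu i0"
      proof (rule ccontr)
        assume "\<not> ?thesis"
        then have alt: "part sig i = part nu (Suc i) \<or> part sig i = Suc (part nu i)" for i
          using rho[of i] by (metis le_SucE le_antisym not_le order_trans Suc_le_mono)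
        have "part sig (max (length sig) r) = 0" by (simp add: part_beyond)
        then have ex: "\<exists>i. part sig i \<noteq> Suc (part nu i)" by (metis Zero_not_Suc)
        \<comment> \<open>Above row \<open>s\<close>, \<open>sig\<close> is \<open>nu\<close> with a
          column added. From row \<open>s\<close> on it is \<open>nu\<close> moved up by one row:
          switching back to the other alternative would make \<open>sig\<close> increase.\<close>
        define s where "s = (LEAST i. part sig i \<noteq> Suc (part nu i))"
        have s: "part sig s \<noteq> Suc (part nu s)" unfolding s_def using ex by (rule LeastI_ex)
        have below: "part sig i = Suc (part nu i)" if "i < s" for i
          using not_less_Least that unfolding s_def by blast
        have above: "part sig i = part nu (Suc i)" if "s \<le> i" for i
          using that
        proof (induction rule: dec_induct)
          case base
          then show ?case using alt[of s] s by blast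
        next
          case (step i)
          then show ?case
            using alt[of "Suc i"] part_antimono[OF sig, of i "Suc i"] by auto
        qed
        define N where "N = max (max (length sig) (length nu)) (max r s)"
        have N: "s \<le> N" "length sig \<le> N" "length nu \<le> N" by (auto simp: N_def)
        \<comment> \<open>Compared with \<open>nu\<close>, \<open>sig\<close> gains \<open>s\<close>
          cells from the added column and loses row \<open>s\<close>. As \<open>mu\<close> gains
          \<open>r\<close> cells, equal sizes force \<open>s = r\<close>.\<close>
        have eq: "sum_list sig + part nu s = sum_list nu + s"
        proof -
          have split: "(\<Sum>i<N. f i) = (\<Sum>i<s. f i) + (\<Sum>i=s..<N. f i)" for f :: "nat \<Rightarrow> nat"
            using sum.atLeastLessThan_concat[of 0 s N f] N(1) by (simp add: atLeast0LessThan)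
          have "sum_list sig = (\<Sum>i<s. Suc (part nu i)) + (\<Sum>i=s..<N. part nu (Suc i))"
            using sum_part[OF N(2)] split[of "part sig"] below above by simp
          moreover have "(\<Sum>i=s..<N. part nu (Suc i)) + part nu s = (\<Sum>i=s..<Suc N. part nu i)"
            using sum.atLeast_Suc_lessThan[of s "Suc N" "part nu"] sum.shift_bounds_Suc_ivl[of "part nu" s N]
              N(1) by (simp del: sum.op_ivl_Suc)
          moreover have "part nu N = 0" using N(3) by (simp add: part_beyond)
          then have "(\<Sum>i=s..<Suc N. part nu i) = (\<Sum>i=s..<N. part nu i)" using N(1) by simp
          moreover have "sum_list nu = (\<Sum>i<s. part nu i) + (\<Sum>i=s..<N. part nu i)"
            using sum_part[OF N(3)] split[of "part nu"] by simp
          moreover have "(\<Sum>i<s. Suc (part nu i)) = (\<Sum>i<s. part nu i) + s"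
            by (induction s) auto
          ultimately show ?thesis by simp
        qed
        have "sum_list sig = sum_list nu + r"
          using sum_list_remove_first_column[OF mu] size by (simp add: nu_def r_def)
        with eq have sr: "r + part nu s = s" by simp
        then have "part nu s = 0" using nu_zero[of s] by simp
        with sr have "s = r" by simp
        have "sig = mu"
        proof (rule partition_eqI[OF sig mu])
          show "part sig i = part mu i" for i
            using below[of i] above[of i] nu_zero[of "Suc i"] \<open>s = r\<close>
            by (cases "i < r") (simp_all add: mu_eq)
        qed
        with False show False by simp
      qed
      then obtain i0 where i0: "part nu (Suc i0) < part sig i0" "part sig i0 \<le> part nu i0" by blast
      have "?X = {tau. is_partition tau \<and> (\<forall>i. a i \<le> part tau i \<and> part tau i \<le> b i)}"
      proof (rule Collect_cong, rule conj_cong[OF refl])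
        fix tau
        show "vstrip sig tau \<and> hstrip nu tau \<longleftrightarrow> (\<forall>i. a i \<le> part tau i \<and> part tau i \<le> b i)"
          unfolding vstrip_def hstrip_def a_def b_def all_conj_distrib[symmetric]
          by (rule all_cong1) linarith
      qed
      moreover have "b (Suc i) \<le> a i" for i by (simp add: a_def b_def)
      moreover have "b i0 = Suc (a i0)" using i0 by (simp add: a_def b_def)
      ultimately show ?thesis using sum_box_eq_0[of b a i0] False by simp
    next
      case True
      then show ?thesis using False by (simp only: sum.empty if_False)
    qed
  qed
qed

lemma vstrip_Nil: 
  assumes "is_partition nu"
  shows "vstrip nu [] \<longleftrightarrow> nu = one_column (sum_list nu)"
proof
  assume v: "vstrip nu []"
  have le: "part nu i \<le> 1" for i using v by (simp add: vstrip_def)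
  have "nu = one_column (length nu)"
  proof (intro partition_eqI assms)
    fix i
    show "part nu i = part (one_column (length nu)) i"
      using le[of i] part_pos_iff[OF assms, of i] by (auto simp: part_one_column)
  qed simp
  then show "nu = one_column (sum_list nu)" by (metis sum_list_one_column)
next
  assume "nu = one_column (sum_list nu)"
  then have "part nu i \<le> 1" for i by (metis part_one_column le_refl zero_le)
  then show "vstrip nu []" by (simp add: vstrip_def)
qed

text \<open>Once the Pieri rule for \<open>e\<close> is known, the double sum over strips is
  \<open>e i * (h (j - i) * schur sig)\<close>. It is phrased through strips because that rule is
  derived from it.\<close>

lemma sum_vertical_horizontal_schur:
  assumes sig: "is_partition sig"
  shows "(\<Sum>i\<le>j. (- 1) ^ i * (\<Sum>tau\<in>hstrips_over sig (sum_list sig + (j - i)).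
       \<Sum>nu\<in>vstrips_over tau (sum_list tau + i). schur nu)) =
     (if j = 0 then schur sig else 0)"
proof -
  define T where "T = {tau. is_partition tau \<and> hstrip tau sig \<and> sum_list tau \<le> sum_list sig + j}"
  define U where "U = partitions_of (sum_list sig + j)"
  have fin: "finite T" "finite U"
    by (rule finite_subset[OF _ finite_partitions_bounded[of "sum_list sig + j"]]) (auto simp: T_def U_def)
  define W where "W tau = (\<Sum>nu | nu \<in> U \<and> vstrip nu tau. schur nu)" for tau
  define D where "D tau = sum_list sig + j - sum_list tau" for tau
  have "(\<Sum>i\<le>j. (- 1) ^ i * (\<Sum>tau\<in>hstrips_over sig (sum_list sig + (j - i)).
       \<Sum>nu\<in>vstrips_over tau (sum_list tau + i). schur nu)) =
     (\<Sum>i\<le>j. \<Sum>tau | tau \<in> T \<and> sum_list tau + i = sum_list sig + j.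
       (- 1) ^ i * W tau)"
  proof (rule sum.cong[OF refl])
    fix i assume i: "i \<in> {..j}"
    have 1: "hstrips_over sig (sum_list sig + (j - i)) =
        {tau. tau \<in> T \<and> sum_list tau + i = sum_list sig + j}"
      using i by (auto simp: T_def)
    have 2: "vstrips_over tau (sum_list tau + i) = {nu. nu \<in> U \<and> vstrip nu tau}"
      if "sum_list tau + i = sum_list sig + j" for tau
      using that by (auto simp: U_def partitions_of_def)
    show "(- 1) ^ i * (\<Sum>tau\<in>hstrips_over sig (sum_list sig + (j - i)).
       \<Sum>nu\<in>vstrips_over tau (sum_list tau + i). schur nu) =
     (\<Sum>tau | tau \<in> T \<and> sum_list tau + i = sum_list sig + j.
       (- 1) ^ i * W tau)"
      unfolding 1 W_def sum_distrib_left[of "(- 1) ^ i"]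
    proof (rule sum.cong[OF refl])
      fix tau assume "tau \<in> {tau. tau \<in> T \<and> sum_list tau + i = sum_list sig + j}"
      then have "sum_list tau + i = sum_list sig + j" by simp
      from 2[OF this]
      show "(\<Sum>nu\<in>vstrips_over tau (sum_list tau + i). (- 1) ^ i * schur nu) =
          (\<Sum>nu | nu \<in> U \<and> vstrip nu tau. (- 1) ^ i * schur nu)"
        by (simp only:)
    qed
  qed
  also have "\<dots> = (\<Sum>tau\<in>T. \<Sum>i | i \<in> {..j} \<and> sum_list tau + i = sum_list sig + j.
       (- 1) ^ i * W tau)"
    by (rule sum.swap_restrict) (use fin in auto)
  also have "\<dots> = (\<Sum>tau\<in>T. \<Sum>nu | nu \<in> U \<and> vstrip nu tau. (- 1) ^ D tau * schur nu)"
  proof (rule sum.cong[OF refl])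
    fix tau assume tau: "tau \<in> T"
    then have "sum_list sig \<le> sum_list tau" using hstrip_size by (auto simp: T_def)
    then have "{i. i \<in> {..j} \<and> sum_list tau + i = sum_list sig + j} = {D tau}"
      using tau by (auto simp: T_def D_def)
    then show "(\<Sum>i | i \<in> {..j} \<and> sum_list tau + i = sum_list sig + j.
       (- 1) ^ i * W tau) =
       (\<Sum>nu | nu \<in> U \<and> vstrip nu tau. (- 1) ^ D tau * schur nu)"
      by (simp add: sum_distrib_left W_def)
  qed
  also have "\<dots> = (\<Sum>nu\<in>U. \<Sum>tau | tau \<in> T \<and> vstrip nu tau. (- 1) ^ D tau * schur nu)"
    by (rule sum.swap_restrict) (use fin in auto)
  also have "\<dots> = (\<Sum>nu\<in>U. if nu = sig then schur sig else 0)"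
  proof (rule sum.cong[OF refl])
    fix nu assume "nu \<in> U"
    then have nu: "is_partition nu" "sum_list nu = sum_list sig + j" by (auto simp: U_def partitions_of_def)
    have X: "{tau. tau \<in> T \<and> vstrip nu tau} =
        {tau. is_partition tau \<and> vstrip nu tau \<and> hstrip tau sig}" (is "_ = ?X")
      using vstrip_size[of nu] nu(2) by (auto simp: T_def)
    have sgn: "(- 1) ^ D tau * schur nu = mps_scale ((- 1) ^ (sum_list nu) * (- 1) ^ sum_list tau) (schur nu)" if "tau \<in> ?X" for tau
    proof -
      have "sum_list tau \<le> sum_list nu" using that vstrip_size by auto
      then have "sum_list nu = D tau + sum_list tau" by (simp add: D_def nu(2))
      then have "(- 1 :: rat) ^ sum_list nu * (- 1) ^ sum_list tau = (- 1) ^ D tau"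
        by (simp add: power_add)
      then show ?thesis by (cases "even (D tau)") (auto intro: mps_eqI)
    qed
    have "(\<Sum>tau | tau \<in> T \<and> vstrip nu tau. (- 1) ^ D tau * schur nu) =
        (\<Sum>tau\<in>?X. mps_scale ((- 1) ^ sum_list nu * (- 1) ^ sum_list tau) (schur nu))"
      unfolding X by (rule sum.cong[OF refl]) (rule sgn)
    also have "\<dots> = mps_scale ((- 1) ^ sum_list nu * (\<Sum>tau\<in>?X. (- 1) ^ sum_list tau)) (schur nu)"
      by (simp add: sum_distrib_left mps.scale_sum_left)
    also have "\<dots> = (if nu = sig then schur sig else 0)"
      unfolding sum_vertical_horizontal[OF nu(1) sig] by (simp flip: power_mult_distrib)
    finally show "(\<Sum>tau | tau \<in> T \<and> vstrip nu tau. (- 1) ^ D tau * schur nu) = (if nu = sig then schur sig else 0)" .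
  qed
  also have "\<dots> = (if j = 0 then schur sig else 0)"
    using fin sig by (simp add: U_def partitions_of_def)
  finally show ?thesis .
qed

text \<open>Both claims share one strong induction. The Pieri rule for \<open>i < j\<close> turns
  the strip identity into an equation for the sum \<open>W j sig\<close> over vertical strips; the
  same equation at the empty partition determines \<open>e j\<close>. Multiplying the latter by
  \<open>schur sig\<close> and comparing gives the rule for \<open>j\<close>.\<close>

lemma pieri_e_aux:
  assumes "is_partition sig"
  shows "e j * schur sig =
      (\<Sum>nu\<in>vstrips_over sig (sum_list sig + j). schur nu) \<and>
    (\<Sum>i\<le>j. (- 1) ^ i * (e i * h (j - i))) = (if j = 0 then 1 else 0)"
  using assms
proof (induction j arbitrary: sig rule: less_induct)
  case (less j)
  define W where "W i tau = (\<Sum>nu\<in>vstrips_over tau (sum_list tau + i). schur nu)"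
    for i tau
  define R where "R = (\<Sum>i<j. (- 1) ^ i * (e i * h (j - i)))"
  have W: "(- 1) ^ j * W j sig + R * schur sig = (if j = 0 then schur sig else 0)"
    if sig: "is_partition sig" for sig
  proof -
    have hz: "hstrips_over sig (sum_list sig) = {sig}"
    proof -
      have "tau = sig" if "is_partition tau" "hstrip tau sig" "sum_list tau = sum_list sig" for tau
      proof (rule partition_eqI)
        fix i
        have le: "part sig i \<le> part tau i" for i using that by (simp add: hstrip_def)
        define N where "N = max (Suc i) (max (length sig) (length tau))"
        have "(\<Sum>i<N. part sig i) = (\<Sum>i<N. part tau i)"
          using that(3) by (simp add: sum_part N_def)
        then show "part tau i = part sig i"
          using le sum_mono_inv[of "part sig" "{..<N}" "part tau" i] by (simp add: N_def)
      qed (use that sig in auto)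
      then show ?thesis using sig part_antimono[OF sig] by (auto simp: hstrip_def)
    qed
    have "(\<Sum>i\<le>j. (- 1) ^ i * (\<Sum>tau\<in>hstrips_over sig (sum_list sig + (j - i)).
        W i tau)) = (\<Sum>i<j. (- 1) ^ i * (\<Sum>tau\<in>hstrips_over sig (sum_list sig + (j - i)).
        W i tau)) + (- 1) ^ j * W j sig"
      by (simp add: hz flip: lessThan_Suc_atMost)
    also have "(\<Sum>i<j. (- 1) ^ i * (\<Sum>tau\<in>hstrips_over sig (sum_list sig + (j - i)).
        W i tau)) = (\<Sum>i<j. (- 1) ^ i * (e i * (h (j - i) * schur sig)))"
    proof (rule sum.cong[OF refl])
      fix i assume "i \<in> {..<j}"
      then have "W i tau = e i * schur tau" if "is_partition tau" for tau
        using less.IH[of i tau] that by (simp add: W_def)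
      then show "(- 1) ^ i * (\<Sum>tau\<in>hstrips_over sig (sum_list sig + (j - i)).
        W i tau) = (- 1) ^ i * (e i * (h (j - i) * schur sig))"
        by (simp add: pieri_h[OF sig] sum_distrib_left)
    qed
    also have "\<dots> = R * schur sig" by (simp add: R_def sum_distrib_right mult.assoc)
    finally show ?thesis
      using sum_vertical_horizontal_schur[OF sig, of j] by (simp add: W_def add.commute)
  qed
  \<comment> \<open>A vertical strip over the empty partition is a column, so \<open>W j []\<close>
    is \<open>e j\<close> itself.\<close>
  have "vstrips_over [] j = {one_column j}"
    by (auto simp: vstrip_Nil)
  then have "W j [] = e j" by (simp add: W_def)
  with W[of "[]"] have E: "(- 1) ^ j * e j + R = (if j = 0 then 1 else 0)" by simp
  then have "(- 1) ^ j * W j sig + R * schur sig = ((- 1) ^ j * e j + R) * schur sig"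
    using W[OF less.prems] by simp
  then have eq: "(- 1) ^ j * W j sig = (- 1) ^ j * (e j * schur sig)" by (simp add: algebra_simps)
  have "W j sig = (- 1) ^ j * ((- 1) ^ j * W j sig)"
    by (simp flip: mult.assoc power_mult_distrib)
  also have "\<dots> = e j * schur sig"
    unfolding eq by (simp flip: mult.assoc power_mult_distrib)
  finally have "W j sig = e j * schur sig" .
  moreover have "(\<Sum>i\<le>j. (- 1) ^ i * (e i * h (j - i))) = (if j = 0 then 1 else 0)"
    using E by (simp add: R_def add.commute flip: lessThan_Suc_atMost)
  ultimately show ?case by (simp add: W_def)
qed

lemmas pieri_e = pieri_e_aux[THEN conjunct1]

lemma sum_e_h: "(\<Sum>i\<le>j. (- 1) ^ i * (e i * h (j - i))) = (if j = 0 then 1 else 0)"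
  using pieri_e_aux[of "[]" j] by simp

text \<open>The Bernstein formula with \<open>h_i^\<bottom> s_\<nu>\<close> written as the sum of
  \<open>schur rho\<close> over horizontal strips of size \<open>i\<close> removed from
  \<open>nu\<close>. Since \<open>mu\<close> has \<open>length mu\<close> cells more than
  \<open>nu\<close>, the index of \<open>e\<close> is \<open>length mu + i\<close>.\<close>

lemma schur_remove_first_column:
  assumes mu: "is_partition mu"
  defines "nu \<equiv> remove_first_column mu"
  shows "schur mu = (\<Sum>rho\<in>hstrips_under nu.
    mps_scale ((- 1) ^ (sum_list nu + sum_list rho)) (e (sum_list mu - sum_list rho) * schur rho))"
proof -
  define R where "R = hstrips_under nu"
  define U where "U = partitions_of (sum_list mu)"
  have fin: "finite R" "finite U" by (simp_all add: R_def U_def)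
  have le: "sum_list rho \<le> sum_list mu" if "rho \<in> R" for rho
    using that hstrip_size[of nu rho] sum_list_remove_first_column[OF mu] by (simp add: R_def nu_def)
  have "(\<Sum>rho\<in>R. mps_scale ((- 1) ^ (sum_list nu + sum_list rho)) (e (sum_list mu - sum_list rho) * schur rho)) =
      (\<Sum>rho\<in>R. \<Sum>sig | sig \<in> U \<and> vstrip sig rho. mps_scale ((- 1) ^ (sum_list nu + sum_list rho)) (schur sig))"
  proof (rule sum.cong[OF refl])
    fix rho assume rho: "rho \<in> R"
    have "vstrips_over rho (sum_list rho + (sum_list mu - sum_list rho)) =
        {sig. sig \<in> U \<and> vstrip sig rho}"
      using le[OF rho] by (auto simp: U_def partitions_of_def)
    then show "mps_scale ((- 1) ^ (sum_list nu + sum_list rho)) (e (sum_list mu - sum_list rho) * schur rho) =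
        (\<Sum>sig | sig \<in> U \<and> vstrip sig rho. mps_scale ((- 1) ^ (sum_list nu + sum_list rho)) (schur sig))"
      using rho by (simp add: R_def pieri_e mps.scale_sum_right)
  qed
  also have "\<dots> = (\<Sum>sig\<in>U. \<Sum>rho | rho \<in> R \<and> vstrip sig rho. mps_scale ((- 1) ^ (sum_list nu + sum_list rho)) (schur sig))"
    by (rule sum.swap_restrict) (use fin in auto)
  also have "\<dots> = (\<Sum>sig\<in>U. if sig = mu then schur mu else 0)"
  proof (rule sum.cong[OF refl])
    fix sig assume "sig \<in> U"
    then have sig: "is_partition sig" "sum_list sig = sum_list mu" by (auto simp: U_def partitions_of_def)
    have X: "{rho. rho \<in> R \<and> vstrip sig rho} =
        {rho. is_partition rho \<and> vstrip sig rho \<and> hstrip nu rho}" (is "_ = ?X")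
      by (auto simp: R_def)
    have "(\<Sum>rho | rho \<in> R \<and> vstrip sig rho. mps_scale ((- 1) ^ (sum_list nu + sum_list rho)) (schur sig)) =
        mps_scale ((- 1) ^ sum_list nu * (\<Sum>rho\<in>?X. (- 1) ^ sum_list rho)) (schur sig)"
      unfolding X by (simp add: sum_distrib_left mps.scale_sum_left power_add)
    also have "\<dots> = (if sig = mu then schur mu else 0)"
      unfolding nu_def sum_vertical_horizontal_column[OF mu sig] by (simp flip: power_mult_distrib)
    finally show "(\<Sum>rho | rho \<in> R \<and> vstrip sig rho. mps_scale ((- 1) ^ (sum_list nu + sum_list rho)) (schur sig)) =
        (if sig = mu then schur mu else 0)" .
  qed
  also have "\<dots> = schur mu" using fin mu by (simp add: U_def partitions_of_def)
  finally show ?thesis by (simp add: R_def)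
qed

section \<open>The bases of Schur functions and of power sum products\<close>

lemma mps_scale_mult_left [simp]: "mps_scale c f * g = mps_scale c (f * g)"
  by (rule mps_eqI) (simp add: mps_coeff_mult sum_distrib_left case_prod_unfold mult.assoc)

lemma mps_scale_mult_right [simp]: "f * mps_scale c g = mps_scale c (f * (g :: 'a::comm_ring_1 mps))"
  by (metis mps_scale_mult_left mult.commute)

lemma mps_scale_minus_one: "mps_scale (- 1) f = - (f :: 'a::comm_ring_1 mps)"
  by (rule mps_eqI) simp

text \<open>In a vanishing combination choose an index of least rank among those that occur: at its
  monomial all other terms vanish.\<close>

lemma triangular_independent:
  fixes f :: "'i \<Rightarrow> rat mps" and rk :: "'i \<Rightarrow> nat"
  assumes diag: "\<And>i. i \<in> I \<Longrightarrow> mps_coeff (f i) (\<theta> i) \<noteq> 0"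
    and tri: "\<And>i j. i \<in> I \<Longrightarrow> j \<in> I \<Longrightarrow> i \<noteq> j \<Longrightarrow> mps_coeff (f j) (\<theta> i) \<noteq> 0 \<Longrightarrow> rk j < rk i"
  shows "inj_on f I" and "mps.independent (f ` I)"
proof -
  show inj: "inj_on f I"
  proof (rule inj_onI, rule ccontr)
    fix i j assume ij: "i \<in> I" "j \<in> I" "f i = f j" "i \<noteq> j"
    then have "rk j < rk i" using tri[of i j] diag[of i] by simp
    moreover have "rk i < rk j" using ij tri[of j i] diag[of j] by simp
    ultimately show False by simp
  qed
  show "mps.independent (f ` I)"
  proof
    assume "mps.dependent (f ` I)"
    then obtain t u where t: "finite t" "t \<subseteq> f ` I" "(\<Sum>v\<in>t. mps_scale (u v) v) = 0" "\<exists>v\<in>t. u v \<noteq> 0"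
      unfolding mps.dependent_explicit by auto
    define J where "J = {i\<in>I. f i \<in> t \<and> u (f i) \<noteq> 0}"
    have "f ` J \<subseteq> t" "inj_on f J" using inj by (auto simp: J_def inj_on_def)
    then have "finite J" using t(1) by (meson finite_imageD finite_subset)
    moreover have "J \<noteq> {}" using t(2,4) by (auto simp: J_def)
    ultimately obtain i where i: "i \<in> J" "\<And>j. j \<in> J \<Longrightarrow> rk i \<le> rk j"
      by (metis arg_min_least arg_min_if_finite(1))
    have iI: "i \<in> I" and it: "f i \<in> t" and ui: "u (f i) \<noteq> 0" using i(1) by (auto simp: J_def)
    have "0 = mps_coeff (\<Sum>v\<in>t. mps_scale (u v) v) (\<theta> i)" by (simp add: t(3))
    also have "\<dots> = (\<Sum>v\<in>t. u v * mps_coeff v (\<theta> i))" by simp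
    also have "\<dots> = (\<Sum>v\<in>{f i}. u v * mps_coeff v (\<theta> i))"
    proof (rule sum.mono_neutral_right)
      show "\<forall>v\<in>t - {f i}. u v * mps_coeff v (\<theta> i) = 0"
      proof
        fix v assume v: "v \<in> t - {f i}"
        then obtain j where j: "j \<in> I" "v = f j" "j \<noteq> i" using t(2) by auto
        show "u v * mps_coeff v (\<theta> i) = 0"
        proof (rule ccontr)
          assume nz: "u v * mps_coeff v (\<theta> i) \<noteq> 0"
          then have "rk j < rk i" using tri[OF iI j(1)] j by auto
          moreover have "j \<in> J" using nz v j by (auto simp: J_def)
          ultimately show False using i(2)[of j] by simp
        qed
      qed
    qed (use t(1) it in auto)
    finally show False using diag[OF iI] ui by simp
  qed
qed

definition partition_monomial :: "nat list \<Rightarrow> (nat \<Rightarrow>\<^sub>0 nat)" where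
  "partition_monomial lam = Abs_poly_mapping (part lam)"

lemma lookup_partition_monomial [simp]: "lookup (partition_monomial lam) = part lam"
proof -
  have "finite {i. part lam i \<noteq> 0}"
    by (rule finite_subset[of _ "{..<length lam}"]) (auto simp: part_def)
  then show ?thesis by (simp add: partition_monomial_def)
qed

lemma sum_entries_content:
  assumes "has_content lam T \<theta>"
  shows "(\<Sum>c\<in>cells lam. T c) = (\<Sum>v\<in>keys \<theta>. v * lookup \<theta> v)"
proof -
  have "T ` cells lam \<subseteq> keys \<theta>"
    using content_entry[OF assms] by (auto simp: in_keys_iff)
  then have "(\<Sum>c\<in>cells lam. T c) = (\<Sum>v\<in>keys \<theta>. \<Sum>c | c \<in> cells lam \<and> T c = v. T c)"
    by (intro sum.group[symmetric]) auto
  also have "\<dots> = (\<Sum>v\<in>keys \<theta>. v * lookup \<theta> v)"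
    using assms by (intro sum.cong) (auto simp: has_content_def)
  finally show ?thesis .
qed

lemma has_content_row_index: "has_content lam fst (partition_monomial lam)"
proof -
  have "{c \<in> cells lam. fst c = v} = Pair v ` {..<part lam v}" for v
    by (auto simp: cells_eq_part)
  then show ?thesis by (simp add: has_content_def card_image inj_on_def)
qed

lemma has_content_restrict [simp]: "has_content lam (restrict T (cells lam)) \<theta> \<longleftrightarrow> has_content lam T \<theta>"
proof -
  have "{c \<in> cells lam. restrict T (cells lam) c = v} = {c \<in> cells lam. T c = v}" for v by auto
  then show ?thesis by (simp add: has_content_def)
qed

lemma
  shows inj_on_schur: "inj_on schur (Collect is_partition)"
    and independent_schur: "mps.independent (schur ` Collect is_partition)"
proof -
  \<comment> \<open>Entries in row \<open>i\<close> are at least \<open>i\<close>, with equality everywhere only for content \<open>lam\<close>.\<close>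
  let ?rk = "\<lambda>lam. \<Sum>c\<in>cells lam. fst c"
  have diag: "mps_coeff (schur lam) (partition_monomial lam) \<noteq> 0" if "lam \<in> Collect is_partition" for lam
  proof -
    have "restrict fst (cells lam) \<in> semistandard_tableaux lam"
      by (auto simp: semistandard_tableaux_def)
    then have "kostka lam (partition_monomial lam) \<noteq> 0"
      using has_content_row_index[of lam] finite_tableaux_content[of lam "partition_monomial lam"]
      unfolding kostka_def by (subst card_0_eq) auto
    then show ?thesis by (simp add: mps_coeff_schur)
  qed
  have tri: "?rk sig < ?rk lam"
    if "lam \<in> Collect is_partition" "sig \<in> Collect is_partition" "lam \<noteq> sig"
      "mps_coeff (schur sig) (partition_monomial lam) \<noteq> 0" for lam sig
  proof -
    have "kostka sig (partition_monomial lam) \<noteq> 0" using that by (simp add: mps_coeff_schur)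
    then obtain T where TS: "T \<in> semistandard_tableaux sig" and TC: "has_content sig T (partition_monomial lam)"
      by (auto simp: kostka_def card_eq_0_iff)
    have ge: "i \<le> T (i, j)" if "(i, j) \<in> cells sig" for i j
      using that
    proof (induction i)
      case (Suc i)
      have "(i, j) \<in> cells sig"
        using Suc.prems part_antimono[of sig i "Suc i"] \<open>sig \<in> Collect is_partition\<close>
        by (simp add: cells_eq_part)
      then have "i \<le> T (i, j)" "T (i, j) < T (Suc i, j)"
        using Suc TS by (auto simp: semistandard_tableaux_def)
      then show ?case by simp
    qed simp
    \<comment> \<open>The sum of all entries depends only on the content, which is that of the
      tableau of shape \<open>lam\<close> filled with row indices.\<close>
    have rk: "?rk lam = (\<Sum>c\<in>cells sig. T c)"
      using sum_entries_content[OF TC] sum_entries_content[OF has_content_row_index] by simp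
    have "\<exists>c\<in>cells sig. fst c < T c"
    proof (rule ccontr)
      assume "\<not> ?thesis"
      then have eq: "T c = fst c" if "c \<in> cells sig" for c
        using ge[of "fst c" "snd c"] that by (metis le_antisym not_less prod.collapse)
      have "part lam v = part sig v" for v
      proof -
        have "part lam v = card {c \<in> cells sig. T c = v}" using TC by (simp add: has_content_def)
        also have "{c \<in> cells sig. T c = v} = {c \<in> cells sig. fst c = v}" using eq by auto
        also have "card \<dots> = part sig v" using has_content_row_index[of sig] by (simp add: has_content_def)
        finally show ?thesis .
      qed
      then show False using that partition_eqI by auto
    qed
    then have "?rk sig < (\<Sum>c\<in>cells sig. T c)"
      using ge by (intro sum_strict_mono_ex1) auto
    then show ?thesis using rk by simp
  qed
  show "inj_on schur (Collect is_partition)" "mps.independent (schur ` Collect is_partition)"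
    using triangular_independent[of "Collect is_partition" schur partition_monomial ?rk] diag tri by blast+
qed

lemma mps_coeff_power_sum_mult:
  assumes "0 < k"
  shows "mps_coeff (power_sum k * f) \<theta> =
    (\<Sum>v | k \<le> lookup \<theta> v. mps_coeff f (\<theta> - single v k))"
proof -
  let ?s = "\<lambda>v. single v k"
  let ?V = "{v. k \<le> lookup \<theta> v}"
  have inj: "inj ?s"
    by (rule injI) (metis assms lookup_single_eq lookup_single_not_eq less_irrefl)
  have the: "(THE w. ?s v = ?s w) = v" for v
    by (rule the_equality) (use inj in \<open>auto dest: injD\<close>)
  have split: "?s v + (\<theta> - ?s v) = \<theta>" if "k \<le> lookup \<theta> v" for v
    by (rule poly_mapping_eqI) (use that in \<open>auto simp: lookup_add lookup_minus lookup_single when_def\<close>)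
  have "mps_coeff (power_sum k * f) \<theta> =
      (\<Sum>p\<in>mono_splits \<theta>. if \<exists>v. fst p = ?s v then mps_coeff f (snd p) else 0)"
    by (simp add: mps_coeff_mult power_sum_def case_prod_unfold if_distrib[of "\<lambda>x. x * _"] cong: if_cong)
  also have "\<dots> = (\<Sum>p | p \<in> mono_splits \<theta> \<and> (\<exists>v. fst p = ?s v). mps_coeff f (snd p))"
    by (rule sum.inter_filter[symmetric]) simp
  also have "\<dots> = (\<Sum>v\<in>?V. mps_coeff f (\<theta> - ?s v))"
  proof (rule sum.reindex_bij_witness[where j = "\<lambda>p. THE v. fst p = ?s v" and i = "\<lambda>v. (?s v, \<theta> - ?s v)"])
    fix p assume p: "p \<in> {p \<in> mono_splits \<theta>. \<exists>v. fst p = ?s v}"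
    then obtain v b where v: "p = (?s v, b)" "?s v + b = \<theta>" by (cases p) (auto simp: mono_splits_def)
    have the: "(THE w. fst p = ?s w) = v"
      using the[of v] by (simp add: v(1))
    have b: "b = \<theta> - ?s v" using v(2) by (metis add_diff_cancel_left')
    show "(?s (THE v. fst p = ?s v), \<theta> - ?s (THE v. fst p = ?s v)) = p"
      by (simp only: the) (simp add: v b)
    show "mps_coeff f (\<theta> - ?s (THE v. fst p = ?s v)) = mps_coeff f (snd p)"
      by (simp only: the) (simp add: v b)
    show "(THE v. fst p = ?s v) \<in> ?V"
      by (simp only: the) (use v(2) in \<open>auto simp: lookup_add\<close>)
  next
    fix v assume "v \<in> ?V"
    then have "?s v + (\<theta> - ?s v) = \<theta>" using split by blast
    then show "(?s v, \<theta> - ?s v) \<in> {p \<in> mono_splits \<theta>. \<exists>v. fst p = ?s v}"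
      by (auto simp: mono_splits_def)
    show "(THE w. fst (?s v, \<theta> - ?s v) = ?s w) = v"
      using the[of v] by simp
  qed
  finally show ?thesis .
qed

lemma finite_lookup_ge: "0 < k \<Longrightarrow> finite {v. k \<le> lookup \<theta> v}"
  for \<theta> :: "nat \<Rightarrow>\<^sub>0 nat"
  by (rule finite_subset[of _ "keys \<theta>"]) (auto simp: in_keys_iff)

lemma mono_degree_diff_single:
  assumes "k \<le> lookup \<theta> v"
  shows "mono_degree (\<theta> - single v k) + k = mono_degree \<theta>"
proof -
  have "\<theta> = (\<theta> - single v k) + single v k"
    by (rule poly_mapping_eqI) (use assms in \<open>auto simp: lookup_add lookup_minus lookup_single when_def\<close>)
  then show ?thesis by (metis mono_degree_add mono_degree_single)
qed

text \<open>On the right, a monomial of degree \<open>r\<close> arises once for each variable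
  \<open>v\<close> and each \<open>i\<close> from 1 to its exponent at \<open>v\<close>, hence
  \<open>r\<close> times.\<close>

lemma newton_h: "mps_scale (of_nat r) (h r) = (\<Sum>i=1..r. power_sum i * h (r - i))"
proof (rule mps_eqI)
  fix \<theta>
  have c: "mps_coeff (h s) \<eta> = (if mono_degree \<eta> = s then 1 else 0)" for s \<eta>
    by (simp add: mps_coeff_schur kostka_one_row)
  have "mps_coeff (\<Sum>i=1..r. power_sum i * h (r - i)) \<theta> =
      (\<Sum>i=1..r. \<Sum>v | i \<le> lookup \<theta> v. if mono_degree \<theta> = r then 1 else 0)"
  proof -
    have "mps_coeff (power_sum i * h (r - i)) \<theta> =
        (\<Sum>v | i \<le> lookup \<theta> v. if mono_degree \<theta> = r then 1 else 0)" if "i \<in> {1..r}" for i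
    proof -
      have "mps_coeff (h (r - i)) (\<theta> - single v i) = (if mono_degree \<theta> = r then 1 else 0)"
        if "i \<le> lookup \<theta> v" for v
        using mono_degree_diff_single[OF that] \<open>i \<in> {1..r}\<close> by (auto simp: c)
      then show ?thesis using that by (simp add: mps_coeff_power_sum_mult)
    qed
    then show ?thesis by simp
  qed
  also have "\<dots> = of_nat r * (if mono_degree \<theta> = r then 1 else 0)"
  proof (cases "mono_degree \<theta> = r")
    case True
    have "(\<Sum>i=1..r. card {v. i \<le> lookup \<theta> v}) =
        (\<Sum>i\<in>{1..r}. \<Sum>v | v \<in> keys \<theta> \<and> i \<le> lookup \<theta> v. 1)"
      by (auto intro!: sum.cong arg_cong[of _ _ card] simp: in_keys_iff)
    also have "\<dots> = (\<Sum>v\<in>keys \<theta>. \<Sum>i | i \<in> {1..r} \<and> i \<le> lookup \<theta> v. 1)"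
      by (rule sum.swap_restrict) auto
    also have "\<dots> = (\<Sum>v\<in>keys \<theta>. lookup \<theta> v)"
    proof (rule sum.cong[OF refl])
      fix v assume "v \<in> keys \<theta>"
      then have "lookup \<theta> v \<le> r"
        unfolding True[symmetric] mono_degree_def by (intro member_le_sum) auto
      then have "{i. i \<in> {1..r} \<and> i \<le> lookup \<theta> v} = {1..lookup \<theta> v}" by auto
      then show "(\<Sum>i | i \<in> {1..r} \<and> i \<le> lookup \<theta> v. 1) = lookup \<theta> v" by simp
    qed
    also have "\<dots> = r" using True by (simp add: mono_degree_def)
    finally have "(\<Sum>i=1..r. card {v. i \<le> lookup \<theta> v}) = r" .
    then have "(\<Sum>i=1..r. of_nat (card {v. i \<le> lookup \<theta> v})) = (of_nat r :: rat)"
      by (metis of_nat_sum)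
    then show ?thesis using True by simp
  qed simp
  finally show "mps_coeff (mps_scale (of_nat r) (h r)) \<theta> = mps_coeff (\<Sum>i=1..r. power_sum i * h (r - i)) \<theta>"
    by (simp add: c)
qed

section \<open>Independence of the products of power sums\<close>

definition exponents :: "(nat \<Rightarrow>\<^sub>0 nat) \<Rightarrow> nat multiset" where
  "exponents \<theta> = image_mset (lookup \<theta>) (mset_set (keys \<theta>))"

text \<open>Merging two positive parts into one exponent strictly increases this number. It serves
  as the rank for the triangularity of \<open>power_sum_prod\<close>.\<close>

definition sum_squares :: "(nat \<Rightarrow>\<^sub>0 nat) \<Rightarrow> nat" where
  "sum_squares \<theta> = (\<Sum>v\<in>keys \<theta>. lookup \<theta> v ^ 2)"

lemma sum_squares_exponents: "sum_squares \<theta> = (\<Sum>x\<in>#exponents \<theta>. x ^ 2)"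
  by (simp add: sum_squares_def exponents_def sum_unfold_sum_mset multiset.map_comp comp_def)

lemma sum_squares_diff_single:
  assumes "0 < k" "k \<le> lookup \<theta> v"
  shows "sum_squares (\<theta> - single v k) + k ^ 2 \<le> sum_squares \<theta>"
    and "sum_squares (\<theta> - single v k) + k ^ 2 = sum_squares \<theta> \<Longrightarrow>
      lookup \<theta> v = k"
proof -
  let ?l = "lookup \<theta>" and ?K = "keys \<theta>"
  have v: "v \<in> ?K" using assms by (auto simp: in_keys_iff)
  have "sum_squares (\<theta> - single v k) =
      (\<Sum>w\<in>?K. lookup (\<theta> - single v k) w ^ 2)"
    unfolding sum_squares_def
    by (rule sum.mono_neutral_left) (auto simp: in_keys_iff lookup_minus)
  also have "\<dots> = (?l v - k) ^ 2 + (\<Sum>w\<in>?K - {v}. ?l w ^ 2)"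
    by (subst sum.remove[OF _ v]) (auto simp: lookup_minus lookup_single when_def intro!: sum.cong)
  finally have 1: "sum_squares (\<theta> - single v k) = (?l v - k) ^ 2 + (\<Sum>w\<in>?K - {v}. ?l w ^ 2)" .
  have 2: "sum_squares \<theta> = ?l v ^ 2 + (\<Sum>w\<in>?K - {v}. ?l w ^ 2)"
    unfolding sum_squares_def by (rule sum.remove[OF _ v]) simp
  obtain d where d: "?l v = k + d" using assms(2) by (metis le_iff_add)
  have 3: "?l v ^ 2 = (?l v - k) ^ 2 + k ^ 2 + 2 * k * d"
    by (simp add: d power2_eq_square algebra_simps)
  show "sum_squares (\<theta> - single v k) + k ^ 2 \<le> sum_squares \<theta>"
    using 1 2 3 by simp
  show "?l v = k" if "sum_squares (\<theta> - single v k) + k ^ 2 = sum_squares \<theta>"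
    using 1 2 3 that assms(1) d by simp
qed

lemma exponents_diff_single:
  assumes "0 < k" "lookup \<theta> v = k"
  shows "exponents \<theta> = add_mset k (exponents (\<theta> - single v k))"
proof -
  let ?\<eta> = "\<theta> - single v k"
  have v: "v \<in> keys \<theta>" using assms by (auto simp: in_keys_iff)
  have l: "lookup ?\<eta> w = (if w = v then 0 else lookup \<theta> w)" for w
    using assms(2) by (auto simp: lookup_minus lookup_single when_def)
  have K: "keys ?\<eta> = keys \<theta> - {v}"
    by (auto simp: in_keys_iff l split: if_splits)
  have "mset_set (keys \<theta>) = add_mset v (mset_set (keys ?\<eta>))"
    unfolding K using v by (simp add: mset_set.remove)
  moreover have "image_mset (lookup \<theta>) (mset_set (keys ?\<eta>)) =
      image_mset (lookup ?\<eta>) (mset_set (keys ?\<eta>))"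
    by (rule image_mset_cong) (auto simp: l K)
  ultimately show ?thesis using assms(2) by (simp add: exponents_def)
qed

lemma power_sum_prod_Cons: "power_sum_prod (k # \<rho>) = power_sum k * power_sum_prod \<rho>"
  by (simp add: power_sum_prod_def)

text \<open>A monomial of the product comes from placing each part on some variable. Parts that
  share a variable raise the sum of squares, so equality means that no two do.\<close>

lemma power_sum_prod_nonzero_coeff:
  assumes "0 \<notin> set \<rho>" "mps_coeff (power_sum_prod \<rho>) \<theta> \<noteq> 0"
  shows "(\<Sum>x\<in>#mset \<rho>. x ^ 2) \<le> sum_squares \<theta> \<and>
    ((\<Sum>x\<in>#mset \<rho>. x ^ 2) = sum_squares \<theta> \<longrightarrow> exponents \<theta> = mset \<rho>)"
  using assms
proof (induction \<rho> arbitrary: \<theta>)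
  case Nil
  then have "\<theta> = 0" by (simp add: power_sum_prod_def split: if_splits)
  then show ?case by (simp add: sum_squares_def exponents_def)
next
  case (Cons k \<rho>)
  have k: "0 < k" using Cons.prems by auto
  have "(\<Sum>v | k \<le> lookup \<theta> v. mps_coeff (power_sum_prod \<rho>) (\<theta> - single v k)) \<noteq> 0"
    using Cons.prems by (simp add: power_sum_prod_Cons mps_coeff_power_sum_mult[OF k])
  then obtain v where v: "k \<le> lookup \<theta> v"
    "mps_coeff (power_sum_prod \<rho>) (\<theta> - single v k) \<noteq> 0"
    by (metis (mono_tags, lifting) mem_Collect_eq sum.not_neutral_contains_not_neutral)
  note IH = Cons.IH[OF _ v(2)]
  note sq = sum_squares_diff_single[OF k v(1)]
  show ?case
  proof (intro conjI impI)
    show "(\<Sum>x\<in>#mset (k # \<rho>). x\<^sup>2) \<le> sum_squares \<theta>"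
      using IH sq(1) Cons.prems by simp
    assume eq: "(\<Sum>x\<in>#mset (k # \<rho>). x\<^sup>2) = sum_squares \<theta>"
    have "sum_squares (\<theta> - single v k) + k ^ 2 = sum_squares \<theta>"
      "(\<Sum>x\<in>#mset \<rho>. x\<^sup>2) = sum_squares (\<theta> - single v k)"
      using IH sq(1) eq Cons.prems by auto
    then show "exponents \<theta> = mset (k # \<rho>)"
      using IH Cons.prems exponents_diff_single[OF k sq(2)] by simp
  qed
qed

lemma power_sum_prod_coeff_nonneg:
  assumes "0 \<notin> set \<rho>"
  shows "0 \<le> mps_coeff (power_sum_prod \<rho>) \<theta>"
  using assms
proof (induction \<rho> arbitrary: \<theta>)
  case Nil
  then show ?case by (simp add: power_sum_prod_def)
next
  case (Cons k \<rho>)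
  then have k: "0 < k" by auto
  then show ?case using Cons by (auto simp: power_sum_prod_Cons mps_coeff_power_sum_mult[OF k] intro!: sum_nonneg)
qed

text \<open>A single placement of the parts is enough, because nonnegative coefficients cannot
  cancel.\<close>

lemma power_sum_prod_coeff_pos:
  assumes "0 \<notin> set \<rho>" "exponents \<theta> = mset \<rho>"
  shows "0 < mps_coeff (power_sum_prod \<rho>) \<theta>"
  using assms
proof (induction \<rho> arbitrary: \<theta>)
  case Nil
  then have "keys \<theta> = {}" by (simp add: exponents_def mset_set_empty_iff)
  then show ?case by (simp add: power_sum_prod_def)
next
  case (Cons k \<rho>)
  then have k: "0 < k" and nz: "0 \<notin> set \<rho>" by auto
  have "k \<in># exponents \<theta>" by (simp add: Cons.prems)
  then obtain v where v: "lookup \<theta> v = k" by (auto simp: exponents_def)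
  have "exponents (\<theta> - single v k) = mset \<rho>"
    using exponents_diff_single[OF k v] Cons.prems by simp
  then have "0 < mps_coeff (power_sum_prod \<rho>) (\<theta> - single v k)"
    using Cons.IH nz by blast
  then show ?case
    unfolding power_sum_prod_Cons mps_coeff_power_sum_mult[OF k]
    by (intro sum_pos2[OF finite_lookup_ge[OF k], of v]) (use v nz power_sum_prod_coeff_nonneg in auto)
qed

lemma exponents_partition_monomial:
  assumes "is_partition lam"
  shows "exponents (partition_monomial lam) = mset lam"
proof -
  have "keys (partition_monomial lam) = {0..<length lam}"
  proof (rule set_eqI)
    show "i \<in> keys (partition_monomial lam) \<longleftrightarrow> i \<in> {0..<length lam}" for i
      using part_pos_iff[OF assms, of i] by (simp add: in_keys_iff)
  qed
  then have "exponents (partition_monomial lam) = image_mset (part lam) (mset [0..<length lam])"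
    by (simp add: exponents_def)
  also have "\<dots> = mset (map (part lam) [0..<length lam])" by (rule mset_map[symmetric])
  also have "map (part lam) [0..<length lam] = lam"
    by (rule nth_equalityI) (auto simp: part_def)
  finally show ?thesis .
qed

lemma partition_eq_mset:
  assumes "is_partition lam" "is_partition mu" "mset lam = mset mu"
  shows "lam = mu"
proof -
  have "sorted (rev lam)" "sorted (rev mu)"
    using assms(1,2) by (simp_all add: is_partition_def sorted_wrt_rev)
  then have "rev lam = rev mu" using assms(3) by (metis mset_rev properties_for_sort)
  then show ?thesis by simp
qed

lemma
  shows inj_on_power_sum_prod: "inj_on power_sum_prod (Collect is_partition)"
    and independent_power_sum_prod: "mps.independent (power_sum_prod ` Collect is_partition)"
proof -
  let ?rk = "\<lambda>lam. sum_squares (partition_monomial lam)"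
  have diag: "mps_coeff (power_sum_prod lam) (partition_monomial lam) \<noteq> 0" if "lam \<in> Collect is_partition" for lam
    using power_sum_prod_coeff_pos[of lam "partition_monomial lam"] that exponents_partition_monomial[of lam]
    by (simp add: is_partition_def)
  have tri: "?rk sig < ?rk lam"
    if "lam \<in> Collect is_partition" "sig \<in> Collect is_partition" "lam \<noteq> sig"
      "mps_coeff (power_sum_prod sig) (partition_monomial lam) \<noteq> 0" for lam sig
  proof -
    have nz: "0 \<notin> set sig" using that by (simp add: is_partition_def)
    have "?rk sig = (\<Sum>x\<in>#mset sig. x ^ 2)"
      using that by (simp add: sum_squares_exponents exponents_partition_monomial)
    moreover have "exponents (partition_monomial lam) \<noteq> mset sig"
      using that partition_eq_mset by (auto simp: exponents_partition_monomial)
    ultimately show ?thesis using power_sum_prod_nonzero_coeff[OF nz that(4)] by auto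
  qed
  show "inj_on power_sum_prod (Collect is_partition)" "mps.independent (power_sum_prod ` Collect is_partition)"
    using triangular_independent[of "Collect is_partition" power_sum_prod partition_monomial ?rk] diag tri
    by blast+
qed

section \<open>The algebra of symmetric functions and its generators\<close>

definition Sym :: "rat mps set" where
  "Sym = mps.span (schur ` Collect is_partition)"

text \<open>The algebra generated by \<open>a 1\<close>, \<open>a 2\<close>, and so on. Products are
  formed with one generator at a time, so that inductions meet only this case;
  \<open>generated_mult\<close> supplies general products.\<close>

inductive generated :: "(nat \<Rightarrow> rat mps) \<Rightarrow> rat mps \<Rightarrow> bool" for a where
  one: "generated a 1"
| mult: "generated a f \<Longrightarrow> 0 < k \<Longrightarrow> generated a (a k * f)"
| add: "generated a f \<Longrightarrow> generated a g \<Longrightarrow> generated a (f + g)"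
| scale: "generated a f \<Longrightarrow> generated a (mps_scale c f)"

lemma generated_0: "generated a 0"
  using generated.scale[OF generated.one, of a 0] by simp

lemma generated_sum: "(\<And>x. x \<in> A \<Longrightarrow> generated a (f x)) \<Longrightarrow> generated a (\<Sum>x\<in>A. f x)"
  by (induction A rule: infinite_finite_induct) (auto intro: generated_0 generated.add)

lemma generated_mult: "generated a f \<Longrightarrow> generated a g \<Longrightarrow> generated a (f * g)"
  by (induction rule: generated.induct)
    (auto simp: mult.assoc distrib_right intro: generated.intros)

lemma minus_one_power_mult: "(- 1) ^ n * f = mps_scale ((- 1) ^ n) (f :: 'a::comm_ring_1 mps)"
  by (cases "even n") (auto intro: mps_eqI)

text \<open>The relation between \<open>e\<close> and \<open>h\<close> is solved for its last term,
  which expresses \<open>e j\<close> by earlier \<open>e i\<close> and the \<open>h\<close>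
  functions.\<close>

lemma generated_h_e: "generated h (e j)"
proof (induction j rule: less_induct)
  case (less j)
  show ?case
  proof (cases "j = 0")
    case False
    have "(\<Sum>i<j. (- 1) ^ i * (e i * h (j - i))) + (- 1) ^ j * e j = 0"
      using sum_e_h[of j] False by (simp flip: lessThan_Suc_atMost)
    then have "(- 1) ^ j * e j = - (\<Sum>i<j. (- 1) ^ i * (e i * h (j - i)))"
      by (simp only: eq_neg_iff_add_eq_0 add.commute)
    then have "(- 1) ^ j * ((- 1) ^ j * e j) = (- 1) ^ j * - (\<Sum>i<j. (- 1) ^ i * (e i * h (j - i)))"
      by (simp only:)
    then have "e j = (- 1) ^ j * - (\<Sum>i<j. (- 1) ^ i * (e i * h (j - i)))"
      by (simp flip: mult.assoc power_mult_distrib)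
    also have "\<dots> = mps_scale ((- 1) ^ j) (mps_scale (- 1) (\<Sum>i<j. mps_scale ((- 1) ^ i) (h (j - i) * e i)))"
      by (simp add: minus_one_power_mult mps_scale_minus_one mult.commute)
    finally have eq: "e j = \<dots>" .
    show ?thesis
      by (subst eq) (intro generated.scale generated_sum generated.mult less.IH; simp)
  qed (simp add: generated.one)
qed

text \<open>\<open>schur_remove_first_column\<close> writes \<open>schur mu\<close> through the
  functions \<open>e\<close> and Schur functions of partitions that are smaller by at least the
  first column.\<close>

lemma generated_h_schur: "is_partition mu \<Longrightarrow> generated h (schur mu)"
proof (induction "sum_list mu" arbitrary: mu rule: less_induct)
  case less
  show ?case
  proof (cases "mu = []")
    case False
    have lt: "sum_list (remove_first_column mu) < sum_list mu"
      using sum_list_remove_first_column[OF less.prems] False by (cases mu) auto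
    show ?thesis
      unfolding schur_remove_first_column[OF less.prems]
    proof (intro generated_sum generated.scale generated_mult generated_h_e)
      fix rho assume "rho \<in> hstrips_under (remove_first_column mu)"
      then show "generated h (schur rho)"
        using lt hstrip_size[of "remove_first_column mu" rho] by (intro less.hyps) auto
    qed
  qed (simp add: generated.one)
qed

lemma Sym_schur [simp, intro]: "is_partition lam \<Longrightarrow> schur lam \<in> Sym"
  unfolding Sym_def by (intro mps.span_base) auto

lemma Sym_0 [simp, intro]: "0 \<in> Sym"
  and Sym_add [simp, intro]: "f \<in> Sym \<Longrightarrow> g \<in> Sym \<Longrightarrow> f + g \<in> Sym"
  and Sym_scale [simp, intro]: "f \<in> Sym \<Longrightarrow> mps_scale c f \<in> Sym"
  and Sym_diff [simp, intro]: "f \<in> Sym \<Longrightarrow> g \<in> Sym \<Longrightarrow> f - g \<in> Sym"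
  and Sym_sum [simp, intro]: "(\<And>x. x \<in> A \<Longrightarrow> F x \<in> Sym) \<Longrightarrow> (\<Sum>x\<in>A. F x) \<in> Sym"
  unfolding Sym_def
  by (simp_all add: mps.span_zero mps.span_add mps.span_scale mps.span_diff mps.span_sum)

lemma Sym_1 [simp, intro]: "1 \<in> Sym"
  using Sym_schur[of "[]"] by simp

lemma Sym_induct [consumes 1, case_names zero add]:
  assumes "f \<in> Sym" "P 0"
    and "\<And>c lam g. is_partition lam \<Longrightarrow> g \<in> Sym \<Longrightarrow> P g \<Longrightarrow> P (mps_scale c (schur lam) + g)"
  shows "P f"
proof -
  have "f \<in> Sym \<and> P f"
    using assms(1) unfolding Sym_def
  proof (induction rule: mps.span_induct_alt)
    case base
    then show ?case using assms(2) by (simp add: mps.span_zero)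
  next
    case (step c x y)
    then show ?case
      using assms(3) by (auto simp: Sym_def[symmetric])
  qed
  then show ?thesis ..
qed

lemma Sym_h_mult: "f \<in> Sym \<Longrightarrow> h r * f \<in> Sym"
  by (induction rule: Sym_induct) (auto simp: distrib_left pieri_h)

text \<open>This is how \<open>Sym\<close>, defined as a span, is seen to be closed under products.
  The Pieri rule gives stability under each \<open>h r\<close>, the Bernstein recursion the
  converse.\<close>

lemma Sym_iff_generated_h: "f \<in> Sym \<longleftrightarrow> generated h f"
proof
  assume "f \<in> Sym"
  then show "generated h f"
    by (induction rule: Sym_induct)
      (auto intro: generated_0 generated.add generated.scale generated_h_schur)
next
  assume "generated h f"
  then show "f \<in> Sym"
    by (induction rule: generated.induct) (auto intro: Sym_h_mult)
qed

lemma Sym_mult [simp, intro]: "f \<in> Sym \<Longrightarrow> g \<in> Sym \<Longrightarrow> f * g \<in> Sym"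
  unfolding Sym_iff_generated_h by (rule generated_mult)

lemma generated_Sym_induct [consumes 2, case_names one mult add scale]:
  assumes "\<And>f. f \<in> Sym \<longleftrightarrow> generated a f" "f \<in> Sym"
    and "P 1" "\<And>f k. f \<in> Sym \<Longrightarrow> 0 < k \<Longrightarrow> P f \<Longrightarrow> P (a k * f)"
    and "\<And>f g. f \<in> Sym \<Longrightarrow> g \<in> Sym \<Longrightarrow> P f \<Longrightarrow> P g \<Longrightarrow> P (f + g)"
    and "\<And>f c. f \<in> Sym \<Longrightarrow> P f \<Longrightarrow> P (mps_scale c f)"
  shows "P f"
proof -
  have "generated a f" using assms(1,2) by simp
  then show ?thesis
    by (induction rule: generated.induct) (use assms in auto)
qed

lemmas Sym_h_induct = generated_Sym_induct[OF Sym_iff_generated_h, consumes 1, case_names one mult add scale]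

lemma newton_h_last:
  assumes "0 < r"
  shows "mps_scale (of_nat r) (h r) = power_sum r + (\<Sum>i=1..<r. power_sum i * h (r - i))"
proof -
  have "{1..r} = insert r {1..<r}" using assms by auto
  then show ?thesis by (simp add: newton_h)
qed

lemma Sym_power_sum [simp, intro]: "0 < k \<Longrightarrow> power_sum k \<in> Sym"
proof (induction k rule: less_induct)
  case (less k)
  have "power_sum k = mps_scale (of_nat k) (h k) - (\<Sum>i=1..<k. power_sum i * h (k - i))"
    using newton_h_last[OF less.prems] by simp
  also have "\<dots> \<in> Sym" using less by (intro Sym_diff Sym_scale Sym_sum Sym_mult) auto
  finally show ?case .
qed

text \<open>Newton's identity can be divided by \<open>r\<close> over the rationals, which recovers
  \<open>h r\<close> from power sums and earlier \<open>h\<close> functions.\<close>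

lemma generated_power_sum_h: "generated power_sum (h r)"
proof (induction r rule: less_induct)
  case (less r)
  show ?case
  proof (cases "r = 0")
    case False
    have "h r = mps_scale (inverse (of_nat r)) (mps_scale (of_nat r) (h r))"
      using False by (simp add: mps_eqI)
    also have "\<dots> = mps_scale (inverse (of_nat r)) (\<Sum>i=1..r. power_sum i * h (r - i))"
      by (simp only: newton_h)
    also have "generated power_sum \<dots>"
      using less by (intro generated.scale generated_sum generated.mult) auto
    finally show ?thesis .
  qed (simp add: generated.one)
qed

lemma Sym_iff_generated_power_sum: "f \<in> Sym \<longleftrightarrow> generated power_sum f"
proof
  assume "f \<in> Sym"
  then show "generated power_sum f"
    by (induction rule: Sym_h_induct)
      (auto intro: generated.intros generated_mult generated_power_sum_h)
next
  assume "generated power_sum f"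
  then show "f \<in> Sym"
    by (induction rule: generated.induct) auto
qed

lemmas Sym_p_induct =
  generated_Sym_induct[OF Sym_iff_generated_power_sum, consumes 1, case_names one mult add scale]

lemma power_sum_prod_insert:
  assumes "is_partition \<rho>" "0 < k"
  obtains \<sigma> where "is_partition \<sigma>" "power_sum k * power_sum_prod \<rho> = power_sum_prod \<sigma>"
    "mset \<sigma> = add_mset k (mset \<rho>)"
proof
  define \<sigma> where "\<sigma> = rev (sort (k # \<rho>))"
  show m: "mset \<sigma> = add_mset k (mset \<rho>)" by (simp add: \<sigma>_def)
  have "set \<sigma> = insert k (set \<rho>)" unfolding \<sigma>_def by (simp only: set_rev set_sort list.set)
  moreover have "sorted_wrt (\<ge>) \<sigma>"
    unfolding \<sigma>_def sorted_wrt_rev by (metis sorted_sort)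
  ultimately show "is_partition \<sigma>"
    using assms by (auto simp: is_partition_def)
  have "power_sum_prod \<tau> = prod_mset (image_mset power_sum (mset \<tau>))" for \<tau>
    by (simp add: power_sum_prod_def prod_mset_prod_list flip: mset_map)
  then show "power_sum k * power_sum_prod \<rho> = power_sum_prod \<sigma>"
    by (simp add: m)
qed

lemma Sym_eq_span_power_sum_prod: "Sym = mps.span (power_sum_prod ` Collect is_partition)" (is "_ = ?S")
proof
  have mult: "power_sum k * f \<in> ?S" if "f \<in> ?S" "0 < k" for f k
    using that(1)
  proof (induction rule: mps.span_induct_alt)
    case base
    then show ?case by (simp add: mps.span_zero)
  next
    case (step c x y)
    then obtain \<rho> where "is_partition \<rho>" "x = power_sum_prod \<rho>" by auto
    then have "power_sum k * x \<in> ?S"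
      using power_sum_prod_insert[OF _ that(2), of \<rho>] by (metis imageI mem_Collect_eq mps.span_base)
    then show ?case using step by (simp add: distrib_left mps.span_add mps.span_scale)
  qed
  show "Sym \<subseteq> ?S"
  proof
    fix f assume "f \<in> Sym"
    then show "f \<in> ?S"
    proof (induction rule: Sym_p_induct)
      case one
      have "power_sum_prod [] \<in> ?S" by (intro mps.span_base) simp
      then show ?case by (simp add: power_sum_prod_def)
    qed (auto intro: mult mps.span_add mps.span_scale)
  qed
  have prod: "power_sum_prod \<rho> \<in> Sym" if "0 \<notin> set \<rho>" for \<rho>
    using that by (induction \<rho>) (auto simp: power_sum_prod_def)
  show "?S \<subseteq> Sym"
    unfolding Sym_def
    by (rule mps.span_minimal) (use prod in \<open>auto simp: is_partition_def Sym_def mps.subspace_span\<close>)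
qed

section \<open>Linear maps and ring homomorphisms on symmetric functions\<close>

definition Sym_linear :: "(rat mps \<Rightarrow> rat mps) \<Rightarrow> bool" where
  "Sym_linear \<phi> \<longleftrightarrow> (\<forall>f\<in>Sym. \<forall>g\<in>Sym. \<phi> (f + g) = \<phi> f + \<phi> g) \<and>
     (\<forall>f\<in>Sym. \<forall>c. \<phi> (mps_scale c f) = mps_scale c (\<phi> f))"

text \<open>Like linearity, this is required on \<open>Sym\<close> only: maps built from
  \<open>representation\<close> take the value 0 off the span and are not additive on all
  series.\<close>

definition Sym_hom :: "(rat mps \<Rightarrow> rat mps) \<Rightarrow> bool" where
  "Sym_hom \<phi> \<longleftrightarrow> Sym_linear \<phi> \<and> \<phi> 1 = 1 \<and> (\<forall>f\<in>Sym. \<forall>g\<in>Sym. \<phi> (f * g) = \<phi> f * \<phi> g)"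

lemma
  assumes "Sym_linear \<phi>"
  shows Sym_linear_add: "f \<in> Sym \<Longrightarrow> g \<in> Sym \<Longrightarrow> \<phi> (f + g) = \<phi> f + \<phi> g"
    and Sym_linear_scale: "f \<in> Sym \<Longrightarrow> \<phi> (mps_scale c f) = mps_scale c (\<phi> f)"
    and Sym_linear_0: "\<phi> 0 = 0"
proof -
  show "\<phi> (f + g) = \<phi> f + \<phi> g" if "f \<in> Sym" "g \<in> Sym" for f g
    using that assms by (auto simp: Sym_linear_def)
  show "\<phi> (mps_scale c f) = mps_scale c (\<phi> f)" if "f \<in> Sym" for f c
    using that assms by (auto simp: Sym_linear_def)
  have "\<phi> (mps_scale 0 0) = mps_scale 0 (\<phi> 0)"
    using assms Sym_0 unfolding Sym_linear_def by blast
  then show "\<phi> 0 = 0" by simp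
qed

lemma Sym_linear_sum:
  assumes "Sym_linear \<phi>" "\<And>x. x \<in> A \<Longrightarrow> F x \<in> Sym"
  shows "\<phi> (\<Sum>x\<in>A. F x) = (\<Sum>x\<in>A. \<phi> (F x))"
  using assms(2)
  by (induction A rule: infinite_finite_induct) (auto simp: Sym_linear_add[OF assms(1)] Sym_linear_0[OF assms(1)])

lemma
  assumes "Sym_hom \<phi>"
  shows Sym_hom_linear: "Sym_linear \<phi>"
    and Sym_hom_1: "\<phi> 1 = 1"
    and Sym_hom_mult: "f \<in> Sym \<Longrightarrow> g \<in> Sym \<Longrightarrow> \<phi> (f * g) = \<phi> f * \<phi> g"
  using assms by (auto simp: Sym_hom_def)

lemma Sym_hom_eqI_p:
  assumes "Sym_hom \<phi>" "Sym_hom \<psi>" "\<And>k. 0 < k \<Longrightarrow> \<phi> (power_sum k) = \<psi> (power_sum k)" "f \<in> Sym"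
  shows "\<phi> f = \<psi> f"
  using assms(4)
proof (induction rule: Sym_p_induct)
  case one
  then show ?case using assms by (simp add: Sym_hom_1)
next
  case (mult f k)
  then show ?case using assms(1-3) by (simp add: Sym_hom_mult)
qed (use assms in \<open>auto simp: Sym_linear_add Sym_linear_scale dest!: Sym_hom_linear\<close>)

text \<open>As the \<open>h r\<close> generate \<open>Sym\<close>, multiplicativity is tested on
  products of one \<open>h r\<close> with one Schur function, and these are accessible by the Pieri
  rule.\<close>

lemma Sym_homI_h:
  assumes lin: "Sym_linear \<phi>" and one: "\<phi> 1 = 1"
    and h: "\<And>r lam. is_partition lam \<Longrightarrow> \<phi> (h r * schur lam) = k r * \<phi> (schur lam)"
  shows "Sym_hom \<phi>" and "\<phi> (h r) = k r"
proof -
  note lins = Sym_linear_add[OF lin] Sym_linear_scale[OF lin] Sym_linear_0[OF lin]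
  have hf: "\<phi> (h r * f) = k r * \<phi> f" if "f \<in> Sym" for r f
    using that by (induction rule: Sym_induct) (simp_all add: lins distrib_left h)
  show "\<phi> (h r) = k r" for r using hf[of 1 r] one by simp
  have "\<phi> (f * g) = \<phi> f * \<phi> g" if "f \<in> Sym" "g \<in> Sym" for f g
    using that(1) by (induction rule: Sym_h_induct)
      (simp_all add: that(2) one lins hf distrib_right mult.assoc)
  then show "Sym_hom \<phi>" using lin one by (simp add: Sym_hom_def)
qed

lemma Sym_homI_p:
  assumes lin: "Sym_linear \<phi>" and one: "\<phi> 1 = 1"
    and p: "\<And>r f. 0 < r \<Longrightarrow> f \<in> Sym \<Longrightarrow> \<phi> (power_sum r * f) = k r * \<phi> f"
  shows "Sym_hom \<phi>"
proof -
  note lins = Sym_linear_add[OF lin] Sym_linear_scale[OF lin] Sym_linear_0[OF lin]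
  have "\<phi> (f * g) = \<phi> f * \<phi> g" if "f \<in> Sym" "g \<in> Sym" for f g
    using that(1) by (induction rule: Sym_p_induct)
      (simp_all add: that(2) one lins p distrib_right mult.assoc)
  then show "Sym_hom \<phi>" using lin one by (simp add: Sym_hom_def)
qed

lemma Sym_linear_id: "Sym_linear (\<lambda>f. f)"
  by (simp add: Sym_linear_def)

lemma Sym_linear_comp:
  "Sym_linear \<phi> \<Longrightarrow> Sym_linear \<psi> \<Longrightarrow> (\<And>f. f \<in> Sym \<Longrightarrow> \<phi> f \<in> Sym) \<Longrightarrow> Sym_linear (\<lambda>f. \<psi> (\<phi> f))"
  by (simp add: Sym_linear_def)

lemma Sym_hom_comp:
  "Sym_hom \<phi> \<Longrightarrow> Sym_hom \<psi> \<Longrightarrow> (\<And>f. f \<in> Sym \<Longrightarrow> \<phi> f \<in> Sym) \<Longrightarrow> Sym_hom (\<lambda>f. \<psi> (\<phi> f))"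
  by (simp add: Sym_hom_def Sym_linear_comp)

section \<open>Homogeneity and coordinates in a basis\<close>

definition homogeneous :: "nat \<Rightarrow> rat mps \<Rightarrow> bool" where
  "homogeneous d f \<longleftrightarrow> (\<forall>\<theta>. mps_coeff f \<theta> \<noteq> 0 \<longrightarrow> mono_degree \<theta> = d)"

lemma homogeneous_schur: "homogeneous (sum_list lam) (schur lam)"
  using kostka_degree by (simp add: homogeneous_def mps_coeff_schur)

lemma homogeneous_1: "homogeneous 0 1"
  by (simp add: homogeneous_def)

lemma homogeneous_scale: "homogeneous d f \<Longrightarrow> homogeneous d (mps_scale c f)"
  by (simp add: homogeneous_def)

lemma homogeneous_sum: "(\<And>x. x \<in> A \<Longrightarrow> homogeneous d (F x)) \<Longrightarrow> homogeneous d (\<Sum>x\<in>A. F x)"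
  unfolding homogeneous_def mps_coeff_sum by (meson sum.neutral)

lemma homogeneous_mult:
  assumes "homogeneous d f" "homogeneous d' g"
  shows "homogeneous (d + d') (f * g)"
  unfolding homogeneous_def
proof (intro allI impI)
  fix \<theta> assume "mps_coeff (f * g) \<theta> \<noteq> 0"
  then obtain p where "p \<in> mono_splits \<theta>" "mps_coeff f (fst p) * mps_coeff g (snd p) \<noteq> 0"
    unfolding mps_coeff_mult case_prod_unfold by (meson sum.neutral)
  then show "mono_degree \<theta> = d + d'"
    using assms by (auto simp: homogeneous_def mono_splits_def mono_degree_add)
qed

lemma homogeneous_power_sum: "homogeneous k (power_sum k)"
  by (auto simp: homogeneous_def power_sum_def split: if_splits)

lemma homogeneous_power_sum_prod: "homogeneous (sum_list \<rho>) (power_sum_prod \<rho>)"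
  by (induction \<rho>)
    (simp_all add: power_sum_prod_Cons homogeneous_mult homogeneous_power_sum,
      simp add: power_sum_prod_def homogeneous_1)

text \<open>Projection to degree \<open>d\<close> fixes \<open>f\<close> and sends each basis vector
  to itself or to 0. So \<open>f\<close> lies in the span of the basis vectors of degree
  \<open>d\<close> alone.\<close>

lemma representation_homogeneous:
  assumes B: "mps.independent B" "\<And>b. b \<in> B \<Longrightarrow> homogeneous (deg b) b"
    and f: "f \<in> mps.span B" "homogeneous d f" and b: "mps.representation B f b \<noteq> 0"
  shows "deg b = d"
proof -
  define comp where "comp g = Abs_mps (\<lambda>\<theta>. if mono_degree \<theta> = d then mps_coeff g \<theta> else 0)" for g :: "rat mps"
  let ?r = "mps.representation B f"
  have "comp f = f" using f(2) by (intro mps_eqI) (auto simp: comp_def homogeneous_def)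
  have comp: "comp b = (if deg b = d then b else 0)" if "b \<in> B" for b
    using B(2)[OF that] by (intro mps_eqI) (auto simp: comp_def homogeneous_def)
  have "comp f = comp (\<Sum>b | ?r b \<noteq> 0. mps_scale (?r b) b)"
    by (rule arg_cong[OF mps.sum_nonzero_representation_eq[OF B(1) f(1), symmetric]])
  also have "\<dots> = (\<Sum>b | ?r b \<noteq> 0. mps_scale (?r b) (comp b))"
    by (rule mps_eqI) (simp add: comp_def)
  also have "\<dots> \<in> mps.span {b\<in>B. deg b = d}"
  proof (rule mps.span_sum)
    fix b assume "b \<in> {b. ?r b \<noteq> 0}"
    then have "b \<in> B" using mps.representation_ne_zero by blast
    then have "comp b \<in> mps.span {b\<in>B. deg b = d}"
      by (auto simp: comp intro: mps.span_zero mps.span_base)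
    then show "mps_scale (?r b) (comp b) \<in> mps.span {b\<in>B. deg b = d}"
      by (rule mps.span_scale)
  qed
  finally have "f \<in> mps.span {b\<in>B. deg b = d}" using \<open>comp f = f\<close> by simp
  then have "?r = mps.representation {b\<in>B. deg b = d} f"
    by (intro mps.representation_extend B(1)) auto
  then show ?thesis using b mps.representation_ne_zero[of "{b\<in>B. deg b = d}" f b] by auto
qed

text \<open>Instantiated below with Schur functions, for \<open>omega\<close> and the skewing
  operators, and with products of power sums, for plethysm.\<close>

locale partition_basis =
  fixes b :: "nat list \<Rightarrow> rat mps"
  assumes inj: "inj_on b (Collect is_partition)"
    and independent: "mps.independent (b ` Collect is_partition)"
    and span: "Sym = mps.span (b ` Collect is_partition)"
begin

definition coeff :: "rat mps \<Rightarrow> nat list \<Rightarrow> rat" where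
  "coeff f lam = mps.representation (b ` Collect is_partition) f (b lam)"

text \<open>Off \<open>Sym\<close> the coordinates default to 0, and so does the value. Hence
  \<open>extend F f\<close> lies in \<open>Sym\<close> for every \<open>f\<close>, provided the
  values of \<open>F\<close> on partitions do.\<close>

definition extend :: "(nat list \<Rightarrow> rat mps) \<Rightarrow> rat mps \<Rightarrow> rat mps" where
  "extend F f = (\<Sum>lam | is_partition lam \<and> coeff f lam \<noteq> 0. mps_scale (coeff f lam) (F lam))"

lemma finite_support [simp]: "finite {lam. is_partition lam \<and> coeff f lam \<noteq> 0}"
proof -
  have "finite {v. mps.representation (b ` Collect is_partition) f v \<noteq> 0}"
    by (rule mps.finite_representation)
  then have "finite (b -` {v. mps.representation (b ` Collect is_partition) f v \<noteq> 0} \<inter> Collect is_partition)"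
    by (rule finite_vimage_IntI) (rule inj)
  then show ?thesis
    by (rule rev_finite_subset) (auto simp: coeff_def)
qed

lemma coeff_basis:
  assumes "is_partition lam" "is_partition mu"
  shows "coeff (b lam) mu = (if lam = mu then 1 else 0)"
  unfolding coeff_def
  using mps.representation_basis[OF independent, of "b lam"] assms inj_onD[OF inj, of lam mu]
  by auto

lemma coeff_add: "f \<in> Sym \<Longrightarrow> g \<in> Sym \<Longrightarrow> coeff (f + g) mu = coeff f mu + coeff g mu"
  unfolding coeff_def span by (simp add: mps.representation_add[OF independent])

lemma coeff_scale: "f \<in> Sym \<Longrightarrow> coeff (mps_scale c f) mu = c * coeff f mu"
  unfolding coeff_def span by (simp add: mps.representation_scale[OF independent])

lemma coeff_0 [simp]: "coeff 0 mu = 0"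
  using coeff_scale[of 0 0 mu] by simp

lemma coeff_sum:
  "(\<And>x. x \<in> A \<Longrightarrow> F x \<in> Sym) \<Longrightarrow> coeff (\<Sum>x\<in>A. F x) mu = (\<Sum>x\<in>A. coeff (F x) mu)"
  by (induction A rule: infinite_finite_induct) (auto simp: coeff_add)

lemma Sym_basis: "is_partition lam \<Longrightarrow> b lam \<in> Sym"
  unfolding span by (intro mps.span_base) auto

lemma extend_eq:
  assumes "finite A" "A \<subseteq> Collect is_partition" "\<And>lam. is_partition lam \<Longrightarrow> coeff f lam \<noteq> 0 \<Longrightarrow> lam \<in> A"
  shows "extend F f = (\<Sum>lam\<in>A. mps_scale (coeff f lam) (F lam))"
  unfolding extend_def
  by (rule sum.mono_neutral_left) (use assms in auto)

lemma extend_basis: "is_partition lam \<Longrightarrow> extend F (b lam) = F lam"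
  by (subst extend_eq[of "{lam}"]) (auto simp: coeff_basis split: if_splits)

lemma extend_linear: "Sym_linear (extend F)"
  unfolding Sym_linear_def
proof safe
  fix f g assume fg: "f \<in> Sym" "g \<in> Sym"
  let ?A = "{lam. is_partition lam \<and> coeff f lam \<noteq> 0} \<union> {lam. is_partition lam \<and> coeff g lam \<noteq> 0}"
  have "extend F (f + g) = (\<Sum>lam\<in>?A. mps_scale (coeff (f + g) lam) (F lam))"
    by (rule extend_eq) (auto simp: coeff_add fg)
  moreover have "extend F f = (\<Sum>lam\<in>?A. mps_scale (coeff f lam) (F lam))"
    by (rule extend_eq) auto
  moreover have "extend F g = (\<Sum>lam\<in>?A. mps_scale (coeff g lam) (F lam))"
    by (rule extend_eq) auto
  ultimately show "extend F (f + g) = extend F f + extend F g"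
    by (simp add: coeff_add fg sum.distrib mps.scale_left_distrib)
next
  fix f c assume f: "f \<in> Sym"
  have "extend F (mps_scale c f) =
      (\<Sum>lam | is_partition lam \<and> coeff f lam \<noteq> 0. mps_scale (coeff (mps_scale c f) lam) (F lam))"
    by (rule extend_eq) (auto simp: coeff_scale f)
  then show "extend F (mps_scale c f) = mps_scale c (extend F f)"
    by (simp add: coeff_scale f extend_def mps.scale_sum_right)
qed

lemma Sym_extend: "(\<And>lam. is_partition lam \<Longrightarrow> F lam \<in> Sym) \<Longrightarrow> extend F f \<in> Sym"
  unfolding extend_def by (intro Sym_sum Sym_scale) auto

lemma linear_eqI:
  assumes "Sym_linear \<phi>" "Sym_linear \<psi>" "\<And>lam. is_partition lam \<Longrightarrow> \<phi> (b lam) = \<psi> (b lam)" "f \<in> Sym"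
  shows "\<phi> f = \<psi> f"
proof -
  have "f \<in> Sym \<and> \<phi> f = \<psi> f"
    using assms(4) unfolding span
  proof (induction rule: mps.span_induct_alt)
    case base
    then show ?case using assms(1,2) by (simp add: mps.span_zero Sym_linear_0)
  next
    case (step c x y)
    then show ?case
      using assms(1-3) Sym_basis
      by (auto simp: span[symmetric] Sym_linear_add Sym_linear_scale)
  qed
  then show ?thesis ..
qed

lemma expand:
  assumes "f \<in> Sym"
  shows "f = (\<Sum>lam | is_partition lam \<and> coeff f lam \<noteq> 0. mps_scale (coeff f lam) (b lam))"
proof -
  have "f = extend b f"
    by (rule linear_eqI[OF Sym_linear_id extend_linear[of b] _ assms]) (simp add: extend_basis)
  then show ?thesis by (simp add: extend_def)
qed

lemma coeff_homogeneous:
  assumes b: "\<And>lam. homogeneous (sum_list lam) (b lam)"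
    and f: "f \<in> Sym" "homogeneous d f" "is_partition mu" "coeff f mu \<noteq> 0"
  shows "sum_list mu = d"
proof -
  \<comment> \<open>The representation is indexed by basis vectors, so the degree of a vector is
    recovered through its partition.\<close>
  let ?deg = "\<lambda>x. sum_list (inv_into (Collect is_partition) b x)"
  have "?deg (b mu) = d"
  proof (rule representation_homogeneous[OF independent])
    fix x assume "x \<in> b ` Collect is_partition"
    then show "homogeneous (?deg x) x"
      by (auto simp: inv_into_f_f[OF inj] b)
  qed (use f in \<open>auto simp: span coeff_def\<close>)
  then show ?thesis using f(3) by (simp add: inv_into_f_f[OF inj])
qed

end

global_interpretation schur: partition_basis schur
  rewrites "partition_basis.coeff schur = schur_coeff"
proof -
  show *: "partition_basis schur"
    using inj_on_schur independent_schur by unfold_locales (simp_all add: Sym_def)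
  show "partition_basis.coeff schur = schur_coeff"
    by (simp add: fun_eq_iff partition_basis.coeff_def[OF *] schur_coeff_def)
qed

global_interpretation power_sum_prod: partition_basis power_sum_prod
  rewrites "partition_basis.coeff power_sum_prod = power_sum_coeff"
proof -
  show *: "partition_basis power_sum_prod"
    using inj_on_power_sum_prod independent_power_sum_prod Sym_eq_span_power_sum_prod
    by unfold_locales
  show "partition_basis.coeff power_sum_prod = power_sum_coeff"
    by (simp add: fun_eq_iff partition_basis.coeff_def[OF *] power_sum_coeff_def)
qed

section \<open>The conjugation involution and the skewing operators\<close>

lemma hstrip_conjugate:
  assumes "is_partition lam" "is_partition mu"
  shows "hstrip (conjugate lam) (conjugate mu) \<longleftrightarrow> vstrip lam mu"
  using vstrip_conjugate[of "conjugate lam" "conjugate mu"] assms by simp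

definition omega :: "rat mps \<Rightarrow> rat mps" where
  "omega = schur.extend (\<lambda>lam. schur (conjugate lam))"

lemma omega_schur [simp]: "is_partition lam \<Longrightarrow> omega (schur lam) = schur (conjugate lam)"
  by (simp add: omega_def schur.extend_basis)

lemma omega_linear: "Sym_linear omega"
  unfolding omega_def by (rule schur.extend_linear)

lemma Sym_omega [simp]: "omega f \<in> Sym"
  unfolding omega_def by (intro schur.Sym_extend) simp

text \<open>Conjugation exchanges horizontal and vertical strips, and thereby the Pieri rules for
  \<open>h r\<close> and \<open>e r\<close>.\<close>

lemma
  shows omega_hom: "Sym_hom omega" and omega_h: "omega (h r) = e r"
proof -
  have one: "omega 1 = 1"
    using omega_schur[of "[]"] by (simp add: conjugate_def)
  have mult: "omega (h r * schur lam) = e r * omega (schur lam)" if lam: "is_partition lam" for r lam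
  proof -
    have "omega (h r * schur lam) = (\<Sum>tau\<in>hstrips_over lam (sum_list lam + r). schur (conjugate tau))"
      unfolding pieri_h[OF lam] by (subst Sym_linear_sum[OF omega_linear]) (auto intro!: sum.cong)
    also have "\<dots> = (\<Sum>nu\<in>vstrips_over (conjugate lam) (sum_list (conjugate lam) + r). schur nu)"
      by (rule sum.reindex_bij_witness[where i = conjugate and j = conjugate])
        (use lam vstrip_conjugate[OF _ lam] hstrip_conjugate[of _ "conjugate lam"] in auto)
    also have "\<dots> = e r * omega (schur lam)"
      using lam by (simp add: pieri_e)
    finally show ?thesis .
  qed
  show "Sym_hom omega" "omega (h r) = e r"
    using Sym_homI_h[of omega e, OF omega_linear one mult] by blast+
qed

text \<open>
  \<open>skew_h\<close> and \<open>skew_e\<close> are the adjoints of multiplication by the infinite sums of all \<open>h\<^sub>r\<close> and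
  of all \<open>e\<^sub>r\<close>. Only these total operators are ring homomorphisms; the summand for a fixed \<open>r\<close>
  is recovered by comparing degrees.
\<close>

definition skew_h :: "rat mps \<Rightarrow> rat mps" where
  "skew_h = schur.extend (\<lambda>lam. \<Sum>mu\<in>hstrips_under lam. schur mu)"

definition skew_e :: "rat mps \<Rightarrow> rat mps" where
  "skew_e = schur.extend (\<lambda>lam. \<Sum>mu\<in>vstrips_under lam. schur mu)"

lemma Sym_skew_h [simp]: "skew_h f \<in> Sym"
  unfolding skew_h_def by (intro schur.Sym_extend) auto

lemma Sym_skew_e [simp]: "skew_e f \<in> Sym"
  unfolding skew_e_def by (intro schur.Sym_extend) auto

lemma skew_h_linear: "Sym_linear skew_h"
  unfolding skew_h_def by (rule schur.extend_linear)

lemma skew_e_linear: "Sym_linear skew_e"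
  unfolding skew_e_def by (rule schur.extend_linear)

lemma skew_h_schur:
  "is_partition lam \<Longrightarrow> skew_h (schur lam) = (\<Sum>mu\<in>hstrips_under lam. schur mu)"
  by (simp add: skew_h_def schur.extend_basis)

lemma skew_e_schur:
  "is_partition lam \<Longrightarrow> skew_e (schur lam) = (\<Sum>mu\<in>vstrips_under lam. schur mu)"
  by (simp add: skew_e_def schur.extend_basis)

text \<open>The strip exchange replaces going up from \<open>nu\<close> by \<open>s\<close> cells
  and then down to \<open>sig\<close> by going down from \<open>nu\<close> and then up by at most
  \<open>s\<close> cells. This bound turns the factor \<open>h s\<close> into the sum of all
  \<open>h i\<close> with \<open>i \<le> s\<close>.\<close>

lemma
  shows skew_h_hom: "Sym_hom skew_h" and skew_h_h: "skew_h (h r) = (\<Sum>i\<le>r. h i)"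
proof -
  have "mu = []" if "is_partition mu" "hstrip [] mu" for mu
    using that by (intro partition_eqI) (auto simp: hstrip_def)
  then have "hstrips_under [] = {[]}"
    by (auto simp: hstrip_def)
  then have one: "skew_h 1 = 1"
    using skew_h_schur[of "[]"] by simp
  have mult: "skew_h (h s * schur nu) = (\<Sum>i\<le>s. h i) * skew_h (schur nu)"
    if nu: "is_partition nu" for s nu
  proof -
    define U where "U = {sig. is_partition sig \<and> sum_list sig \<le> sum_list nu + s}"
    define T where "T = hstrips_under nu"
    define R where "R = hstrips_over nu (sum_list nu + s)"
    define Q where "Q sig tau \<longleftrightarrow> hstrip sig tau \<and> sum_list sig \<le> sum_list tau + s" for sig tau
    have fin: "finite U" "finite T" "finite R" by (simp_all add: U_def T_def R_def finite_partitions_bounded)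
    have "skew_h (h s * schur nu) = (\<Sum>rho\<in>R. skew_h (schur rho))"
      unfolding pieri_h[OF nu] R_def[symmetric]
      by (rule Sym_linear_sum[OF skew_h_linear]) (auto simp: R_def)
    also have "\<dots> = (\<Sum>rho\<in>R. \<Sum>sig | sig \<in> U \<and> hstrip rho sig. schur sig)"
    proof (rule sum.cong[OF refl])
      fix rho assume rho: "rho \<in> R"
      have "hstrips_under rho = {sig. sig \<in> U \<and> hstrip rho sig}"
        using rho hstrip_size[of rho] by (auto simp: R_def U_def)
      then show "skew_h (schur rho) = (\<Sum>sig | sig \<in> U \<and> hstrip rho sig. schur sig)"
        using rho by (simp add: R_def skew_h_schur)
    qed
    also have "\<dots> = (\<Sum>sig\<in>U. \<Sum>rho | rho \<in> R \<and> hstrip rho sig. schur sig)"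
      by (rule sum.swap_restrict[OF fin(3,1)])
    also have "\<dots> = (\<Sum>sig\<in>U. \<Sum>tau | tau \<in> T \<and> Q sig tau. schur sig)"
    proof (rule sum.cong[OF refl])
      fix sig assume "sig \<in> U"
      then have sig: "is_partition sig" by (simp add: U_def)
      have "card {rho. rho \<in> R \<and> hstrip rho sig} =
        card {rho. is_partition rho \<and> hstrip rho nu \<and> hstrip rho sig \<and> sum_list rho = sum_list nu + s}"
        by (rule arg_cong[of _ _ card]) (auto simp: R_def)
      also have "\<dots> = card {tau. is_partition tau \<and> hstrip nu tau \<and> hstrip sig tau \<and> sum_list sig \<le> sum_list tau + s}"
        by (rule card_strip_exchange[OF nu sig])
      also have "\<dots> = card {tau. tau \<in> T \<and> Q sig tau}"
        by (rule arg_cong[of _ _ card]) (auto simp: T_def Q_def)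
      finally show "(\<Sum>rho | rho \<in> R \<and> hstrip rho sig. schur sig) =
          (\<Sum>tau | tau \<in> T \<and> Q sig tau. schur sig)"
        by simp
    qed
    also have "\<dots> = (\<Sum>tau\<in>T. \<Sum>sig | sig \<in> U \<and> Q sig tau. schur sig)"
      by (rule sum.swap_restrict[OF fin(1,2)])
    also have "\<dots> = (\<Sum>tau\<in>T. \<Sum>i\<le>s. h i * schur tau)"
    proof (rule sum.cong[OF refl])
      fix tau assume tau: "tau \<in> T"
      let ?A = "\<lambda>i. hstrips_over tau (sum_list tau + i)"
      have "{sig. sig \<in> U \<and> Q sig tau} = (\<Union>i\<in>{..s}. ?A i)"
      proof (intro set_eqI iffI)
        fix sig assume sig: "sig \<in> {sig. sig \<in> U \<and> Q sig tau}"
        then have "sum_list tau \<le> sum_list sig" using hstrip_size by (auto simp: Q_def)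
        then have "sig \<in> ?A (sum_list sig - sum_list tau)" "sum_list sig - sum_list tau \<in> {..s}"
          using sig by (auto simp: U_def Q_def)
        then show "sig \<in> (\<Union>i\<in>{..s}. ?A i)" by blast
      next
        fix sig assume "sig \<in> (\<Union>i\<in>{..s}. ?A i)"
        then show "sig \<in> {sig. sig \<in> U \<and> Q sig tau}"
          using hstrip_size[of nu tau] tau by (auto simp: U_def T_def Q_def)
      qed
      also have "(\<Sum>sig\<in>(\<Union>i\<in>{..s}. ?A i). schur sig) = (\<Sum>i\<le>s. \<Sum>sig\<in>?A i. schur sig)"
        by (rule sum.UNION_disjoint) auto
      finally show "(\<Sum>sig | sig \<in> U \<and> Q sig tau. schur sig) =
          (\<Sum>i\<le>s. h i * schur tau)"
        using tau by (simp add: pieri_h T_def)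
    qed
    also have "\<dots> = (\<Sum>i\<le>s. h i) * skew_h (schur nu)"
      unfolding skew_h_schur[OF nu] T_def[symmetric] sum_product by (rule sum.swap)
    finally show ?thesis .
  qed
  show "Sym_hom skew_h" "skew_h (h r) = (\<Sum>i\<le>r. h i)"
    using Sym_homI_h[of skew_h "\<lambda>r. \<Sum>i\<le>r. h i", OF skew_h_linear one mult] by blast+
qed

text \<open>Conjugation on both sides turns horizontal strips into vertical ones; in this form
  \<open>skew_e\<close> inherits multiplicativity from \<open>skew_h\<close>.\<close>

lemma skew_e_eq:
  assumes "f \<in> Sym"
  shows "skew_e f = omega (skew_h (omega f))"
proof (rule schur.linear_eqI[OF skew_e_linear _ _ assms])
  show "Sym_linear (\<lambda>f. omega (skew_h (omega f)))"
    by (intro Sym_linear_comp[where \<phi> = omega and \<psi> = "\<lambda>f. omega (skew_h f)"]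
        Sym_linear_comp[OF skew_h_linear] omega_linear) auto
  fix lam :: "nat list" assume lam: "is_partition lam"
  have "omega (skew_h (omega (schur lam))) =
      (\<Sum>mu\<in>hstrips_under (conjugate lam). schur (conjugate mu))"
    using lam by (simp add: skew_h_schur) (subst Sym_linear_sum[OF omega_linear], auto intro!: sum.cong)
  also have "\<dots> = (\<Sum>mu\<in>vstrips_under lam. schur mu)"
    by (rule sum.reindex_bij_witness[where i = conjugate and j = conjugate])
      (use lam vstrip_conjugate[of "conjugate lam"] hstrip_conjugate[OF lam] in auto)
  finally show "skew_e (schur lam) = omega (skew_h (omega (schur lam)))"
    using lam by (simp add: skew_e_schur)
qed

lemma skew_e_hom: "Sym_hom skew_e"
proof -
  have "Sym_hom (\<lambda>f. omega (skew_h (omega f)))"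
    by (rule Sym_hom_comp[OF omega_hom Sym_hom_comp[OF skew_h_hom omega_hom]]) auto
  then show ?thesis
    using skew_e_eq unfolding Sym_hom_def Sym_linear_def by simp
qed

text \<open>Newton's identities between a sequence \<open>a\<close> in the role of the
  \<open>h r\<close> and a sequence \<open>q\<close> in the role of the power sums. Each determines
  the other (\<open>q\<close> at positive indices), and homomorphisms preserve the relation. So
  values on one family of generators can be transferred to the other.\<close>

definition newton :: "(nat \<Rightarrow> rat mps) \<Rightarrow> (nat \<Rightarrow> rat mps) \<Rightarrow> bool" where
  "newton a q \<longleftrightarrow> a 0 = 1 \<and> (\<forall>r. mps_scale (of_nat r) (a r) = (\<Sum>i=1..r. q i * a (r - i)))"

lemma newton_h_power_sum: "newton h power_sum"
  by (simp add: newton_def newton_h)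

lemma newton_hom:
  assumes \<phi>: "Sym_hom \<phi>" and "newton a q" and "\<And>r. a r \<in> Sym" "\<And>r. 0 < r \<Longrightarrow> q r \<in> Sym"
  shows "newton (\<lambda>r. \<phi> (a r)) (\<lambda>r. \<phi> (q r))"
proof -
  note lin = Sym_hom_linear[OF \<phi>]
  have "mps_scale (of_nat r) (\<phi> (a r)) = (\<Sum>i=1..r. \<phi> (q i) * \<phi> (a (r - i)))" for r
  proof -
    have "mps_scale (of_nat r) (\<phi> (a r)) = \<phi> (mps_scale (of_nat r) (a r))"
      using assms by (simp add: Sym_linear_scale[OF lin])
    also have "\<dots> = \<phi> (\<Sum>i=1..r. q i * a (r - i))"
      using assms by (simp add: newton_def)
    also have "\<dots> = (\<Sum>i=1..r. \<phi> (q i * a (r - i)))"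
      by (rule Sym_linear_sum[OF lin]) (use assms in auto)
    also have "\<dots> = (\<Sum>i=1..r. \<phi> (q i) * \<phi> (a (r - i)))"
      by (rule sum.cong) (use assms in \<open>auto simp: Sym_hom_mult\<close>)
    finally show ?thesis .
  qed
  then show ?thesis using assms by (simp add: newton_def Sym_hom_1)
qed

lemma newton_unique_power_sums:
  assumes "newton a q" "newton a q'" "0 < r"
  shows "q r = q' r"
  using assms(3)
proof (induction r rule: less_induct)
  case (less r)
  have eq: "{1..r} = insert r {1..<r}" using less.prems by auto
  have split: "(\<Sum>i=1..r. p i * a (r - i)) = p r + (\<Sum>i=1..<r. p i * a (r - i))" for p
    using assms(1) by (subst eq) (simp add: newton_def)
  have "(\<Sum>i=1..r. q i * a (r - i)) = (\<Sum>i=1..r. q' i * a (r - i))"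
    using assms(1,2) unfolding newton_def by metis
  moreover have "(\<Sum>i=1..<r. q i * a (r - i)) = (\<Sum>i=1..<r. q' i * a (r - i))"
    using less.IH by (intro sum.cong) auto
  ultimately show ?case
    unfolding split by simp
qed

lemma newton_unique:
  assumes "newton a q" "newton b q'" "\<And>r. 0 < r \<Longrightarrow> q r = q' r"
  shows "a r = b r"
proof (induction r rule: less_induct)
  case (less r)
  show ?case
  proof (cases "r = 0")
    case False
    have "mps_scale (of_nat r) (a r) = mps_scale (of_nat r) (b r)"
      using assms less unfolding newton_def by (auto intro!: sum.cong)
    then show ?thesis using False by simp
  qed (use assms in \<open>simp add: newton_def\<close>)
qed

lemma of_nat_mult_mps: "of_nat n * f = mps_scale (of_nat n) (f :: 'a::comm_ring_1 mps)"
  by (induction n) (auto intro!: mps_eqI simp: distrib_right)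

text \<open>
  In terms of the generating functions \<open>A\<close> of \<open>a\<close> and \<open>Q\<close> of \<open>q\<close> (with constant term \<open>0\<close>),
  \<^prop>\<open>newton a q\<close> says that \<open>X A' = Q A\<close>: the \<open>q\<close> are the coefficients of a logarithmic
  derivative and so add up under products.
\<close>

lemma newton_iff_fps:
  "newton a q \<longleftrightarrow> a 0 = 1 \<and>
     fps_X * fps_deriv (Abs_fps a) = Abs_fps (\<lambda>i. if i = 0 then 0 else q i) * Abs_fps a"
proof -
  have "fps_nth (fps_X * fps_deriv (Abs_fps a)) r = mps_scale (of_nat r) (a r)" for r
    by (cases r) (simp_all add: of_nat_mult_mps del: of_nat_Suc)
  moreover have "fps_nth (Abs_fps (\<lambda>i. if i = 0 then 0 else q i) * Abs_fps a) r = (\<Sum>i=1..r. q i * a (r - i))" for r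
    unfolding fps_mult_nth by (rule sum.mono_neutral_cong_right) auto
  ultimately show ?thesis by (simp add: newton_def fps_eq_iff)
qed

lemma newton_convolution:
  assumes "newton a q" "newton b q'"
  shows "newton (\<lambda>r. \<Sum>i\<le>r. a i * b (r - i)) (\<lambda>r. q r + q' r)"
proof -
  let ?A = "Abs_fps a" and ?B = "Abs_fps b"
  let ?Q = "\<lambda>q. Abs_fps (\<lambda>i. if i = 0 then 0 else q i :: rat mps)"
  have conv: "Abs_fps (\<lambda>r. \<Sum>i\<le>r. a i * b (r - i)) = ?A * ?B"
    by (simp add: fps_eq_iff fps_mult_nth atLeast0AtMost)
  have Q: "?Q (\<lambda>r. q r + q' r) = ?Q q + ?Q q'" by (simp add: fps_eq_iff)
  have "fps_X * fps_deriv (?A * ?B) = (fps_X * fps_deriv ?A) * ?B + ?A * (fps_X * fps_deriv ?B)"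
    by (simp add: algebra_simps)
  also have "\<dots> = (?Q q * ?A) * ?B + ?A * (?Q q' * ?B)"
    using assms by (simp add: newton_iff_fps)
  also have "\<dots> = (?Q q + ?Q q') * (?A * ?B)" by (simp add: algebra_simps)
  finally show ?thesis
    unfolding newton_iff_fps conv Q using assms by (simp add: newton_def)
qed

text \<open>By \<open>skew_h_h\<close>, \<open>skew_h\<close> acts on the \<open>h r\<close> as
  adjoining one further variable with value 1. The constant sequence 1 is the family of complete
  functions of that variable, and all its power sums are 1.\<close>

lemma skew_h_power_sum:
  assumes "0 < k"
  shows "skew_h (power_sum k) = power_sum k + 1"
proof (rule newton_unique_power_sums[OF _ _ assms])
  show "newton (\<lambda>r. skew_h (h r)) (\<lambda>k. skew_h (power_sum k))"
    by (rule newton_hom[OF skew_h_hom newton_h_power_sum]) auto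
  have "newton (\<lambda>_. 1) (\<lambda>_. 1)"
    by (simp add: newton_def flip: of_nat_mult_mps)
  from newton_convolution[OF newton_h_power_sum this]
  show "newton (\<lambda>r. skew_h (h r)) (\<lambda>k. power_sum k + 1)"
    by (simp add: skew_h_h)
qed

text \<open>By \<open>sum_e_h\<close>, the sequence \<open>(-1)^r e r\<close> is the convolution
  inverse of \<open>h\<close>, so its power sums are the negatives of \<open>power_sum k\<close>.
  Rescaling degree \<open>k\<close> by \<open>(-1)^k\<close> passes to the sequence
  \<open>e\<close>, which is the image of \<open>h\<close>.\<close>

lemma omega_power_sum:
  assumes "0 < k"
  shows "omega (power_sum k) = mps_scale ((- 1) ^ Suc k) (power_sum k)"
proof -
  have "newton (\<lambda>r. omega (h r)) (\<lambda>k. omega (power_sum k))"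
    by (rule newton_hom[OF omega_hom newton_h_power_sum]) auto
  then have e: "mps_scale (of_nat r) (e r) = (\<Sum>i=1..r. omega (power_sum i) * e (r - i))" for r
    by (simp add: newton_def omega_h)
  have "mps_scale (of_nat r) (mps_scale ((- 1) ^ r) (e r)) =
      (\<Sum>i=1..r. mps_scale ((- 1) ^ i) (omega (power_sum i)) * mps_scale ((- 1) ^ (r - i)) (e (r - i)))" for r
  proof -
    have "mps_scale (of_nat r) (mps_scale ((- 1) ^ r) (e r)) =
        mps_scale ((- 1) ^ r) (\<Sum>i=1..r. omega (power_sum i) * e (r - i))"
      unfolding e[symmetric] by (simp add: mult.commute)
    also have "\<dots> = (\<Sum>i=1..r. mps_scale ((- 1) ^ i) (omega (power_sum i)) * mps_scale ((- 1) ^ (r - i)) (e (r - i)))"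
      unfolding mps.scale_sum_right
      by (rule sum.cong) (auto simp flip: power_add)
    finally show ?thesis .
  qed
  then have E: "newton (\<lambda>r. mps_scale ((- 1) ^ r) (e r)) (\<lambda>i. mps_scale ((- 1) ^ i) (omega (power_sum i)))"
    by (simp add: newton_def)
  have "newton (\<lambda>r. if r = 0 then 1 else 0)
      (\<lambda>i. mps_scale ((- 1) ^ i) (omega (power_sum i)) + power_sum i)"
    using newton_convolution[OF E newton_h_power_sum] sum_e_h by (simp add: minus_one_power_mult)
  moreover have "newton (\<lambda>r. if r = 0 then 1 else 0) (\<lambda>_. 0)"
    by (simp add: newton_def)
  ultimately have "mps_scale ((- 1) ^ k) (omega (power_sum k)) + power_sum k = 0"
    using newton_unique_power_sums assms by blast
  then have "mps_scale ((- 1) ^ k) (mps_scale ((- 1) ^ k) (omega (power_sum k))) = mps_scale ((- 1) ^ k) (- power_sum k)"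
    by (simp add: add_eq_0_iff2)
  then show ?thesis by (simp flip: power_mult_distrib)
qed

lemma skew_e_power_sum:
  assumes "0 < k"
  shows "skew_e (power_sum k) = power_sum k + mps_scale ((- 1) ^ Suc k) 1"
proof -
  note lins = Sym_linear_scale[OF skew_h_linear] Sym_linear_scale[OF omega_linear] Sym_linear_add[OF omega_linear]
  \<comment> \<open>The sign enters with each use of \<open>omega\<close>: it cancels on
    \<open>power_sum k\<close> and remains on the constant term.\<close>
  define c :: rat where "c = (- 1) ^ Suc k"
  have "c * c = 1" by (simp add: c_def flip: power_mult_distrib)
  moreover have "skew_e (power_sum k) = mps_scale c (mps_scale c (power_sum k) + 1)"
    unfolding c_def using assms by (simp only: skew_e_eq Sym_power_sum omega_power_sum lins skew_h_power_sum
        Sym_add Sym_1 Sym_hom_1[OF omega_hom])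
  ultimately show ?thesis unfolding c_def[symmetric] by (simp add: mps.scale_right_distrib)
qed

section \<open>Plethysm\<close>

abbreviation mono_power :: "nat \<Rightarrow> (nat \<Rightarrow>\<^sub>0 nat) \<Rightarrow> (nat \<Rightarrow>\<^sub>0 nat)" where
  "mono_power k \<equiv> Poly_Mapping.map ((*) k)"

lemma lookup_mono_power [simp]: "lookup (mono_power k \<eta>) v = k * lookup \<eta> v"
  by (simp add: map.rep_eq when_def)

lemma mono_power_add: "mono_power k (a + b) = mono_power k a + mono_power k b"
  by (rule poly_mapping_eqI) (simp add: lookup_add distrib_left)

lemma mono_power_inject [simp]: "0 < k \<Longrightarrow> mono_power k a = mono_power k b \<longleftrightarrow> a = b"
  by (auto simp: poly_mapping_eq_iff fun_eq_iff)

lemma mono_power_single [simp]: "mono_power k (single v j) = single v (k * j)"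
  by (rule poly_mapping_eqI) (simp add: lookup_single when_def)

lemma mono_power_eq_single_iff:
  assumes "0 < k"
  shows "mono_power k \<eta> = single v (k * j) \<longleftrightarrow> \<eta> = single v j"
  using mono_power_inject[OF assms, of \<eta> "single v j"] by simp

lemma mono_degree_mono_power: "mono_degree (mono_power k \<eta>) = k * mono_degree \<eta>"
proof -
  have "mono_degree (mono_power k \<eta>) = (\<Sum>v\<in>keys \<eta>. lookup (mono_power k \<eta>) v)"
    by (rule mono_degree_eq) (auto simp: in_keys_iff)
  then show ?thesis by (simp add: mono_degree_def sum_distrib_left)
qed

lemma mps_coeff_adams_power:
  assumes "0 < k"
  shows "mps_coeff (adams k g) (mono_power k \<eta>) = mps_coeff g \<eta>"
proof -
  have "{\<eta>'. mono_power k \<eta>' = mono_power k \<eta>} = {\<eta>}" using assms by auto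
  then show ?thesis by (simp add: adams_def)
qed

lemma mps_coeff_adams_other:
  assumes "\<theta> \<notin> range (mono_power k)"
  shows "mps_coeff (adams k g) \<theta> = 0"
proof -
  have "{\<eta>. mono_power k \<eta> = \<theta>} = {}" using assms by auto
  then show ?thesis unfolding adams_def mps_coeff_Abs by (simp only: sum.empty)
qed

lemma adams_eqI:
  assumes "0 < k" "\<And>\<eta>. mps_coeff F (mono_power k \<eta>) = mps_coeff g \<eta>"
    and "\<And>\<theta>. \<theta> \<notin> range (mono_power k) \<Longrightarrow> mps_coeff F \<theta> = 0"
  shows "adams k g = F"
proof (rule mps_eqI)
  fix \<theta>
  show "mps_coeff (adams k g) \<theta> = mps_coeff F \<theta>"
    using assms mps_coeff_adams_power[OF assms(1)] mps_coeff_adams_other[of \<theta> k]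
    by (cases "\<theta> \<in> range (mono_power k)") auto
qed

lemma adams_mult:
  assumes k: "0 < k"
  shows "adams k (f * g) = adams k f * adams k g"
proof (rule adams_eqI[OF k])
  fix \<eta>
  let ?T = "\<lambda>p. mps_coeff (adams k f) (fst p) * mps_coeff (adams k g) (snd p)"
  let ?j = "\<lambda>(a, b). (mono_power k a, mono_power k b)"
  have inj: "inj_on ?j (mono_splits \<eta>)" using k by (auto simp: inj_on_def)
  have "mps_coeff (adams k f * adams k g) (mono_power k \<eta>) = (\<Sum>p\<in>mono_splits (mono_power k \<eta>). ?T p)"
    by (simp add: mps_coeff_mult case_prod_unfold)
  \<comment> \<open>A splitting contributes only if both factors are \<open>k\<close>-th powers of
    monomials, and then it comes from a splitting of \<open>\<eta>\<close>.\<close>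
  also have "\<dots> = (\<Sum>p\<in>?j ` mono_splits \<eta>. ?T p)"
  proof (rule sum.mono_neutral_right)
    show "?j ` mono_splits \<eta> \<subseteq> mono_splits (mono_power k \<eta>)"
      by (auto simp: mono_splits_def mono_power_add)
    show "\<forall>p\<in>mono_splits (mono_power k \<eta>) - ?j ` mono_splits \<eta>. ?T p = 0"
    proof (intro ballI, rule ccontr)
      fix p assume p: "p \<in> mono_splits (mono_power k \<eta>) - ?j ` mono_splits \<eta>" "?T p \<noteq> 0"
      then have "fst p \<in> range (mono_power k)" "snd p \<in> range (mono_power k)"
        using mps_coeff_adams_other by force+
      then obtain a b where ab: "p = (mono_power k a, mono_power k b)" by (cases p) auto
      then have "mono_power k (a + b) = mono_power k \<eta>"
        using p(1) by (auto simp: mono_splits_def mono_power_add)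
      then have "a + b = \<eta>" using k by simp
      then show False using p(1) ab by (auto simp: mono_splits_def)
    qed
  qed simp
  also have "\<dots> = mps_coeff (f * g) \<eta>"
    by (subst sum.reindex[OF inj])
      (simp add: mps_coeff_mult case_prod_unfold mps_coeff_adams_power[OF k])
  finally show "mps_coeff (adams k f * adams k g) (mono_power k \<eta>) = mps_coeff (f * g) \<eta>" .
next
  fix \<theta> assume \<theta>: "\<theta> \<notin> range (mono_power k)"
  have "mps_coeff (adams k f) a * mps_coeff (adams k g) b = 0" if "a + b = \<theta>" for a b
  proof (rule ccontr)
    assume "\<not> ?thesis"
    then have "a \<in> range (mono_power k)" "b \<in> range (mono_power k)"
      using mps_coeff_adams_other by force+
    then show False using \<theta> that by (auto simp flip: mono_power_add)
  qed
  then show "mps_coeff (adams k f * adams k g) \<theta> = 0"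
    by (auto simp: mps_coeff_mult mono_splits_def intro!: sum.neutral)
qed

lemma adams_1:
  assumes "0 < k"
  shows "adams k 1 = 1"
proof (rule adams_eqI[OF assms])
  show "mps_coeff 1 (mono_power k \<eta>) = (mps_coeff 1 \<eta> :: rat)" for \<eta>
    using mono_power_inject[OF assms, of \<eta> 0] by (auto simp: poly_mapping_eq_iff fun_eq_iff assms)
  have "mono_power k 0 = 0" by (rule poly_mapping_eqI) simp
  then show "mps_coeff 1 \<theta> = (0 :: rat)" if "\<theta> \<notin> range (mono_power k)" for \<theta>
    using that by (metis mps_coeff_simps(2) rangeI)
qed

lemma adams_power_sum:
  assumes "0 < k" "0 < j"
  shows "adams k (power_sum j) = power_sum (k * j)"
proof (rule adams_eqI[OF assms(1)])
  show "mps_coeff (power_sum (k * j)) (mono_power k \<eta>) = mps_coeff (power_sum j) \<eta>" for \<eta>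
    by (simp add: power_sum_def mono_power_eq_single_iff[OF assms(1)])
  have "single v (k * j) \<in> range (mono_power k)" for v
    by (metis mono_power_single rangeI)
  then show "mps_coeff (power_sum (k * j)) \<theta> = 0" if "\<theta> \<notin> range (mono_power k)" for \<theta>
    using that by (auto simp: power_sum_def)
qed

lemma
  assumes "0 < k"
  shows adams_add: "adams k (f + g) = adams k f + adams k g"
    and adams_scale: "adams k (mps_scale c f) = mps_scale c (adams k f)"
  by (rule adams_eqI; simp add: assms mps_coeff_adams_power mps_coeff_adams_other)+

lemma adams_hom: "0 < k \<Longrightarrow> Sym_hom (adams k)"
  by (simp add: Sym_hom_def Sym_linear_def adams_add adams_scale adams_mult adams_1)

lemma Sym_adams:
  assumes "f \<in> Sym" "0 < k"
  shows "adams k f \<in> Sym"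
  using assms(1)
  by (induction rule: Sym_p_induct)
    (auto simp: assms(2) adams_1 adams_mult adams_add adams_scale adams_power_sum)

lemma homogeneous_adams:
  assumes "homogeneous d g" "0 < k"
  shows "homogeneous (k * d) (adams k g)"
  unfolding homogeneous_def
proof (intro allI impI)
  fix \<theta> assume nz: "mps_coeff (adams k g) \<theta> \<noteq> 0"
  then obtain \<eta> where \<theta>: "\<theta> = mono_power k \<eta>" using mps_coeff_adams_other by blast
  then show "mono_degree \<theta> = k * d"
    using nz assms by (auto simp: mps_coeff_adams_power mono_degree_mono_power homogeneous_def)
qed

section \<open>Plethysm as a homomorphism in its first argument\<close>

lemma plethysm_eq_extend: "plethysm f g = power_sum_prod.extend (\<lambda>\<rho>. prod_list (map (\<lambda>k. adams k g) \<rho>)) f"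
  by (simp add: plethysm_def power_sum_prod.extend_def)

lemma plethysm_power_sum_prod:
  "is_partition \<rho> \<Longrightarrow> plethysm (power_sum_prod \<rho>) g = prod_list (map (\<lambda>k. adams k g) \<rho>)"
  by (simp add: plethysm_eq_extend power_sum_prod.extend_basis)

lemma plethysm_linear: "Sym_linear (\<lambda>f. plethysm f g)"
  unfolding plethysm_eq_extend by (rule power_sum_prod.extend_linear)

text \<open>Multiplying a basis element by \<open>power_sum r\<close> inserts one part, and the
  product of the \<open>adams k g\<close> depends only on the multiset of parts.\<close>

lemma plethysm_hom: "Sym_hom (\<lambda>f. plethysm f g)"
proof (rule Sym_homI_p[OF plethysm_linear])
  show "plethysm 1 g = 1"
    using plethysm_power_sum_prod[of "[]" g] by (simp add: power_sum_prod_def)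
  fix r :: nat and f :: "rat mps" assume r: "0 < r" and f: "f \<in> Sym"
  show "plethysm (power_sum r * f) g = adams r g * plethysm f g"
  proof (rule power_sum_prod.linear_eqI[OF _ _ _ f])
    show "Sym_linear (\<lambda>f. plethysm (power_sum r * f) g)"
      by (rule Sym_linear_comp[OF _ plethysm_linear]) (use r in \<open>auto simp: Sym_linear_def distrib_left\<close>)
    show "Sym_linear (\<lambda>f. adams r g * plethysm f g)"
      using plethysm_linear[of g] by (simp add: Sym_linear_def distrib_left)
    fix \<rho> assume \<rho>: "is_partition \<rho>"
    obtain \<sigma> where \<sigma>: "is_partition \<sigma>" "power_sum r * power_sum_prod \<rho> = power_sum_prod \<sigma>"
      "mset \<sigma> = add_mset r (mset \<rho>)"
      using power_sum_prod_insert[OF \<rho> r] .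
    have "prod_list (map (\<lambda>k. adams k g) \<tau>) = prod_mset (image_mset (\<lambda>k. adams k g) (mset \<tau>))" for \<tau>
      by (simp add: prod_mset_prod_list flip: mset_map)
    then show "plethysm (power_sum r * power_sum_prod \<rho>) g = adams r g * plethysm (power_sum_prod \<rho>) g"
      by (simp add: \<sigma> plethysm_power_sum_prod \<rho>)
  qed
qed

lemma plethysm_power_sum:
  assumes "0 < k"
  shows "plethysm (power_sum k) g = adams k g"
  using plethysm_power_sum_prod[of "[k]" g] assms
  by (simp add: power_sum_prod_def is_partition_def)

lemma Sym_plethysm [intro]:
  assumes "g \<in> Sym"
  shows "plethysm f g \<in> Sym"
proof -
  have "prod_list (map (\<lambda>k. adams k g) \<rho>) \<in> Sym" if "0 \<notin> set \<rho>" for \<rho>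
    using that by (induction \<rho>) (auto simp: assms Sym_adams)
  then show ?thesis
    unfolding plethysm_eq_extend by (intro power_sum_prod.Sym_extend) (auto simp: is_partition_def)
qed

lemma homogeneous_plethysm:
  assumes "f \<in> Sym" "homogeneous d f" "homogeneous d' g"
  shows "homogeneous (d * d') (plethysm f g)"
  unfolding plethysm_def
proof (intro homogeneous_sum homogeneous_scale)
  fix \<rho> assume "\<rho> \<in> {\<rho>. is_partition \<rho> \<and> power_sum_coeff f \<rho> \<noteq> 0}"
  then have \<rho>: "is_partition \<rho>" "power_sum_coeff f \<rho> \<noteq> 0" by auto
  then have d: "sum_list \<rho> = d"
    using power_sum_prod.coeff_homogeneous[OF homogeneous_power_sum_prod assms(1,2)] by blast
  have "homogeneous (sum_list \<tau> * d') (prod_list (map (\<lambda>k. adams k g) \<tau>))" if "0 \<notin> set \<tau>" for \<tau>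
    using that
    by (induction \<tau>) (simp_all add: homogeneous_1 distrib_right homogeneous_mult homogeneous_adams assms(3))
  then show "homogeneous (d * d') (prod_list (map (\<lambda>k. adams k g) \<rho>))"
    using \<rho>(1) d by (auto simp: is_partition_def)
qed

text \<open>The sequence \<open>adams k (h r)\<close> in \<open>r\<close> has the power sums
  \<open>power_sum (k * j)\<close>. To each of these \<open>skew_e\<close> adds a constant, which
  amounts to a convolution with a sequence that vanishes beyond index 1. Therefore only
  \<open>h m\<close> and \<open>h (m - 1)\<close> appear.\<close>

lemma skew_e_adams_h:
  assumes "0 < k" "0 < m"
  shows "skew_e (adams k (h m)) = adams k (h m) + mps_scale ((- 1) ^ Suc k) (adams k (h (m - 1)))"
proof -
  \<comment> \<open>The generating function of \<open>c\<close> is linear,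
    \<open>1 + c 1 * X\<close>. Its power sums are \<open>-((- c 1)^j) = (-1)^(k*j + 1)\<close>, the
    constants that \<open>skew_e\<close> adds to \<open>power_sum (k * j)\<close>.\<close>
  define c where "c r = (if r = 0 then 1 else if r = 1 then mps_scale ((- 1) ^ Suc k) 1 else 0 :: rat mps)" for r :: nat
  define q where "q j = mps_scale ((- 1) ^ Suc (k * j)) (1 :: rat mps)" for j
  have N: "newton (\<lambda>r. adams k (h r)) (\<lambda>j. adams k (power_sum j))"
    by (rule newton_hom[OF adams_hom newton_h_power_sum]) (use assms in auto)
  have "newton (\<lambda>r. skew_e (adams k (h r))) (\<lambda>j. skew_e (adams k (power_sum j)))"
    by (rule newton_hom[OF skew_e_hom N]) (auto simp: assms Sym_adams)
  moreover have "newton c q"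
  proof -
    have "mps_scale (of_nat r) (c r) = (\<Sum>i=1..r. q i * c (r - i))" for r
    proof (cases "r \<le> 1")
      case True
      then consider "r = 0" | "r = 1" by linarith
      then show ?thesis by cases (simp_all add: c_def q_def)
    next
      case False
      then obtain r' where r: "r = Suc (Suc r')" by (metis One_nat_def not0_implies_Suc not_less_eq_eq le0)
      \<comment> \<open>For \<open>r\<close> at least 2 only \<open>i = r - 1\<close> and
        \<open>i = r\<close> survive, and these two terms have opposite signs.\<close>
      have "(\<Sum>i=1..r. q i * c (r - i)) = (\<Sum>i\<in>{Suc r', Suc (Suc r')}. q i * c (r - i))"
        by (rule sum.mono_neutral_right) (auto simp: r c_def)
      also have "\<dots> = mps_scale ((- 1) ^ Suc k * (- 1) ^ Suc (k * Suc r') + (- 1) ^ Suc (k * Suc (Suc r'))) 1"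
        by (simp add: r c_def q_def mps.scale_left_diff_distrib mult.commute)
      also have "(- 1) ^ Suc k * (- 1) ^ Suc (k * Suc r') + (- 1) ^ Suc (k * Suc (Suc r')) = (0 :: rat)"
        by (simp add: power_add)
      finally show ?thesis by (simp add: r c_def)
    qed
    then show ?thesis by (simp add: newton_def c_def)
  qed
  note newton_convolution[OF N this]
  moreover have "skew_e (adams k (power_sum j)) = adams k (power_sum j) + q j" if "0 < j" for j
    using that assms by (simp add: adams_power_sum skew_e_power_sum q_def)
  ultimately have "skew_e (adams k (h m)) = (\<Sum>i\<le>m. adams k (h i) * c (m - i))"
    by (rule newton_unique)
  also have "\<dots> = (\<Sum>i\<in>{m - 1, m}. adams k (h i) * c (m - i))"
    by (rule sum.mono_neutral_right) (auto simp: c_def)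
  also have "\<dots> = adams k (h m) + mps_scale ((- 1) ^ Suc k) (adams k (h (m - 1)))"
    using assms by (simp add: c_def)
  finally show ?thesis .
qed

section \<open>The recursion\<close>

definition partition_pairs :: "nat \<Rightarrow> (nat list \<times> nat list) set" where
  "partition_pairs n = {(b, c). is_partition b \<and> is_partition c \<and> sum_list b + sum_list c = n}"

lemma finite_partition_pairs [simp]: "finite (partition_pairs n)"
proof (rule finite_subset)
  show "partition_pairs n \<subseteq> {b. is_partition b \<and> sum_list b \<le> n} \<times> {c. is_partition c \<and> sum_list c \<le> n}"
    by (auto simp: partition_pairs_def)
qed (auto intro: finite_partitions_bounded)

lemma schur_coeff_mult_schur_degree:
  assumes "is_partition b" "is_partition c" "is_partition lam" "schur_coeff (schur b * schur c) lam \<noteq> 0"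
  shows "sum_list b + sum_list c = sum_list lam"
  using schur.coeff_homogeneous[OF homogeneous_schur _ homogeneous_mult[OF homogeneous_schur homogeneous_schur]] assms
  by (metis Sym_mult Sym_schur)

lemma schur_coeff_extend:
  assumes "\<And>sig. is_partition sig \<Longrightarrow> F sig \<in> Sym"
  shows "schur_coeff (schur.extend F f) lam =
    (\<Sum>sig | is_partition sig \<and> schur_coeff f sig \<noteq> 0. schur_coeff f sig * schur_coeff (F sig) lam)"
proof -
  have "schur_coeff (schur.extend F f) lam =
      (\<Sum>sig | is_partition sig \<and> schur_coeff f sig \<noteq> 0. schur_coeff (mps_scale (schur_coeff f sig) (F sig)) lam)"
    unfolding schur.extend_def by (rule schur.coeff_sum) (use assms in auto)
  also have "\<dots> = (\<Sum>sig | is_partition sig \<and> schur_coeff f sig \<noteq> 0. schur_coeff f sig * schur_coeff (F sig) lam)"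
    by (rule sum.cong) (use assms in \<open>auto simp: schur.coeff_scale\<close>)
  finally show ?thesis .
qed

lemma schur_coeff_sum_schur:
  assumes "finite A" "A \<subseteq> Collect is_partition" "is_partition lam"
  shows "schur_coeff (\<Sum>mu\<in>A. schur mu) lam = (if lam \<in> A then 1 else 0)"
proof -
  have "schur_coeff (\<Sum>mu\<in>A. schur mu) lam = (\<Sum>mu\<in>A. schur_coeff (schur mu) lam)"
    by (rule schur.coeff_sum) (use assms in auto)
  also have "\<dots> = (\<Sum>mu\<in>A. if mu = lam then 1 else 0)"
    by (rule sum.cong) (use assms in \<open>auto simp: schur.coeff_basis\<close>)
  finally show ?thesis using assms by simp
qed

text \<open>Adjointness: the left side pairs \<open>f\<close> with \<open>h r * schur lam\<close>.
  Homogeneity of \<open>f\<close> singles out the summand of \<open>skew_h\<close> that lowers the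
  degree by \<open>r\<close>.\<close>

lemma sum_schur_coeff_strips:
  assumes f: "f \<in> Sym" "homogeneous (sum_list lam + r) f" and lam: "is_partition lam"
  shows "(\<Sum>rho\<in>hstrips_over lam (sum_list lam + r). schur_coeff f rho) =
    schur_coeff (skew_h f) lam"
proof -
  have strips: "schur_coeff (\<Sum>mu\<in>hstrips_under sig. schur mu) lam =
      (if hstrip sig lam then 1 else 0)" for sig
    by (subst schur_coeff_sum_schur) (auto simp: lam)
  have "schur_coeff (skew_h f) lam = (\<Sum>sig | is_partition sig \<and> schur_coeff f sig \<noteq> 0.
      schur_coeff f sig * (if hstrip sig lam then 1 else 0))"
    unfolding skew_h_def by (subst schur_coeff_extend) (auto simp only: strips Sym_sum Sym_schur)
  also have "\<dots> = (\<Sum>sig | is_partition sig \<and> schur_coeff f sig \<noteq> 0 \<and> hstrip sig lam. schur_coeff f sig)"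
    by (rule sum.mono_neutral_cong_right) auto
  also have "\<dots> = (\<Sum>rho\<in>hstrips_over lam (sum_list lam + r). schur_coeff f rho)"
    by (rule sum.mono_neutral_left)
      (use schur.coeff_homogeneous[OF homogeneous_schur f] in auto)
  finally show ?thesis by simp
qed

text \<open>
  The coproduct of \<open>s\<^sub>\<lambda>\<close>: the power sums are primitive, and its structure constants are the
  Littlewood--Richardson coefficients of the product. The right-hand side extends to a ring
  homomorphism in \<open>s\<^sub>\<lambda>\<close> because the adjoint \<open>skew_h\<close> of multiplication by the \<open>h\<^sub>r\<close> is one.
\<close>

lemma Sym_hom_sum_schur:
  assumes \<phi>: "Sym_hom \<phi>" and \<psi>: "Sym_hom \<psi>" and \<chi>: "Sym_hom \<chi>"
    and p: "\<And>k. 0 < k \<Longrightarrow> \<chi> (power_sum k) = \<phi> (power_sum k) + \<psi> (power_sum k)"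
    and lam: "is_partition lam"
  shows "\<chi> (schur lam) = (\<Sum>(b, c)\<in>partition_pairs (sum_list lam).
    mps_scale (schur_coeff (schur b * schur c) lam) (\<phi> (schur b) * \<psi> (schur c)))"
proof -
  define X where "X bc = \<phi> (schur (fst bc)) * \<psi> (schur (snd bc))" for bc
  define C where "C bc lam = schur_coeff (schur (fst bc) * schur (snd bc)) lam" for bc lam
  \<comment> \<open>The claimed right-hand side, extended linearly. It turns out to be a
    homomorphism that agrees with \<open>\<chi>\<close> on power sums.\<close>
  define \<Psi> where "\<Psi> = schur.extend (\<lambda>lam. \<Sum>bc\<in>partition_pairs (sum_list lam). mps_scale (C bc lam) (X bc))"
  define S where "S bc bc' \<longleftrightarrow> hstrip (fst bc) (fst bc') \<and> hstrip (snd bc) (snd bc')"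
    for bc bc' :: "nat list \<times> nat list"
  define K where "K r = (\<Sum>i\<le>r. \<phi> (h i) * \<psi> (h (r - i)))" for r
  have lin: "Sym_linear \<Psi>" unfolding \<Psi>_def by (rule schur.extend_linear)
  have \<Psi>_schur: "\<Psi> (schur lam) = (\<Sum>bc\<in>partition_pairs (sum_list lam). mps_scale (C bc lam) (X bc))"
    if "is_partition lam" for lam
    using that by (simp add: \<Psi>_def schur.extend_basis)
  \<comment> \<open>Adjointness passes from strips over \<open>lam\<close> to \<open>skew_h\<close>
    of the product; as \<open>skew_h\<close> is multiplicative, strips come off \<open>b\<close> and
    \<open>c\<close> separately.\<close>
  have C_strips: "(\<Sum>rho\<in>hstrips_over lam (sum_list lam + r). C bc rho) =
      (\<Sum>bc' | bc' \<in> partition_pairs (sum_list lam) \<and> S bc bc'. C bc' lam)"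
    if lam: "is_partition lam" and bc: "bc \<in> partition_pairs (sum_list lam + r)" for bc lam r
  proof -
    obtain b c where bc_eq: "bc = (b, c)" and b: "is_partition b" and c: "is_partition c"
      and sz: "sum_list b + sum_list c = sum_list lam + r"
      using bc by (auto simp: partition_pairs_def)
    let ?B = "{b'. is_partition b' \<and> hstrip b b'}" and ?C = "{c'. is_partition c' \<and> hstrip c c'}"
    have "(\<Sum>rho\<in>hstrips_over lam (sum_list lam + r). C bc rho) =
        schur_coeff (skew_h (schur b * schur c)) lam"
      unfolding C_def bc_eq fst_conv snd_conv
      by (rule sum_schur_coeff_strips[OF _ _ lam])
        (use b c homogeneous_mult[OF homogeneous_schur[of b] homogeneous_schur[of c]] sz in auto)
    also have "skew_h (schur b * schur c) = (\<Sum>bc'\<in>?B \<times> ?C. schur (fst bc') * schur (snd bc'))"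
      using b c by (simp add: Sym_hom_mult[OF skew_h_hom] skew_h_schur sum_product
          sum.cartesian_product case_prod_unfold)
    also have "schur_coeff \<dots> lam = (\<Sum>bc'\<in>?B \<times> ?C. C bc' lam)"
      unfolding C_def by (rule schur.coeff_sum) auto
    also have "\<dots> = (\<Sum>bc' | bc' \<in> partition_pairs (sum_list lam) \<and> S bc bc'. C bc' lam)"
    proof (rule sum.mono_neutral_right)
      show "\<forall>bc'\<in>?B \<times> ?C - {bc'. bc' \<in> partition_pairs (sum_list lam) \<and> S bc bc'}. C bc' lam = 0"
        using schur_coeff_mult_schur_degree[OF _ _ lam]
        by (auto simp: C_def S_def bc_eq partition_pairs_def)
    qed (auto simp: partition_pairs_def S_def bc_eq)
    finally show ?thesis .
  qed
  \<comment> \<open>The Pieri rule acts on each factor, with the total size \<open>r\<close>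
    distributed over both in all ways.\<close>
  have X_strips: "(\<Sum>bc | bc \<in> partition_pairs (n + r) \<and> S bc bc'. X bc) = K r * X bc'"
    if bc': "bc' \<in> partition_pairs n" for bc' n r
  proof -
    obtain b' c' where bc'_eq: "bc' = (b', c')" and b': "is_partition b'" and c': "is_partition c'"
      and sz: "sum_list b' + sum_list c' = n"
      using bc' by (auto simp: partition_pairs_def)
    let ?up = "\<lambda>i a. hstrips_over a (sum_list a + i)"
    have "{bc. bc \<in> partition_pairs (n + r) \<and> S bc bc'} = (\<Union>i\<in>{..r}. ?up i b' \<times> ?up (r - i) c')"
    proof (intro set_eqI iffI)
      fix bc assume "bc \<in> {bc. bc \<in> partition_pairs (n + r) \<and> S bc bc'}"
      then obtain b c where bc: "bc = (b, c)" "is_partition b" "is_partition c"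
        "sum_list b + sum_list c = n + r" "hstrip b b'" "hstrip c c'"
        by (auto simp: partition_pairs_def S_def bc'_eq)
      have "sum_list b' \<le> sum_list b" "sum_list c' \<le> sum_list c" using bc hstrip_size by auto
      then have "bc \<in> ?up (sum_list b - sum_list b') b' \<times> ?up (r - (sum_list b - sum_list b')) c'"
        "sum_list b - sum_list b' \<in> {..r}"
        using bc sz by auto
      then show "bc \<in> (\<Union>i\<in>{..r}. ?up i b' \<times> ?up (r - i) c')" by blast
    next
      fix bc assume "bc \<in> (\<Union>i\<in>{..r}. ?up i b' \<times> ?up (r - i) c')"
      then show "bc \<in> {bc. bc \<in> partition_pairs (n + r) \<and> S bc bc'}"
        using sz by (auto simp: partition_pairs_def S_def bc'_eq)
    qed
    also have "(\<Sum>bc\<in>(\<Union>i\<in>{..r}. ?up i b' \<times> ?up (r - i) c'). X bc) = (\<Sum>i\<le>r. \<Sum>bc\<in>?up i b' \<times> ?up (r - i) c'. X bc)"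
      by (rule sum.UNION_disjoint) auto
    also have "\<dots> = (\<Sum>i\<le>r. (\<Sum>b\<in>?up i b'. \<phi> (schur b)) * (\<Sum>c\<in>?up (r - i) c'. \<psi> (schur c)))"
      unfolding sum_product sum.cartesian_product X_def case_prod_unfold ..
    also have "\<dots> = (\<Sum>i\<le>r. \<phi> (h i * schur b') * \<psi> (h (r - i) * schur c'))"
    proof (rule sum.cong[OF refl])
      fix i
      have "\<phi> (h i * schur b') = (\<Sum>b\<in>?up i b'. \<phi> (schur b))"
        unfolding pieri_h[OF b'] by (rule Sym_linear_sum[OF Sym_hom_linear[OF \<phi>]]) auto
      moreover have "\<psi> (h (r - i) * schur c') = (\<Sum>c\<in>?up (r - i) c'. \<psi> (schur c))"
        unfolding pieri_h[OF c'] by (rule Sym_linear_sum[OF Sym_hom_linear[OF \<psi>]]) auto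
      ultimately show "(\<Sum>b\<in>?up i b'. \<phi> (schur b)) * (\<Sum>c\<in>?up (r - i) c'. \<psi> (schur c)) =
          \<phi> (h i * schur b') * \<psi> (h (r - i) * schur c')"
        by simp
    qed
    also have "\<dots> = K r * X bc'"
      using b' c' by (simp add: K_def X_def bc'_eq sum_distrib_left sum_distrib_right Sym_hom_mult[OF \<phi>] Sym_hom_mult[OF \<psi>] ac_simps)
    finally show ?thesis .
  qed
  have "b = [] \<and> c = []" if "(b, c) \<in> partition_pairs 0" for b c
    using that sum_list_zero_partition[of b] sum_list_zero_partition[of c] by (auto simp: partition_pairs_def)
  then have "partition_pairs 0 = {([], [])}"
    by (auto simp: partition_pairs_def)
  then have one: "\<Psi> 1 = 1"
    using \<Psi>_schur[of "[]"] schur.coeff_basis[of "[]" "[]"]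
    by (simp add: C_def X_def Sym_hom_1[OF \<phi>] Sym_hom_1[OF \<psi>])
  have mult: "\<Psi> (h r * schur lam) = K r * \<Psi> (schur lam)" if lam: "is_partition lam" for r lam
  proof -
    let ?n = "sum_list lam"
    let ?R = "hstrips_over lam (?n + r)"
    have "\<Psi> (h r * schur lam) = (\<Sum>rho\<in>?R. \<Psi> (schur rho))"
      unfolding pieri_h[OF lam] by (rule Sym_linear_sum[OF lin]) auto
    also have "\<dots> = (\<Sum>rho\<in>?R. \<Sum>bc\<in>partition_pairs (?n + r). mps_scale (C bc rho) (X bc))"
      by (rule sum.cong) (auto simp: \<Psi>_schur)
    also have "\<dots> = (\<Sum>bc\<in>partition_pairs (?n + r). mps_scale (\<Sum>rho\<in>?R. C bc rho) (X bc))"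
      by (subst sum.swap) (simp add: mps.scale_sum_left)
    also have "\<dots> = (\<Sum>bc\<in>partition_pairs (?n + r). \<Sum>bc' | bc' \<in> partition_pairs ?n \<and> S bc bc'. mps_scale (C bc' lam) (X bc))"
      by (rule sum.cong[OF refl]) (simp add: C_strips[OF lam] mps.scale_sum_left)
    also have "\<dots> = (\<Sum>bc'\<in>partition_pairs ?n. \<Sum>bc | bc \<in> partition_pairs (?n + r) \<and> S bc bc'. mps_scale (C bc' lam) (X bc))"
      by (rule sum.swap_restrict) auto
    also have "\<dots> = (\<Sum>bc'\<in>partition_pairs ?n. mps_scale (C bc' lam) (K r * X bc'))"
      by (rule sum.cong[OF refl]) (simp add: X_strips flip: mps.scale_sum_right)
    also have "\<dots> = K r * \<Psi> (schur lam)"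
      using lam by (simp add: \<Psi>_schur sum_distrib_left)
    finally show ?thesis .
  qed
  have hom: "Sym_hom \<Psi>" and \<Psi>_h: "\<Psi> (h r) = K r" for r
    using Sym_homI_h[of \<Psi> K, OF lin one mult] by blast+
  have N\<Psi>: "newton (\<lambda>r. \<Psi> (h r)) (\<lambda>k. \<Psi> (power_sum k))"
    by (rule newton_hom[OF hom newton_h_power_sum]) auto
  have N: "newton (\<lambda>r. \<phi> (h r)) (\<lambda>k. \<phi> (power_sum k))"
    "newton (\<lambda>r. \<psi> (h r)) (\<lambda>k. \<psi> (power_sum k))"
    by (rule newton_hom[OF _ newton_h_power_sum]; auto simp: \<phi> \<psi>)+
  \<comment> \<open>The values of \<open>\<Psi>\<close> on the \<open>h r\<close> are a convolution,
    so its values on power sums are sums.\<close>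
  from newton_convolution[OF N]
  have "newton (\<lambda>r. \<Psi> (h r)) (\<lambda>k. \<phi> (power_sum k) + \<psi> (power_sum k))"
    unfolding \<Psi>_h K_def .
  from newton_unique_power_sums[OF N\<Psi> this]
  have eq: "\<chi> (power_sum k) = \<Psi> (power_sum k)" if "0 < k" for k
    using that p by simp
  have "\<chi> (schur lam) = \<Psi> (schur lam)"
    by (rule Sym_hom_eqI_p[OF \<chi> hom eq Sym_schur[OF lam]])
  then show ?thesis by (simp add: \<Psi>_schur lam C_def X_def case_prod_unfold)
qed

lemma schur_coeff_omega:
  assumes "f \<in> Sym" "is_partition lam"
  shows "schur_coeff (omega f) (conjugate lam) = schur_coeff f lam"
proof -
  have "schur_coeff (omega f) (conjugate lam) =
    (\<Sum>sig | is_partition sig \<and> schur_coeff f sig \<noteq> 0. schur_coeff f sig * schur_coeff (schur (conjugate sig)) (conjugate lam))"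
    unfolding omega_def by (rule schur_coeff_extend) auto
  also have "\<dots> = (\<Sum>sig | is_partition sig \<and> schur_coeff f sig \<noteq> 0. if sig = lam then schur_coeff f lam else 0)"
  proof (rule sum.cong[OF refl])
    fix sig assume "sig \<in> {sig. is_partition sig \<and> schur_coeff f sig \<noteq> 0}"
    then have "is_partition sig" by simp
    moreover from this have "conjugate sig = conjugate lam \<longleftrightarrow> sig = lam"
      using assms(2) by (metis conjugate_conjugate)
    ultimately show "schur_coeff f sig * schur_coeff (schur (conjugate sig)) (conjugate lam) =
        (if sig = lam then schur_coeff f lam else 0)"
      using assms(2) by (simp add: schur.coeff_basis)
  qed
  also have "\<dots> = schur_coeff f lam" using assms(2) by simp
  finally show ?thesis .
qed

text \<open>On \<open>power_sum k\<close> the left side is a sum of two plethysms, by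
  \<open>skew_e_adams_h\<close>. The sign of the second is supplied by \<open>omega\<close>, which
  makes it the value of the homomorphism \<open>?\<psi>\<close>, and
  \<open>Sym_hom_sum_schur\<close> applies.\<close>

lemma skew_e_plethysm:
  assumes m: "0 < m" and lam: "is_partition lam"
  shows "skew_e (plethysm (schur (conjugate lam)) (h m)) =
    (\<Sum>(b, c)\<in>partition_pairs (sum_list lam). mps_scale (schur_coeff (schur c * schur b) lam)
      (plethysm (schur (conjugate b)) (h m) * plethysm (schur c) (h (m - 1))))"
proof -
  let ?\<psi> = "\<lambda>f. plethysm (omega f) (h (m - 1))"
  have \<psi>: "Sym_hom ?\<psi>" by (rule Sym_hom_comp[OF omega_hom plethysm_hom]) auto
  have \<chi>: "Sym_hom (\<lambda>f. skew_e (plethysm f (h m)))"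
    by (rule Sym_hom_comp[OF plethysm_hom skew_e_hom]) auto
  have p: "skew_e (plethysm (power_sum k) (h m)) = plethysm (power_sum k) (h m) + ?\<psi> (power_sum k)"
    if "0 < k" for k
  proof -
    have "?\<psi> (power_sum k) = mps_scale ((- 1) ^ Suc k) (adams k (h (m - 1)))"
      using that by (simp only: omega_power_sum Sym_linear_scale[OF plethysm_linear] Sym_power_sum plethysm_power_sum)
    then show ?thesis using that m by (simp only: plethysm_power_sum skew_e_adams_h)
  qed
  have "skew_e (plethysm (schur (conjugate lam)) (h m)) =
    (\<Sum>(b, c)\<in>partition_pairs (sum_list (conjugate lam)). mps_scale (schur_coeff (schur b * schur c) (conjugate lam))
      (plethysm (schur b) (h m) * ?\<psi> (schur c)))"
    using Sym_hom_sum_schur[OF plethysm_hom \<psi> \<chi> p, of "conjugate lam"] lam by simp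
  also have "\<dots> = (\<Sum>(b, c)\<in>partition_pairs (sum_list lam). mps_scale (schur_coeff (schur c * schur b) lam)
      (plethysm (schur (conjugate b)) (h m) * plethysm (schur c) (h (m - 1))))"
  \<comment> \<open>Conjugating both partitions of the pair undoes \<open>omega\<close> in the
    second factor, puts a conjugate into the first, and changes the coefficient at
    \<open>conjugate lam\<close> into one at \<open>lam\<close>.\<close>
  proof (rule sum.reindex_bij_witness[where i = "map_prod conjugate conjugate" and j = "map_prod conjugate conjugate"])
    fix bc assume "bc \<in> partition_pairs (sum_list (conjugate lam))"
    then obtain b c where bc: "bc = (b, c)" "is_partition b" "is_partition c" by (auto simp: partition_pairs_def)
    have "omega (schur (conjugate c) * schur (conjugate b)) = schur b * schur c"
      using bc by (simp add: Sym_hom_mult[OF omega_hom] mult.commute)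
    then have "schur_coeff (schur (conjugate c) * schur (conjugate b)) lam = schur_coeff (schur b * schur c) (conjugate lam)"
      using schur_coeff_omega[of "schur (conjugate c) * schur (conjugate b)" lam] lam bc by simp
    then show "(case map_prod conjugate conjugate bc of (b, c) \<Rightarrow>
        mps_scale (schur_coeff (schur c * schur b) lam)
          (plethysm (schur (conjugate b)) (h m) * plethysm (schur c) (h (m - 1)))) =
      (case bc of (b, c) \<Rightarrow> mps_scale (schur_coeff (schur b * schur c) (conjugate lam))
          (plethysm (schur b) (h m) * ?\<psi> (schur c)))"
      using bc by simp
  qed (use lam in \<open>auto simp: partition_pairs_def\<close>)
  finally show ?thesis .
qed

lemma schur_coeff_h_mult:
  assumes "is_partition rho" "is_partition nu"
  shows "schur_coeff (h i * schur rho) nu = (if hstrip nu rho \<and> sum_list nu = sum_list rho + i then 1 else 0)"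
  unfolding pieri_h[OF assms(1)] by (subst schur_coeff_sum_schur) (auto simp: assms)

text \<open>The adjoint of the Bernstein formula. The operator \<open>skew_e\<close> is total, but
  \<open>f\<close> is homogeneous, so the coefficient at \<open>nu\<close> after multiplying by
  \<open>h i\<close> sees only the removal of \<open>length mu + i\<close> cells. Indices
  \<open>i\<close> above \<open>sum_list nu\<close> have no effect on that coefficient.\<close>

lemma schur_coeff_via_first_column:
  assumes f: "f \<in> Sym" "homogeneous (sum_list mu) f" and mu: "is_partition mu"
  defines "nu \<equiv> remove_first_column mu"
  shows "schur_coeff f mu = (\<Sum>i\<le>sum_list nu. (- 1) ^ i * schur_coeff (h i * skew_e f) nu)"
proof -
  have nu: "is_partition nu" using partition_remove_first_column[OF mu] by (simp add: nu_def)
  let ?s = "sum_list nu"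
  have basis: "(\<Sum>i\<le>?s. (- 1) ^ i * schur_coeff (h i * skew_e (schur sig)) nu) = (if sig = mu then 1 else 0)"
    if sig: "is_partition sig" "sum_list sig = sum_list mu" for sig
  proof -
    let ?V = "vstrips_under sig"
    have "(\<Sum>i\<le>?s. (- 1) ^ i * schur_coeff (h i * skew_e (schur sig)) nu) =
        (\<Sum>i\<le>?s. \<Sum>rho\<in>?V. (- 1) ^ i * schur_coeff (h i * schur rho) nu)"
      unfolding skew_e_schur[OF sig(1)] sum_distrib_left
      by (subst schur.coeff_sum) (auto simp: sum_distrib_left)
    also have "\<dots> = (\<Sum>rho\<in>?V. \<Sum>i\<le>?s. (- 1) ^ i * schur_coeff (h i * schur rho) nu)"
      by (rule sum.swap)
    also have "\<dots> = (\<Sum>rho\<in>?V. if hstrip nu rho then (- 1) ^ (?s + sum_list rho) else 0)"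
    proof (rule sum.cong[OF refl])
      fix rho assume rho: "rho \<in> ?V"
      \<comment> \<open>The size of the strip from \<open>rho\<close> to \<open>nu\<close> leaves a
        single index \<open>i\<close>.\<close>
      have "(\<Sum>i\<le>?s. (- 1) ^ i * schur_coeff (h i * schur rho) nu) =
          (\<Sum>i\<le>?s. if i = ?s - sum_list rho then (if hstrip nu rho then (- 1) ^ (?s + sum_list rho) else 0) else (0 :: rat))"
      proof (rule sum.cong[OF refl])
        fix i assume "i \<in> {..?s}"
        show "(- 1) ^ i * schur_coeff (h i * schur rho) nu =
          (if i = ?s - sum_list rho then (if hstrip nu rho then (- 1) ^ (?s + sum_list rho) else 0) else 0)"
        proof (cases "hstrip nu rho")
          case True
          then have le: "sum_list rho \<le> ?s" by (rule hstrip_size)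
          then have "(- 1 :: rat) ^ (?s + sum_list rho) = (- 1) ^ (?s - sum_list rho)"
            by (metis (no_types, opaque_lifting) add.commute le_add_diff_inverse minus_one_power_iff even_add even_diff_nat)
          then show ?thesis using True le rho by (auto simp: schur_coeff_h_mult nu)
        next
          case False
          then show ?thesis using rho by (simp add: schur_coeff_h_mult nu)
        qed
      qed
      then show "(\<Sum>i\<le>?s. (- 1) ^ i * schur_coeff (h i * schur rho) nu) =
          (if hstrip nu rho then (- 1) ^ (?s + sum_list rho) else 0)"
        by simp
    qed
    also have "\<dots> = (\<Sum>rho | is_partition rho \<and> vstrip sig rho \<and> hstrip nu rho. (- 1) ^ (?s + sum_list rho))"
      by (rule sum.mono_neutral_cong_right) auto
    also have "\<dots> = (- 1) ^ ?s * (\<Sum>rho | is_partition rho \<and> vstrip sig rho \<and> hstrip nu rho. (- 1) ^ sum_list rho)"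
      by (simp add: sum_distrib_left power_add)
    also have "\<dots> = (if sig = mu then 1 else 0)"
      unfolding nu_def sum_vertical_horizontal_column[OF mu sig] by (simp flip: power_mult_distrib)
    finally show ?thesis .
  qed
  let ?A = "{sig. is_partition sig \<and> schur_coeff f sig \<noteq> 0}"
  have deg: "sum_list sig = sum_list mu" if "sig \<in> ?A" for sig
    using schur.coeff_homogeneous[OF homogeneous_schur f] that by auto
  have rc: "skew_e f = (\<Sum>sig\<in>?A. mps_scale (schur_coeff f sig) (skew_e (schur sig)))"
    by (simp add: skew_e_def schur.extend_def[of _ f] schur.extend_basis)
  have "schur_coeff (h i * skew_e f) nu =
      (\<Sum>sig\<in>?A. schur_coeff f sig * schur_coeff (h i * skew_e (schur sig)) nu)" for i
    unfolding rc sum_distrib_left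
    by (subst schur.coeff_sum) (auto simp: schur.coeff_scale)
  then have "(\<Sum>i\<le>?s. (- 1) ^ i * schur_coeff (h i * skew_e f) nu) =
      (\<Sum>i\<le>?s. \<Sum>sig\<in>?A. schur_coeff f sig * ((- 1) ^ i * schur_coeff (h i * skew_e (schur sig)) nu))"
    by (simp add: sum_distrib_left ac_simps)
  also have "\<dots> = (\<Sum>sig\<in>?A. schur_coeff f sig * (\<Sum>i\<le>?s. (- 1) ^ i * schur_coeff (h i * skew_e (schur sig)) nu))"
    by (subst sum.swap) (simp add: sum_distrib_left)
  also have "\<dots> = (\<Sum>sig\<in>?A. if sig = mu then schur_coeff f mu else 0)"
    by (rule sum.cong) (auto simp: basis deg)
  also have "\<dots> = schur_coeff f mu"
    using mu by simp
  finally show ?thesis by simp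
qed

text \<open>Homogeneity of \<open>g\<close> confines the expansion of \<open>f\<close> to one
  degree, which yields the index set of \<open>skew_plethysm_coeff\<close>.\<close>

lemma schur_coeff_mult_expand:
  assumes f: "f \<in> Sym" and g: "g \<in> Sym" "homogeneous d g" and nu: "is_partition nu"
  shows "schur_coeff (f * g) nu =
    (\<Sum>zeta | is_partition zeta \<and> sum_list zeta + d = sum_list nu. schur_coeff f zeta * schur_coeff (schur zeta * g) nu)"
proof -
  let ?A = "{zeta. is_partition zeta \<and> schur_coeff f zeta \<noteq> 0}"
  let ?B = "{zeta. is_partition zeta \<and> sum_list zeta + d = sum_list nu}"
  have "schur_coeff (f * g) nu = schur_coeff ((\<Sum>zeta\<in>?A. mps_scale (schur_coeff f zeta) (schur zeta)) * g) nu"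
    using schur.expand[OF f] by simp
  also have "\<dots> = (\<Sum>zeta\<in>?A. schur_coeff f zeta * schur_coeff (schur zeta * g) nu)"
    unfolding sum_distrib_right
    by (subst schur.coeff_sum) (auto simp: schur.coeff_scale g)
  also have "\<dots> = (\<Sum>zeta\<in>?A \<union> ?B. schur_coeff f zeta * schur_coeff (schur zeta * g) nu)"
    by (rule sum.mono_neutral_left) auto
  also have "\<dots> = (\<Sum>zeta\<in>?B. schur_coeff f zeta * schur_coeff (schur zeta * g) nu)"
  proof (rule sum.mono_neutral_right)
    show "\<forall>zeta\<in>?A \<union> ?B - ?B. schur_coeff f zeta * schur_coeff (schur zeta * g) nu = 0"
    proof
      fix zeta assume zeta: "zeta \<in> ?A \<union> ?B - ?B"
      have hom: "homogeneous (sum_list zeta + d) (schur zeta * g)"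
        by (rule homogeneous_mult[OF homogeneous_schur g(2)])
      have "schur zeta * g \<in> Sym" using zeta g by auto
      from schur.coeff_homogeneous[OF homogeneous_schur this hom nu]
      have "schur_coeff (schur zeta * g) nu = 0" using zeta by fastforce
      then show "schur_coeff f zeta * schur_coeff (schur zeta * g) nu = 0" by simp
    qed
  qed auto
  finally show ?thesis .
qed

lemma hall_inner_schur:
  assumes "is_partition mu"
  shows "hall_inner f (schur mu) = schur_coeff f mu"
proof -
  have "hall_inner f (schur mu) = (\<Sum>sig | is_partition sig \<and> schur_coeff f sig \<noteq> 0. if sig = mu then schur_coeff f mu else 0)"
    unfolding hall_inner_def by (rule sum.cong) (auto simp: schur.coeff_basis assms)
  then show ?thesis using assms by simp
qed

text \<open>The sum over \<open>\<zeta>\<close> reassembles into one coefficient of a product: it is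
  the Schur expansion of the plethysm, multiplied by \<open>schur \<beta>\<close>.\<close>

lemma skew_plethysm_coeff_eq:
  assumes "is_partition \<alpha>" "is_partition \<beta>" "is_partition \<gamma>"
  shows "skew_plethysm_coeff \<alpha> \<beta> \<gamma> \<delta> (one_row m) =
    (\<Sum>\<eta> | is_partition \<eta> \<and> sum_list \<eta> + sum_list \<delta> = sum_list \<gamma>.
       schur_coeff (schur \<eta> * schur \<delta>) \<gamma> * schur_coeff (plethysm (schur \<eta>) (h m) * schur \<beta>) \<alpha>)"
  unfolding skew_plethysm_coeff_def
proof (rule sum.cong[OF refl])
  fix \<eta>
  have "schur_coeff (plethysm (schur \<eta>) (h m) * schur \<beta>) \<alpha> =
      (\<Sum>\<zeta> | is_partition \<zeta> \<and> sum_list \<zeta> + sum_list \<beta> = sum_list \<alpha>.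
        schur_coeff (plethysm (schur \<eta>) (h m)) \<zeta> * schur_coeff (schur \<zeta> * schur \<beta>) \<alpha>)"
    by (rule schur_coeff_mult_expand) (use assms in \<open>auto simp: homogeneous_schur\<close>)
  then show "(\<Sum>\<zeta> | is_partition \<zeta> \<and> sum_list \<zeta> + sum_list \<beta> = sum_list \<alpha>.
       lr_coeff \<gamma> \<eta> \<delta> * lr_coeff \<alpha> \<zeta> \<beta> * plethysm_coeff \<zeta> \<eta> (one_row m)) =
     schur_coeff (schur \<eta> * schur \<delta>) \<gamma> * schur_coeff (plethysm (schur \<eta>) (h m) * schur \<beta>) \<alpha>"
    using assms by (simp add: sum_distrib_left lr_coeff_def plethysm_coeff_def hall_inner_schur ac_simps)
qed

theorem theoremA:
  fixes n m k :: nat and lam \<mu> :: "nat list"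
  assumes "n > 0" and "m > 0" and "k < n"
    and "lam \<in> partitions_of n"
    and "\<mu> \<in> partitions_of (m * n)"
    and "length \<mu> = n - k"
  shows "plethysm_coeff \<mu> (conjugate lam) (one_row m) =
    (\<Sum>i=0..k. (- 1) ^ (k + i) *
      (\<Sum>\<alpha>\<in>partitions_of (k + (m - 1) * i). \<Sum>\<beta>\<in>partitions_of i.
        skew_plethysm_coeff \<alpha> (one_row (k - i)) (conjugate \<beta>) [] (one_row m) *
        skew_plethysm_coeff (remove_first_column \<mu>) \<alpha> lam \<beta> (one_row (m - 1))))"
proof -
  define \<nu> where "\<nu> = remove_first_column \<mu>"
  obtain m' where m: "m = Suc m'" using \<open>m > 0\<close> by (cases m) auto
  have lam: "is_partition lam" "sum_list lam = n" and \<mu>: "is_partition \<mu>" "sum_list \<mu> = m * n"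
    using assms by (auto simp: partitions_of_def)
  have \<nu>: "is_partition \<nu>" using partition_remove_first_column[OF \<mu>(1)] by (simp add: \<nu>_def)
  have size: "sum_list \<nu> = m' * n + k"
    using sum_list_remove_first_column[OF \<mu>(1)] \<mu>(2) assms(3,6) by (simp add: \<nu>_def m)
  define P where "P \<beta> = plethysm (schur (conjugate \<beta>)) (h m)" for \<beta>
  define Q where "Q \<eta> = plethysm (schur \<eta>) (h m')" for \<eta>
  define c where "c \<beta> \<eta> = schur_coeff (schur \<eta> * schur \<beta>) lam" for \<beta> \<eta>
  define t where "t i \<beta> \<eta> = schur_coeff (h i * (P \<beta> * Q \<eta>)) \<nu>" for i \<beta> \<eta>
  have Sym_PQ: "P \<beta> \<in> Sym" "Q \<eta> \<in> Sym" for \<beta> \<eta> by (auto simp: P_def Q_def)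
  have hom_P: "homogeneous (sum_list \<beta> * m) (P \<beta>)" if "is_partition \<beta>" for \<beta>
    unfolding P_def using homogeneous_plethysm[OF _ homogeneous_schur homogeneous_schur, of "conjugate \<beta>" "one_row m"] that
    by simp
  have hom_Q: "homogeneous (sum_list \<eta> * m') (Q \<eta>)" if "is_partition \<eta>" for \<eta>
    unfolding Q_def using homogeneous_plethysm[OF _ homogeneous_schur homogeneous_schur, of \<eta> "one_row m'"] that
    by simp
  \<comment> \<open>The product has degree \<open>i + m * |\<beta>| + m' * |\<eta>|\<close>, which
    is \<open>i + |\<beta>| + m' * n\<close>, while \<open>\<nu>\<close> has size
    \<open>m' * n + k\<close>.\<close>
  have t_degree: "i + sum_list \<beta> = k" if "t i \<beta> \<eta> \<noteq> 0" "(\<beta>, \<eta>) \<in> partition_pairs n" for i \<beta> \<eta>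
  proof -
    have p: "is_partition \<beta>" "is_partition \<eta>" "sum_list \<beta> + sum_list \<eta> = n"
      using that by (auto simp: partition_pairs_def)
    have hom: "homogeneous (i + (sum_list \<beta> * m + sum_list \<eta> * m')) (h i * (P \<beta> * Q \<eta>))"
      using homogeneous_mult[OF homogeneous_schur[of "one_row i"] homogeneous_mult[OF hom_P hom_Q]] p by simp
    have "h i * (P \<beta> * Q \<eta>) \<in> Sym" using Sym_PQ by auto
    from schur.coeff_homogeneous[OF homogeneous_schur this hom \<nu>]
    have "sum_list \<nu> = i + (sum_list \<beta> * m + sum_list \<eta> * m')"
      using that(1) by (simp add: t_def)
    also have "\<dots> = i + sum_list \<beta> + m' * n"
      by (simp add: m p(3)[symmetric] algebra_simps)
    finally show ?thesis using size by simp
  qed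
  have "plethysm_coeff \<mu> (conjugate lam) (one_row m) = schur_coeff (P lam) \<mu>"
    by (simp add: plethysm_coeff_def hall_inner_schur \<mu> P_def)
  also have "\<dots> = (\<Sum>i\<le>sum_list \<nu>. (- 1) ^ i * schur_coeff (h i * skew_e (P lam)) \<nu>)"
    unfolding \<nu>_def
    by (rule schur_coeff_via_first_column) (use Sym_PQ hom_P[OF lam(1)] lam \<mu> in \<open>auto simp: mult.commute\<close>)
  also have "\<dots> = (\<Sum>i\<le>sum_list \<nu>. \<Sum>(\<beta>, \<eta>)\<in>partition_pairs n. c \<beta> \<eta> * ((- 1) ^ i * t i \<beta> \<eta>))"
  proof (rule sum.cong[OF refl])
    fix i
    have "h i * skew_e (P lam) = (\<Sum>(\<beta>, \<eta>)\<in>partition_pairs n. mps_scale (c \<beta> \<eta>) (h i * (P \<beta> * Q \<eta>)))"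
      unfolding P_def skew_e_plethysm[OF assms(2) lam(1)] lam(2)
      by (simp add: sum_distrib_left c_def Q_def m case_prod_unfold)
    then have "schur_coeff (h i * skew_e (P lam)) \<nu> = (\<Sum>(\<beta>, \<eta>)\<in>partition_pairs n. c \<beta> \<eta> * t i \<beta> \<eta>)"
      unfolding case_prod_unfold
      by (simp only:, subst schur.coeff_sum) (auto simp: schur.coeff_scale Sym_PQ t_def)
    then show "(- 1) ^ i * schur_coeff (h i * skew_e (P lam)) \<nu> =
        (\<Sum>(\<beta>, \<eta>)\<in>partition_pairs n. c \<beta> \<eta> * ((- 1) ^ i * t i \<beta> \<eta>))"
      by (simp add: sum_distrib_left case_prod_unfold ac_simps)
  qed
  also have "\<dots> = (\<Sum>(\<beta>, \<eta>)\<in>partition_pairs n. \<Sum>i\<le>sum_list \<nu>. c \<beta> \<eta> * ((- 1) ^ i * t i \<beta> \<eta>))"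
    unfolding case_prod_unfold by (rule sum.swap)
  \<comment> \<open>Each pair determines the Bernstein index as \<open>k - sum_list \<beta>\<close>.
    From here the sum is organised by the size of \<open>\<beta>\<close>, and this size is the index
    \<open>i\<close> of the theorem.\<close>
  also have "\<dots> = (\<Sum>(\<beta>, \<eta>)\<in>partition_pairs n. if sum_list \<beta> \<le> k
      then c \<beta> \<eta> * ((- 1) ^ (k + sum_list \<beta>) * t (k - sum_list \<beta>) \<beta> \<eta>) else 0)"
  proof (rule sum.cong[OF refl], safe)
    fix \<beta> \<eta> assume p: "(\<beta>, \<eta>) \<in> partition_pairs n"
    show "(\<Sum>i\<le>sum_list \<nu>. c \<beta> \<eta> * ((- 1) ^ i * t i \<beta> \<eta>)) = (if sum_list \<beta> \<le> k
      then c \<beta> \<eta> * ((- 1) ^ (k + sum_list \<beta>) * t (k - sum_list \<beta>) \<beta> \<eta>) else 0)"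
    proof (cases "sum_list \<beta> \<le> k")
      case True
      have "(\<Sum>i\<le>sum_list \<nu>. c \<beta> \<eta> * ((- 1) ^ i * t i \<beta> \<eta>)) =
          (\<Sum>i\<in>{k - sum_list \<beta>}. c \<beta> \<eta> * ((- 1) ^ i * t i \<beta> \<eta>))"
        by (rule sum.mono_neutral_right) (use t_degree[OF _ p] size in fastforce)+
      moreover have "(- 1 :: rat) ^ (k + sum_list \<beta>) = (- 1) ^ (k - sum_list \<beta>)"
        using True by (simp add: minus_one_power_iff)
      ultimately show ?thesis using True by simp
    next
      case False
      then have "t i \<beta> \<eta> = 0" for i using t_degree[OF _ p, of i] by auto
      then show ?thesis using False by simp
    qed
  qed
  also have "\<dots> = (\<Sum>p | p \<in> partition_pairs n \<and> sum_list (fst p) \<le> k.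
      c (fst p) (snd p) * ((- 1) ^ (k + sum_list (fst p)) * t (k - sum_list (fst p)) (fst p) (snd p)))"
    unfolding case_prod_unfold by (rule sum.inter_filter[symmetric]) simp
  also have "\<dots> = (\<Sum>i\<in>{0..k}. \<Sum>p\<in>(SIGMA \<beta>:partitions_of i. {\<eta>. is_partition \<eta> \<and> sum_list \<eta> + i = n}).
      c (fst p) (snd p) * ((- 1) ^ (k + i) * t (k - i) (fst p) (snd p)))"
  proof -
    let ?I = "\<lambda>i. SIGMA \<beta>:partitions_of i. {\<eta>. is_partition \<eta> \<and> sum_list \<eta> + i = n}"
    let ?F = "\<lambda>p. c (fst p) (snd p) * ((- 1) ^ (k + sum_list (fst p)) * t (k - sum_list (fst p)) (fst p) (snd p))"
    have "{p. p \<in> partition_pairs n \<and> sum_list (fst p) \<le> k} = (\<Union>i\<in>{0..k}. ?I i)"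
      by (auto simp: partition_pairs_def partitions_of_def)
    moreover have "(\<Sum>p\<in>(\<Union>i\<in>{0..k}. ?I i). ?F p) = (\<Sum>i\<in>{0..k}. \<Sum>p\<in>?I i. ?F p)"
    proof (rule sum.UNION_disjoint)
      show "\<forall>i\<in>{0..k}. finite (?I i)" by (intro ballI finite_SigmaI) auto
    qed (auto simp: partitions_of_def)
    moreover have "(\<Sum>p\<in>?I i. ?F p) = (\<Sum>p\<in>?I i. c (fst p) (snd p) * ((- 1) ^ (k + i) * t (k - i) (fst p) (snd p)))" for i
      by (rule sum.cong) (auto simp: partitions_of_def)
    ultimately show ?thesis by simp
  qed
  also have "\<dots> = (\<Sum>i=0..k. (- 1) ^ (k + i) * (\<Sum>\<beta>\<in>partitions_of i.
      \<Sum>\<eta> | is_partition \<eta> \<and> sum_list \<eta> + i = n. c \<beta> \<eta> * t (k - i) \<beta> \<eta>))"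
  proof (rule sum.cong[OF refl])
    fix i
    show "(\<Sum>p\<in>(SIGMA \<beta>:partitions_of i. {\<eta>. is_partition \<eta> \<and> sum_list \<eta> + i = n}).
      c (fst p) (snd p) * ((- 1) ^ (k + i) * t (k - i) (fst p) (snd p))) =
      (- 1) ^ (k + i) * (\<Sum>\<beta>\<in>partitions_of i.
      \<Sum>\<eta> | is_partition \<eta> \<and> sum_list \<eta> + i = n. c \<beta> \<eta> * t (k - i) \<beta> \<eta>)"
      by (simp add: sum.cartesian_product sum_distrib_left case_prod_unfold ac_simps)
  qed
  also have "\<dots> = (\<Sum>i=0..k. (- 1) ^ (k + i) * (\<Sum>\<alpha>\<in>partitions_of (k + (m - 1) * i). \<Sum>\<beta>\<in>partitions_of i.
        skew_plethysm_coeff \<alpha> (one_row (k - i)) (conjugate \<beta>) [] (one_row m) *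
        skew_plethysm_coeff (remove_first_column \<mu>) \<alpha> lam \<beta> (one_row (m - 1))))"
  proof (rule sum.cong[OF refl])
    fix i assume i: "i \<in> {0..k}"
    let ?E = "{\<eta>. is_partition \<eta> \<and> sum_list \<eta> + i = n}"
    let ?A = "partitions_of (k + m' * i)"
    let ?s = "\<lambda>\<alpha> \<beta>. skew_plethysm_coeff \<alpha> (one_row (k - i)) (conjugate \<beta>) [] (one_row m) *
        skew_plethysm_coeff \<nu> \<alpha> lam \<beta> (one_row m')"
    \<comment> \<open>Here \<open>\<alpha>\<close> arises: the product of \<open>P \<beta>\<close>
      and \<open>h (k - i)\<close> is expanded into Schur functions, and the degree of
      \<open>Q \<eta>\<close> fixes the size of \<open>\<alpha>\<close>.\<close>
    have t_expand: "t (k - i) \<beta> \<eta> = (\<Sum>\<alpha>\<in>?A. schur_coeff (P \<beta> * h (k - i)) \<alpha> * schur_coeff (Q \<eta> * schur \<alpha>) \<nu>)"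
      if "\<eta> \<in> ?E" for \<beta> \<eta>
    proof -
      have "sum_list \<alpha> + sum_list \<eta> * m' = sum_list \<nu> \<longleftrightarrow> sum_list \<alpha> = k + m' * i" for \<alpha>
        using that size by (auto simp: algebra_simps)
      then have A: "{\<alpha>. is_partition \<alpha> \<and> sum_list \<alpha> + sum_list \<eta> * m' = sum_list \<nu>} = ?A"
        by (auto simp: partitions_of_def)
      have "t (k - i) \<beta> \<eta> = schur_coeff (P \<beta> * h (k - i) * Q \<eta>) \<nu>" by (simp add: t_def ac_simps)
      also have "\<dots> = (\<Sum>\<alpha>\<in>?A. schur_coeff (P \<beta> * h (k - i)) \<alpha> * schur_coeff (schur \<alpha> * Q \<eta>) \<nu>)"
        unfolding A[symmetric]
        by (rule schur_coeff_mult_expand) (use Sym_PQ hom_Q that \<nu> in auto)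
      finally show ?thesis by (simp add: mult.commute)
    qed
    \<comment> \<open>With an empty inner lower shape, the coefficient of
      \<open>schur \<eta>\<close> at \<open>conjugate \<beta>\<close> leaves only
      \<open>\<eta> = conjugate \<beta>\<close>.\<close>
    have skew1: "skew_plethysm_coeff \<alpha> (one_row (k - i)) (conjugate \<beta>) [] (one_row m) = schur_coeff (P \<beta> * h (k - i)) \<alpha>"
      if "\<alpha> \<in> ?A" "\<beta> \<in> partitions_of i" for \<alpha> \<beta>
    proof -
      have p: "is_partition \<alpha>" "is_partition \<beta>" using that by (auto simp: partitions_of_def)
      have "skew_plethysm_coeff \<alpha> (one_row (k - i)) (conjugate \<beta>) [] (one_row m) =
        (\<Sum>\<eta> | is_partition \<eta> \<and> sum_list \<eta> + sum_list [] = sum_list (conjugate \<beta>).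
          if \<eta> = conjugate \<beta> then schur_coeff (P \<beta> * h (k - i)) \<alpha> else 0)"
        using p by (subst skew_plethysm_coeff_eq) (auto simp: schur.coeff_basis P_def intro!: sum.cong)
      then show ?thesis
        using p finite_partitions_of[of "sum_list \<beta>"] by (simp add: partitions_of_def)
    qed
    have skew2: "skew_plethysm_coeff \<nu> \<alpha> lam \<beta> (one_row m') = (\<Sum>\<eta>\<in>?E. c \<beta> \<eta> * schur_coeff (Q \<eta> * schur \<alpha>) \<nu>)"
      if "\<alpha> \<in> ?A" "\<beta> \<in> partitions_of i" for \<alpha> \<beta>
      using that lam \<nu> by (subst skew_plethysm_coeff_eq) (auto simp: partitions_of_def c_def Q_def)
    have "(\<Sum>\<beta>\<in>partitions_of i. \<Sum>\<eta>\<in>?E. c \<beta> \<eta> * t (k - i) \<beta> \<eta>) =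
        (\<Sum>\<beta>\<in>partitions_of i. \<Sum>\<eta>\<in>?E. \<Sum>\<alpha>\<in>?A.
          schur_coeff (P \<beta> * h (k - i)) \<alpha> * (c \<beta> \<eta> * schur_coeff (Q \<eta> * schur \<alpha>) \<nu>))"
      by (intro sum.cong refl) (simp add: t_expand sum_distrib_left ac_simps)
    also have "\<dots> = (\<Sum>\<beta>\<in>partitions_of i. \<Sum>\<alpha>\<in>?A.
          schur_coeff (P \<beta> * h (k - i)) \<alpha> * (\<Sum>\<eta>\<in>?E. c \<beta> \<eta> * schur_coeff (Q \<eta> * schur \<alpha>) \<nu>))"
      unfolding sum_distrib_left by (rule sum.cong[OF refl], rule sum.swap)
    also have "\<dots> = (\<Sum>\<beta>\<in>partitions_of i. \<Sum>\<alpha>\<in>?A. ?s \<alpha> \<beta>)"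
      by (intro sum.cong refl) (simp add: skew1 skew2)
    also have "\<dots> = (\<Sum>\<alpha>\<in>?A. \<Sum>\<beta>\<in>partitions_of i. ?s \<alpha> \<beta>)"
      by (rule sum.swap)
    finally show "(- 1) ^ (k + i) * (\<Sum>\<beta>\<in>partitions_of i. \<Sum>\<eta>\<in>?E. c \<beta> \<eta> * t (k - i) \<beta> \<eta>) =
      (- 1) ^ (k + i) * (\<Sum>\<alpha>\<in>partitions_of (k + (m - 1) * i). \<Sum>\<beta>\<in>partitions_of i.
        skew_plethysm_coeff \<alpha> (one_row (k - i)) (conjugate \<beta>) [] (one_row m) *
        skew_plethysm_coeff (remove_first_column \<mu>) \<alpha> lam \<beta> (one_row (m - 1)))"
      by (simp add: m \<nu>_def)
  qed
  finally show ?thesis .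
qed

end
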